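(* Every left-invariant complex structure on $\mathrm{SL}(3,\mathbb{R})$ is equivalent to one and only one of the left-invariant complex structures corresponding to the invariant complex subalgebras $\mathrm{I}_\lambda$ (with $\lambda\in\mathbb{C}$, $|\lambda|<1$) and $\mathrm{II}$ of $\mathfrak{sl}(3,\mathbb{C})$, where $\mathrm{I}_\lambda$ is the complex span of $$U=\tfrac12\begin{bmatrix}1-\lambda&-i(\lambda+1)&0\\ i(\lambda+1)&1-\lambda&0\\0&0&-2(1-\lambda)\end{bmatrix},\quad X=\tfrac1{\sqrt2}\begin{bmatrix}0&0&1\\0&0&i\\0&0&0\end{bmatrix},\quad Y=\tfrac1{\sqrt2}\begin{bmatrix}0&0&0\\0&0&0\\1&i&0\end{bmatrix},\quad Z=\tfrac12\begin{bmatrix}1&i&0\\i&-1&0\\0&0&0\end{bmatrix},$$ and $\mathrm{II}$ is the complex span of $$U=\tfrac12\begin{bmatrix}-1&-3i&0\\3i&-1&0\\0&0&2\end{bmatrix},\quad X=\tfrac1{\sqrt2}\begin{bmatrix}0&0&1\\0&0&i\\1&-i&0\end{bmatrix},\quad Y=\tfrac1{\sqrt2}\begin{bmatrix}0&0&0\\0&0&0\\1&i&0\end{bmatrix},\quad Z=\tfrac12\begin{bmatrix}1&i&0\\i&-1&0\\0&0&0\end{bmatrix}.$$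
   Context: A complex structure on a real Lie algebra $\mathfrak g$ is a linear map $J:\mathfrak g\to\mathfrak g$ with $J^2=-\mathrm{Id}$ and $[x,y]+J([Jx,y]+[x,Jy])-[Jx,Jy]=0$ for all $x,y\in\mathfrak g$; left-invariant complex structures on a Lie group correspond to complex structures on its Lie algebra. Two complex structures $J_1,J_2$ on $\mathfrak g$ are equivalent if there is a Lie algebra automorphism $\varphi$ of $\mathfrak g$ with $J_1\circ\varphi=\varphi\circ J_2$. Let $\sigma$ be the complex conjugation of $\mathfrak g^{\mathbb C}$ with respect to $\mathfrak g$ (for $\mathfrak g=\mathfrak{sl}(3,\mathbb R)$: entrywise conjugation on $\mathfrak{sl}(3,\mathbb C)$). An invariant complex subalgebra is a complex Lie subalgebra $\mathfrak m\subset\mathfrak g^{\mathbb C}$ with $\mathfrak g^{\mathbb C}=\mathfrak m\oplus\sigma(\mathfrak m)$. It corresponds to the complex structure $J$ on $\mathfrak g$ whose $\mathbb C$-linear extension is $-i$ on $\mathfrak m$ and $+i$ on $\sigma(\mathfrak m)$; this is a bijection between invariant complex subalgebras and complex structures on $\mathfrak g$. *)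

theory Defs
  imports "HOL-Analysis.Analysis"
begin

section \<open>Matrix Lie algebras\<close>

definition lie_bracket :: "'a::comm_ring_1^'n^'n \<Rightarrow> 'a^'n^'n \<Rightarrow> 'a^'n^'n" where
  "lie_bracket A B = A ** B - B ** A"

definition sl :: "('a::comm_ring_1^'n^'n) set" where
  "sl = {A. trace A = 0}"

text \<open>
  HOL-Analysis makes \<^typ>\<open>complex^'n^'n\<close> a real vector space only. The following
  scalar multiplication makes it a complex vector space, which gives access to the library
  notions of complex subspace and complex span.
\<close>

definition cscale :: "complex \<Rightarrow> complex^'n^'n \<Rightarrow> complex^'n^'n" (infixr \<open>*\<^sub>C\<close> 75) where
  "c *\<^sub>C A = map_matrix ((*) c) A"

interpretation cmat: vector_space "(*\<^sub>C) :: complex \<Rightarrow> complex^'n^'n \<Rightarrow> complex^'n^'n"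
  by unfold_locales (simp_all add: cscale_def vec_eq_iff algebra_simps)

section \<open>Complex structures on \<open>sl(n, \<real>)\<close>\<close>

text \<open>
  A linear map of \<open>sl(n, \<real>)\<close> is represented by a function on all real matrices of which
  only the restriction to \<^const>\<open>sl\<close> matters.
\<close>

definition linear_on_sl :: "(real^'n^'n \<Rightarrow> real^'n^'n) \<Rightarrow> bool" where
  "linear_on_sl f \<longleftrightarrow>
     (\<forall>A\<in>sl. f A \<in> sl) \<and>
     (\<forall>A\<in>sl. \<forall>B\<in>sl. f (A + B) = f A + f B) \<and>
     (\<forall>c. \<forall>A\<in>sl. f (c *\<^sub>R A) = c *\<^sub>R f A)"

definition complex_structure :: "(real^'n^'n \<Rightarrow> real^'n^'n) \<Rightarrow> bool" where
  "complex_structure J \<longleftrightarrow>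
     linear_on_sl J \<and>
     (\<forall>A\<in>sl. J (J A) = - A) \<and>
     (\<forall>A\<in>sl. \<forall>B\<in>sl.
        lie_bracket A B + J (lie_bracket (J A) B + lie_bracket A (J B))
          - lie_bracket (J A) (J B) = 0)"

definition lie_automorphism :: "(real^'n^'n \<Rightarrow> real^'n^'n) \<Rightarrow> bool" where
  "lie_automorphism \<phi> \<longleftrightarrow>
     linear_on_sl \<phi> \<and> bij_betw \<phi> sl sl \<and>
     (\<forall>A\<in>sl. \<forall>B\<in>sl. \<phi> (lie_bracket A B) = lie_bracket (\<phi> A) (\<phi> B))"

definition equivalent_structures ::
  "(real^'n^'n \<Rightarrow> real^'n^'n) \<Rightarrow> (real^'n^'n \<Rightarrow> real^'n^'n) \<Rightarrow> bool" where
  "equivalent_structures J\<^sub>1 J\<^sub>2 \<longleftrightarrow>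
     (\<exists>\<phi>. lie_automorphism \<phi> \<and> (\<forall>A\<in>sl. J\<^sub>1 (\<phi> A) = \<phi> (J\<^sub>2 A)))"

section \<open>Invariant complex subalgebras of \<open>sl(n, \<complex>)\<close>\<close>

definition conj_mat :: "complex^'n^'n \<Rightarrow> complex^'n^'n" where
  "conj_mat = map_matrix cnj"

definition invariant_complex_subalgebra :: "(complex^'n^'n) set \<Rightarrow> bool" where
  "invariant_complex_subalgebra M \<longleftrightarrow>
     M \<subseteq> sl \<and> cmat.subspace M \<and>
     (\<forall>A\<in>M. \<forall>B\<in>M. lie_bracket A B \<in> M) \<and>
     M \<inter> conj_mat ` M = {0} \<and>
     {A + B |A B. A \<in> M \<and> B \<in> conj_mat ` M} = sl"

definition complex_linear_extension ::
  "(real^'n^'n \<Rightarrow> real^'n^'n) \<Rightarrow> complex^'n^'n \<Rightarrow> complex^'n^'n" where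
  "complex_linear_extension J A =
     map_matrix complex_of_real (J (map_matrix Re A)) +
     \<i> *\<^sub>C map_matrix complex_of_real (J (map_matrix Im A))"

text \<open>
  For an invariant complex subalgebra \<open>M\<close> the following relation determines \<open>J\<close> on \<^const>\<open>sl\<close>;
  it is a relation rather than a function of \<open>M\<close> because \<open>J\<close> is arbitrary outside \<^const>\<open>sl\<close>.
\<close>

definition corresponds :: "(complex^'n^'n) set \<Rightarrow> (real^'n^'n \<Rightarrow> real^'n^'n) \<Rightarrow> bool" where
  "corresponds M J \<longleftrightarrow>
     complex_structure J \<and>
     (\<forall>A\<in>M. complex_linear_extension J A = (- \<i>) *\<^sub>C A) \<and>
     (\<forall>A\<in>conj_mat ` M. complex_linear_extension J A = \<i> *\<^sub>C A)"

section \<open>The subalgebras \<open>I\<^sub>\<lambda>\<close> and \<open>II\<close> of \<open>sl(3, \<complex>)\<close>\<close>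

definition algebra_I :: "complex \<Rightarrow> (complex^3^3) set" where
  "algebra_I l = cmat.span {
     (1/2) *\<^sub>C vector [vector [1 - l, - \<i> * (l + 1), 0],
                     vector [\<i> * (l + 1), 1 - l, 0],
                     vector [0, 0, - 2 * (1 - l)]],
     complex_of_real (1 / sqrt 2) *\<^sub>C
              vector [vector [0, 0, 1],
                     vector [0, 0, \<i>],
                     vector [0, 0, 0]],
     complex_of_real (1 / sqrt 2) *\<^sub>C
              vector [vector [0, 0, 0],
                     vector [0, 0, 0],
                     vector [1, \<i>, 0]],
     (1/2) *\<^sub>C vector [vector [1, \<i>, 0],
                     vector [\<i>, - 1, 0],
                     vector [0, 0, 0]]}"

definition algebra_II :: "(complex^3^3) set" where
  "algebra_II = cmat.span {
     (1/2) *\<^sub>C vector [vector [- 1, - 3 * \<i>, 0],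
                     vector [3 * \<i>, - 1, 0],
                     vector [0, 0, 2]],
     complex_of_real (1 / sqrt 2) *\<^sub>C
              vector [vector [0, 0, 1],
                     vector [0, 0, \<i>],
                     vector [1, - \<i>, 0]],
     complex_of_real (1 / sqrt 2) *\<^sub>C
              vector [vector [0, 0, 0],
                     vector [0, 0, 0],
                     vector [1, \<i>, 0]],
     (1/2) *\<^sub>C vector [vector [1, \<i>, 0],
                     vector [\<i>, - 1, 0],
                     vector [0, 0, 0]]}"

text \<open>
  The members of the list are indexed by labels, so that uniqueness is uniqueness of the label,
  including uniqueness of the parameter \<open>\<lambda>\<close>.
\<close>

datatype label = Label_I complex | Label_II

definition labels :: "label set" where
  "labels = insert Label_II {Label_I l |l. cmod l < 1}"

primrec label_algebra :: "label \<Rightarrow> (complex^3^3) set" where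
  "label_algebra (Label_I l) = algebra_I l"
| "label_algebra Label_II = algebra_II"

end

theory Submission
  imports Defs "HOL-Computational_Algebra.Fundamental_Theorem_Algebra"
begin

text \<open>
  A complex structure \<open>J\<close> is encoded by its \<open>-\<i>\<close>-eigenspace \<open>m\<close>, a
  4-dimensional complex subalgebra of \<open>sl(3)\<close> complementary to its conjugate.

  Reducibility. The alternating 3-form \<open>tr (x[y, z])\<close> on the 4-dimensional \<open>m\<close> has a nonzero
  kernel, which is the ideal \<open>k = m \<inter> [m, m]\<^sup>\<bottom>\<close>. By the argument of Cartan's
  criterion \<open>[m, k]\<close> consists of nilpotent matrices. If it vanishes, any element of \<open>k\<close> is
  central and its eigenspaces are invariant; otherwise the common kernel of \<open>[m, k]\<close>, nonzero by Engel's
  theorem, is invariant. So \<open>m\<close> has an invariant line or plane, and by the outer automorphism \<open>A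
  \<mapsto> -A\<^sup>T\<close> we may assume an invariant line \<open>L\<close>, which is not real.

  Flag. In a basis \<open>(v, e, v\<^sup>*)\<close> with \<open>v \<in> L\<close>, \<open>v\<^sup>*\<close> its
  conjugate and \<open>e\<close> real, conjugation becomes \<open>A \<mapsto> S conj(A) S\<close> with
  \<open>S\<close> antidiagonal. Let \<open>n\<close> be the part of \<open>m\<close> acting trivially on
  \<open>L\<close> and on the quotient by \<open>L\<close>. If \<open>dim n = 1\<close>, its kernel is an invariant
  plane through \<open>L\<close>; if \<open>dim n = 2\<close>, such a plane exists since \<open>m/n\<close> is a
  2-dimensional subalgebra of \<open>gl(2)\<close>; if \<open>n = 0\<close>, then \<open>m\<close> is a centralizer
  isomorphic to \<open>gl(2)\<close>, which meets its conjugate. Hence \<open>m\<close> is a hyperplane in a Borel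
  subalgebra, and being closed under the bracket it is either of type \<open>I\<close> or, up to an explicit real
  change of basis and the outer automorphism, of type \<open>II\<close>.

  Uniqueness. Already the abstract Lie algebras in the list are pairwise non-isomorphic: type \<open>I\<close> with
  parameter \<open>\<lambda>\<close> has weights \<open>(2 - \<lambda> : 2\<lambda> - 1 : 1 + \<lambda>)\<close>,
  which determine \<open>\<lambda>\<close> up to inversion, and a torus of rank one, whereas type \<open>II\<close> is
  a product of two copies of the affine algebra.
\<close>

section \<open>Matrices and invariant subalgebras\<close>

lemma mat3_eq: "A = B \<longleftrightarrow> A$1$1=B$1$1 \<and> A$1$2=B$1$2 \<and> A$1$3=B$1$3 \<and> A$2$1=B$2$1 \<and> A$2$2=B$2$2 \<and> A$2$3=B$2$3
   \<and> A$3$1=B$3$1 \<and> A$3$2=B$3$2 \<and> A$3$3=B$3$3"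
  for A B :: "'a^3^3"
  by (auto simp: vec_eq_iff forall_3)

lemma mult3: "(A ** B)$i$j = A$i$1*B$1$j + A$i$2*B$2$j + A$i$3*B$3$j"
  for A B :: "'a::comm_ring_1^3^3"
  by (simp add: matrix_matrix_mult_def sum_3)

lemma multv3: "(A *v v)$i = A$i$1* v$1 + A$i$2* v$2 + A$i$3* v$3"
  for A :: "'a::comm_ring_1^3^3"
  by (simp add: matrix_vector_mult_def sum_3)

lemma trace3: "trace A = A$1$1 + A$2$2 + A$3$3"
  for A :: "'a::comm_ring_1^3^3"
  by (simp add: trace_def sum_3)

lemma cscale_nth [simp]: "(c *\<^sub>C A)$i$j = c * A$i$j"
  by (simp add: cscale_def)

lemma conj_mat_nth [simp]: "(conj_mat A)$i$j = cnj (A$i$j)"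
  by (simp add: conj_mat_def)

lemma cscale_mult_left [simp]: "(c *\<^sub>C A) ** B = c *\<^sub>C (A ** B)"
  and cscale_mult_right [simp]: "A ** (c *\<^sub>C B) = c *\<^sub>C (A ** B)"
  by (simp_all add: vec_eq_iff matrix_matrix_mult_def sum_distrib_left mult_ac)

lemma cscale_multv: "(c *\<^sub>C A) *v u = c *s (A *v u)"
  by (simp add: vec_eq_iff matrix_vector_mult_def sum_distrib_left mult_ac)

lemma trace_cscale [simp]: "trace (c *\<^sub>C A) = c * trace A"
  by (simp add: trace_def sum_distrib_left)

lemma trace_uminus: "trace (- A) = - trace A" for A :: "'a::comm_ring_1^'n^'n"
  by (simp add: trace_def sum_negf)

lemma bracket_nth: "(lie_bracket A B)$i$j = (A**B)$i$j - (B**A)$i$j"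
  by (simp add: lie_bracket_def)

lemma bracket_anti: "lie_bracket A B = - lie_bracket B A"
  by (simp add: lie_bracket_def)

lemma matrix_diff_distrib:
  "A ** (B - C) = A ** B - A ** C" "(B - C) ** A = B ** A - C ** A"
  for A B C :: "'a::comm_ring_1^'n^'n"
  by (simp_all add: vec_eq_iff matrix_matrix_mult_def sum_subtractf right_diff_distrib left_diff_distrib)

lemma trace_bracket_cycle: "trace (lie_bracket A B ** C) = trace (B ** lie_bracket C A)"
  for A B C :: "complex^'n^'n"
proof -
  have "trace (A ** (B ** C)) = trace (B ** C ** A)" by (rule trace_mul_sym)
  thus ?thesis
    by (simp add: lie_bracket_def matrix_diff_distrib trace_sub matrix_mul_assoc)
qed

section \<open>Matrix units and complex dimension\<close>

definition mat_unit :: "'n \<Rightarrow> 'n \<Rightarrow> complex^'n^'n" where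
  "mat_unit i j = (\<chi> a b. if a = i \<and> b = j then 1 else 0)"

lemma mat_unit_nth [simp]: "mat_unit i j $ a $ b = (if a = i \<and> b = j then 1 else 0)"
  by (simp add: mat_unit_def)

definition mat_basis :: "(complex^'n^'n) set" where
  "mat_basis = (\<lambda>(i,j). mat_unit i j) ` UNIV"

lemma inj_mat_unit: "inj (\<lambda>(i,j). mat_unit i j :: complex^'n^'n)"
proof (rule injI, clarify)
  fix i j k l assume "(mat_unit i j :: complex^'n^'n) = mat_unit k l"
  hence "(mat_unit i j :: complex^'n^'n) $ i $ j = mat_unit k l $ i $ j" by simp
  thus "i = k \<and> j = l" by (simp split: if_splits)
qed

lemma sum_mat_units:
  "(\<Sum>p\<in>UNIV. c p *\<^sub>C (\<lambda>(i,j). mat_unit i j :: complex^'n^'n) p) $ a $ b = c (a,b)"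
proof -
  have "(\<Sum>p\<in>UNIV. c p *\<^sub>C (\<lambda>(i,j). mat_unit i j :: complex^'n^'n) p) $ a $ b
      = (\<Sum>p\<in>UNIV. (c p *\<^sub>C (\<lambda>(i,j). mat_unit i j :: complex^'n^'n) p) $ a $ b)"
    by (simp only: sum_component)
  also have "\<dots> = (\<Sum>p\<in>UNIV. if p = (a,b) then c p else 0)"
    by (rule sum.cong) (auto split: prod.splits)
  finally have "(\<Sum>p\<in>UNIV. c p *\<^sub>C (\<lambda>(i,j). mat_unit i j :: complex^'n^'n) p) $ a $ b
      = (\<Sum>p\<in>UNIV. if p = (a,b) then c p else 0)" .
  thus ?thesis by simp
qed

text \<open>With the matrix units as a basis, \<open>cmat.dim\<close> is the complex dimension; all
  dimension counts below are over the complex numbers.\<close>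

interpretation cmatfd: finite_dimensional_vector_space "(*\<^sub>C)" "mat_basis :: (complex^'n^'n) set"
proof
  let ?E = "\<lambda>(i,j). mat_unit i j :: complex^'n^'n"
  show "finite (mat_basis :: (complex^'n^'n) set)"
    by (simp add: mat_basis_def)
  show "\<not> cmat.dependent (mat_basis :: (complex^'n^'n) set)"
  proof (rule cmat.independent_if_scalars_zero)
    show "finite (mat_basis :: (complex^'n^'n) set)"
      by (simp add: mat_basis_def)
  next
    fix f :: "complex^'n^'n \<Rightarrow> complex" and x :: "complex^'n^'n"
    assume s: "(\<Sum>x\<in>mat_basis. f x *\<^sub>C x) = 0" and x: "x \<in> mat_basis"
    obtain i j where ij: "x = mat_unit i j"
      using x by (auto simp: mat_basis_def)
    have "(\<Sum>x\<in>mat_basis. f x *\<^sub>C x) = (\<Sum>p\<in>UNIV. f (?E p) *\<^sub>C ?E p)"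
      unfolding mat_basis_def by (subst sum.reindex[OF inj_mat_unit]) simp
    hence "0 = (\<Sum>p\<in>UNIV. f (?E p) *\<^sub>C ?E p) $ i $ j"
      using s by (metis zero_index)
    also have "\<dots> = f (?E (i, j))" by (rule sum_mat_units)
    finally show "f x = 0" using ij by simp
  qed
  show "cmat.span (mat_basis :: (complex^'n^'n) set) = UNIV"
  proof (rule UNIV_eq_I[symmetric])
    fix A :: "complex^'n^'n"
    have "A = (\<Sum>p\<in>UNIV. (\<lambda>(i,j). A$i$j) p *\<^sub>C ?E p)"
      by (subst vec_eq_iff, subst vec_eq_iff) (simp only: sum_mat_units split_conv, simp)
    also have "\<dots> \<in> cmat.span mat_basis"
      by (intro cmat.span_sum cmat.span_scale cmat.span_base) (auto simp: mat_basis_def)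
    finally show "A \<in> cmat.span mat_basis" .
  qed
qed

text \<open>Subtracting \<open>(f y / f x) *\<^sub>C x\<close> moves any \<open>y\<close> of
  \<open>S\<close> into the kernel, so \<open>x\<close> and the kernel together span
  \<open>S\<close>, and \<open>x\<close> itself is not in the span of the kernel.\<close>

lemma dim_kernel:
  fixes S :: "(complex^'n^'n) set" and f :: "complex^'n^'n \<Rightarrow> complex"
  assumes S: "cmat.subspace S" and f: "\<And>A B. f (A + B) = f A + f B" "\<And>c A. f (c *\<^sub>C A) = c * f A"
    and x: "x \<in> S" "f x \<noteq> 0"
  shows "cmat.dim S = Suc (cmat.dim {A\<in>S. f A = 0})"
proof -
  let ?K = "{A\<in>S. f A = 0}"
  have f0: "f 0 = 0" using f(2)[of 0 0] by simp
  have K: "cmat.subspace ?K"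
    unfolding cmat.subspace_def using f0 S
    by (simp add: f cmat.subspace_0 cmat.subspace_add cmat.subspace_scale)
  have "cmat.span (insert x ?K) = S"
  proof
    show "cmat.span (insert x ?K) \<subseteq> S"
      using x by (intro cmat.span_minimal S) auto
    show "S \<subseteq> cmat.span (insert x ?K)"
    proof
      fix y assume y: "y \<in> S"
      have "f (y + (- f y / f x) *\<^sub>C x) = 0"
        unfolding f using x by simp
      moreover have "y + (- f y / f x) *\<^sub>C x \<in> S"
        by (intro cmat.subspace_add cmat.subspace_scale S x y)
      ultimately have "y + (- f y / f x) *\<^sub>C x \<in> cmat.span ?K"
        by (intro cmat.span_base) auto
      hence "y - (f y / f x) *\<^sub>C x \<in> cmat.span ?K" by simp
      thus "y \<in> cmat.span (insert x ?K)"
        unfolding cmat.span_insert by blast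
    qed
  qed
  hence "cmat.dim S = cmat.dim (insert x ?K)"
    using cmat.dim_span[of "insert x ?K"] by simp
  also have "\<dots> = Suc (cmat.dim ?K)"
  proof -
    have "cmat.span ?K = ?K" using K by (rule cmat.span_eq_iff[THEN iffD2])
    hence "x \<notin> cmat.span ?K" using x by blast
    thus ?thesis by (simp add: cmatfd.dim_insert)
  qed
  finally show ?thesis .
qed

lemma dim_kernel_le:
  fixes S :: "(complex^'n^'n) set" and f :: "complex^'n^'n \<Rightarrow> complex"
  assumes S: "cmat.subspace S" and f: "\<And>A B. f (A + B) = f A + f B" "\<And>c A. f (c *\<^sub>C A) = c * f A"
  shows "cmat.dim S \<le> Suc (cmat.dim {A\<in>S. f A = 0})"
proof (cases "\<exists>x\<in>S. f x \<noteq> 0")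
  case True
  then obtain x where "x \<in> S" "f x \<noteq> 0" by blast
  from dim_kernel[of S f, OF S f this] show ?thesis by simp
next
  case False
  hence "{A\<in>S. f A = 0} = S" by auto
  thus ?thesis by simp
qed

lemma subspace_kernel:
  fixes S :: "(complex^'n^'n) set" and f :: "complex^'n^'n \<Rightarrow> complex"
  assumes S: "cmat.subspace S" and f: "\<And>A B. f (A + B) = f A + f B" "\<And>c A. f (c *\<^sub>C A) = c * f A"
  shows "cmat.subspace {A\<in>S. f A = 0}"
proof -
  have f0: "f 0 = 0" using f(2)[of 0 0] by simp
  thus ?thesis
    unfolding cmat.subspace_def using S
    by (simp add: f cmat.subspace_0 cmat.subspace_add cmat.subspace_scale)
qed

lemma subspace_nonzero:
  fixes S :: "(complex^'n^'n) set"
  assumes S: "cmat.subspace S" "cmat.dim S > 0"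
  shows "\<exists>A\<in>S. A \<noteq> 0"
proof (rule ccontr)
  assume "\<not> ?thesis"
  hence "S \<subseteq> {0}" by auto
  hence "cmat.dim S = 0" by simp
  thus False using S(2) by linarith
qed

lemma subspace_sl: "cmat.subspace (sl :: (complex^'n^'n) set)"
  by (auto simp: cmat.subspace_def sl_def trace_add) (simp add: trace_def)

lemma dim_sl3: "cmat.dim (sl :: (complex^3^3) set) = 8"
proof -
  have "cmat.dim (UNIV :: (complex^3^3) set) = card (mat_basis :: (complex^3^3) set)"
    by (simp add: cmatfd.dim_UNIV cmatfd.dimension_def)
  also have "\<dots> = 9"
    by (simp add: mat_basis_def card_image inj_mat_unit)
  finally have "cmat.dim (UNIV :: (complex^3^3) set) = 9" .
  moreover have "cmat.dim (UNIV :: (complex^3^3) set) = Suc (cmat.dim {A\<in>UNIV :: (complex^3^3) set. trace A = 0})"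
    by (rule dim_kernel[where x = "mat_unit 1 1"]) (auto simp: trace_add trace3 algebra_simps)
  ultimately show ?thesis by (simp add: sl_def)
qed

definition conjugation :: "(complex^'n^'n \<Rightarrow> complex^'n^'n) \<Rightarrow> bool" where
  "conjugation s \<longleftrightarrow> (\<forall>A B. s (A + B) = s A + s B) \<and> (\<forall>c A. s (c *\<^sub>C A) = cnj c *\<^sub>C s A) \<and>
     (\<forall>A. s (s A) = A)"

text \<open>The conjugation is a parameter: besides \<open>conj_mat\<close> the notion is used for
  \<open>tconj\<close>, the same real form seen in a basis made of a vector, a real vector and the
  conjugate of the first.\<close>

definition inv_subalgebra :: "(complex^'n^'n \<Rightarrow> complex^'n^'n) \<Rightarrow> (complex^'n^'n) set \<Rightarrow> bool" where
  "inv_subalgebra s M \<longleftrightarrow>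
     M \<subseteq> sl \<and> cmat.subspace M \<and>
     (\<forall>A\<in>M. \<forall>B\<in>M. lie_bracket A B \<in> M) \<and>
     M \<inter> s ` M = {0} \<and>
     {A + B |A B. A \<in> M \<and> B \<in> s ` M} = sl"

lemma invariant_complex_subalgebra_iff:
  "invariant_complex_subalgebra M \<longleftrightarrow> inv_subalgebra conj_mat M"
  by (simp add: invariant_complex_subalgebra_def inv_subalgebra_def)

lemma conjugation_conj_mat: "conjugation conj_mat"
  by (simp add: conjugation_def vec_eq_iff)

lemma conjugation_0: "conjugation s \<Longrightarrow> s 0 = 0"
  unfolding conjugation_def by (metis cmat.scale_zero_left complex_cnj_zero)

lemma subspace_conjugation:
  assumes s: "conjugation s" and M: "cmat.subspace M"
  shows "cmat.subspace (s ` M)"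
  unfolding cmat.subspace_def
proof (intro conjI ballI allI)
  show "0 \<in> s ` M"
    using cmat.subspace_0[OF M] conjugation_0[OF s] by (metis imageI)
next
  fix x y assume "x \<in> s ` M" "y \<in> s ` M"
  then obtain a b where "a \<in> M" "b \<in> M" "x = s a" "y = s b" by auto
  hence "x + y = s (a + b)" "a + b \<in> M"
    using s cmat.subspace_add[OF M] by (simp_all add: conjugation_def)
  thus "x + y \<in> s ` M" by blast
next
  fix c x assume "x \<in> s ` M"
  then obtain a where "a \<in> M" "x = s a" by auto
  hence "c *\<^sub>C x = s (cnj c *\<^sub>C a)" "cnj c *\<^sub>C a \<in> M"
    using s cmat.subspace_scale[OF M] by (simp_all add: conjugation_def)
  thus "c *\<^sub>C x \<in> s ` M" by blast
qed

text \<open>An antilinear map still sends a basis to a spanning set of the image.\<close>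

lemma dim_conjugation_le:
  assumes s: "conjugation s" and M: "cmat.subspace M"
  shows "cmat.dim (s ` M) \<le> cmat.dim M"
proof -
  obtain B where B: "B \<subseteq> M" "\<not> cmat.dependent B" "M \<subseteq> cmat.span B" "card B = cmat.dim M"
    using cmat.basis_exists by blast
  have fin: "finite B" using B(2) cmatfd.finiteI_independent by blast
  have "s x \<in> cmat.span (s ` B)" if "x \<in> cmat.span B" for x
    using that
  proof (induction rule: cmat.span_induct_alt)
    case base
    then show ?case using conjugation_0[OF s] by (simp add: cmat.span_zero)
  next
    case (step c x y)
    have "s (c *\<^sub>C x + y) = cnj c *\<^sub>C s x + s y"
      using s by (simp add: conjugation_def)
    thus ?case
      using step by (metis cmat.span_add cmat.span_scale cmat.span_base imageI)
  qed
  hence "s ` M \<subseteq> cmat.span (s ` B)" using B(3) by auto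
  hence "cmat.dim (s ` M) \<le> card (s ` B)"
    using fin by (intro cmat.dim_le_card) auto
  also have "\<dots> \<le> card B" using fin by (rule card_image_le)
  finally show ?thesis using B by simp
qed

text \<open>\<open>sl\<close> has dimension 8 and is the direct sum of \<open>M\<close> and its
  image under \<open>s\<close>, whose dimensions agree because \<open>s\<close> is an
  involution.\<close>

lemma dim_inv_subalgebra:
  fixes M :: "(complex^3^3) set"
  assumes s: "conjugation s" and M: "inv_subalgebra s M"
  shows "cmat.dim M = 4"
proof -
  have sub: "cmat.subspace M" "cmat.subspace (s ` M)"
    using M subspace_conjugation[OF s] by (auto simp: inv_subalgebra_def)
  have "s ` s ` M = M" using s by (simp add: conjugation_def image_image)
  hence eq: "cmat.dim (s ` M) = cmat.dim M"
    using dim_conjugation_le[OF s sub(1)] dim_conjugation_le[OF s sub(2)] by simp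
  have "cmat.dim {A + B |A B. A \<in> M \<and> B \<in> s ` M} + cmat.dim (M \<inter> s ` M)
      = cmat.dim M + cmat.dim (s ` M)"
    using cmatfd.dim_sums_Int[OF sub] by simp
  moreover have "M \<inter> s ` M = {0}" "{A + B |A B. A \<in> M \<and> B \<in> s ` M} = sl"
    using M by (auto simp: inv_subalgebra_def)
  moreover have "cmat.dim {0::complex^3^3} = 0"
    using cmat.dim_le_card[of "{0::complex^3^3}" "{}"] by simp
  ultimately show ?thesis using eq by (simp add: dim_sl3)
qed

section \<open>Engel's theorem in dimension three\<close>

text \<open>The matrix with columns \<open>a\<close>, \<open>b\<close>, \<open>c\<close> has trivial
  kernel, hence is invertible; its inverse applied to \<open>v\<close> gives the
  coefficients.\<close>

lemma independent3_span:
  fixes a b c v :: "complex^3"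
  assumes "\<And>\<alpha> \<beta> \<gamma>. \<alpha> *s a + \<beta> *s b + \<gamma> *s c = 0 \<Longrightarrow> \<alpha> = 0 \<and> \<beta> = 0 \<and> \<gamma> = 0"
  shows "\<exists>\<alpha> \<beta> \<gamma>. v = \<alpha> *s a + \<beta> *s b + \<gamma> *s c"
proof -
  define B :: "complex^3^3" where "B = (\<chi> i j. if j = 1 then a$i else if j = 2 then b$i else c$i)"
  have B: "B *v x = x$1 *s a + x$2 *s b + x$3 *s c" for x
    by (simp add: vec_eq_iff B_def multv3 algebra_simps)
  have "x = 0" if "B *v x = 0" for x
    using assms[of "x$1" "x$2" "x$3"] that unfolding B by (simp add: vec_eq_iff forall_3)
  then obtain C where "C ** B = mat 1"
    using matrix_left_invertible_ker[of B] by blast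
  hence "B ** C = mat 1" using matrix_left_right_inverse by blast
  hence "v = B *v (C *v v)" by (simp add: matrix_vector_mul_assoc)
  thus ?thesis unfolding B by blast
qed

text \<open>Polarization: the cubes of \<open>x + y\<close> and \<open>x - y\<close> vanish, and
  comparing them isolates the part quadratic in \<open>x\<close> and linear in
  \<open>y\<close>.\<close>

lemma polarized_cube:
  fixes H :: "(complex^'n^'n) set"
  assumes H: "cmat.subspace H" and nil: "\<And>x v. x \<in> H \<Longrightarrow> x *v (x *v (x *v v)) = 0"
    and "x \<in> H" "y \<in> H"
  shows "x *v (x *v (y *v v)) + x *v (y *v (x *v v)) + y *v (x *v (x *v v)) = 0"
    (is "?P = 0")
proof -
  let ?Q = "x *v (y *v (y *v v)) + y *v (x *v (y *v v)) + y *v (y *v (x *v v))"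
  have "?P + ?Q = (x + y) *v ((x + y) *v ((x + y) *v v))"
    using nil[OF \<open>x \<in> H\<close>, of v] nil[OF \<open>y \<in> H\<close>, of v]
    by (simp add: matrix_vector_mult_add_rdistrib matrix_vector_right_distrib)
  also have "\<dots> = 0"
    using assms by (intro nil cmat.subspace_add)
  finally have 1: "?P + ?Q = 0" .
  have "?Q - ?P = (x - y) *v ((x - y) *v ((x - y) *v v))"
    using nil[OF \<open>x \<in> H\<close>, of v] nil[OF \<open>y \<in> H\<close>, of v]
    by (simp add: matrix_vector_mult_diff_rdistrib matrix_vector_mult_diff_distrib
      matrix_vector_right_distrib)
  also have "\<dots> = 0"
    using assms by (intro nil cmat.subspace_diff)
  finally have "?Q = ?P" by simp
  with 1 have "2 *\<^sub>R ?P = 0" unfolding scaleR_2 by simp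
  thus ?thesis by (simp only: scaleR_eq_0_iff) simp
qed

lemma nilpotent_eigenvalue:
  fixes y :: "complex^'n^'n"
  assumes "y *v (y *v (y *v e)) = 0" "y *v e = c *s e" "e \<noteq> 0"
  shows "c = 0"
proof -
  have "(c * (c * c)) *s e = 0"
    using assms(1) unfolding assms(2) vector_scalar_commute by (simp add: assms(2) vector_smult_assoc mult_ac)
  thus ?thesis using assms(3) by (auto simp: vec_eq_iff)
qed

text \<open>Two cases. If some \<open>x\<close> in \<open>H\<close> has nonzero square, its kernel
  is the line of \<open>e = x (x w)\<close>, and the polarized cube together with nilpotency of
  brackets forces every \<open>y\<close> in \<open>H\<close> to kill \<open>e\<close>. If all
  squares vanish, \<open>x0\<close> has rank one, and polarizing the square shows that
  \<open>H\<close> kills its image.\<close>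

lemma engel3:
  fixes H :: "(complex^3^3) set"
  assumes H: "cmat.subspace H" and br: "\<And>x y. x \<in> H \<Longrightarrow> y \<in> H \<Longrightarrow> lie_bracket x y \<in> H"
    and nil: "\<And>x v. x \<in> H \<Longrightarrow> x *v (x *v (x *v v)) = 0"
    and nz: "x0 \<in> H" "x0 \<noteq> 0"
  shows "\<exists>e. e \<noteq> 0 \<and> (\<forall>y\<in>H. y *v e = 0)"
proof (cases "\<exists>x\<in>H. \<exists>w. x *v (x *v w) \<noteq> 0")
  case True
  then obtain x w where x: "x \<in> H" "x *v (x *v w) \<noteq> 0" by blast
  define e where "e = x *v (x *v w)"
  have e: "e \<noteq> 0" "x *v e = 0"
    using x nil by (auto simp: e_def)
  \<comment> \<open>\<open>w\<close>, \<open>x w\<close>, \<open>e\<close> form a Jordan basis: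
    \<open>x\<close> is a single nilpotent block, so its kernel is a line.\<close>
  have ker: "\<exists>c. v = c *s e" if v: "x *v v = 0" for v
  proof -
    have ind: "\<alpha> = 0 \<and> \<beta> = 0 \<and> \<gamma> = 0" if eq: "\<alpha> *s w + \<beta> *s (x *v w) + \<gamma> *s e = 0" for \<alpha> \<beta> \<gamma>
    proof -
      have "x *v (x *v (\<alpha> *s w + \<beta> *s (x *v w) + \<gamma> *s e)) = \<alpha> *s e"
        using e by (simp add: matrix_vector_right_distrib vector_scalar_commute e_def[symmetric])
      hence a: "\<alpha> = 0" using eq e by simp
      have "x *v (\<alpha> *s w + \<beta> *s (x *v w) + \<gamma> *s e) = \<beta> *s e"
        using e a by (simp add: matrix_vector_right_distrib vector_scalar_commute e_def[symmetric])
      hence b: "\<beta> = 0" using eq e by simp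
      show ?thesis using a b eq e by simp
    qed
    then obtain \<alpha> \<beta> \<gamma> where eq: "v = \<alpha> *s w + \<beta> *s (x *v w) + \<gamma> *s e"
      using independent3_span[of w "x *v w" e v] by blast
    have "x *v (x *v v) = \<alpha> *s e"
      using e unfolding eq by (simp add: matrix_vector_right_distrib vector_scalar_commute e_def[symmetric])
    hence a: "\<alpha> = 0" using v e by simp
    have "x *v v = \<beta> *s e"
      using e a unfolding eq by (simp add: matrix_vector_right_distrib vector_scalar_commute e_def[symmetric])
    hence "\<beta> = 0" using v e by simp
    thus ?thesis using a eq by auto
  qed
  have "y *v e = 0" if y: "y \<in> H" for y
  proof -
    \<comment> \<open>Since \<open>x e = 0\<close>, only one term of the polarized cube survives at
      \<open>e\<close>.\<close>
    have "x *v (x *v (y *v e)) = 0"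
      using polarized_cube[OF H nil x(1) y, of e] e by simp
    then obtain \<mu> where \<mu>: "x *v (y *v e) = \<mu> *s e" using ker by blast
    have "lie_bracket x y *v e = \<mu> *s e"
      using e \<mu> by (simp add: lie_bracket_def matrix_vector_mult_diff_rdistrib flip: matrix_vector_mul_assoc)
    hence "\<mu> = 0"
      using nilpotent_eigenvalue e(1) nil[OF br[OF x(1) y]] by blast
    hence "x *v (y *v e) = 0" using \<mu> by simp
    then obtain \<nu> where \<nu>: "y *v e = \<nu> *s e" using ker by blast
    hence "\<nu> = 0" using nilpotent_eigenvalue e(1) nil[OF y] by blast
    thus ?thesis using \<nu> by simp
  qed
  thus ?thesis using e by blast
next
  case False
  hence sq: "x *v (x *v w) = 0" if "x \<in> H" for x w using that by blast
  obtain w where w: "x0 *v w \<noteq> 0" using nz(2) by (metis matrix_eq matrix_vector_mult_0)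
  define e where "e = x0 *v w"
  have e: "e \<noteq> 0" "x0 *v e = 0" using w sq[OF nz(1)] by (auto simp: e_def)
  \<comment> \<open>Otherwise \<open>w\<close>, \<open>e\<close> and \<open>x0 v\<close> would form
    a basis, and \<open>x0\<close>, which kills the last two, would have its image in the line of
    \<open>e\<close> after all.\<close>
  have rk: "\<exists>c. x0 *v v = c *s e" for v
  proof (rule ccontr)
    assume no: "\<nexists>c. x0 *v v = c *s e"
    have ind: "\<alpha> = 0 \<and> \<beta> = 0 \<and> \<gamma> = 0" if eq: "\<alpha> *s w + \<beta> *s e + \<gamma> *s (x0 *v v) = 0" for \<alpha> \<beta> \<gamma>
    proof -
      have "x0 *v (\<alpha> *s w + \<beta> *s e + \<gamma> *s (x0 *v v)) = \<alpha> *s e"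
        using e sq[OF nz(1)] by (simp add: matrix_vector_right_distrib vector_scalar_commute e_def[symmetric])
      hence a: "\<alpha> = 0" using eq e by simp
      have g: "\<gamma> = 0"
      proof (rule ccontr)
        assume "\<gamma> \<noteq> 0"
        have "(x0 *v v)$i = (- \<beta> / \<gamma>) * e$i" for i
        proof -
          have "\<beta> * e$i + \<gamma> * (x0 *v v)$i = 0"
            using arg_cong[OF eq, of "\<lambda>v. v$i"] a by simp
          thus ?thesis using \<open>\<gamma> \<noteq> 0\<close> by (simp add: field_simps add_eq_0_iff)
        qed
        hence "x0 *v v = (- \<beta> / \<gamma>) *s e" by (simp add: vec_eq_iff)
        thus False using no by blast
      qed
      show ?thesis using a g eq e by simp
    qed
    then obtain \<alpha> \<beta> \<gamma> where "v = \<alpha> *s w + \<beta> *s e + \<gamma> *s (x0 *v v)"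
      using independent3_span[of w e "x0 *v v" v] by blast
    hence "x0 *v v = x0 *v (\<alpha> *s w + \<beta> *s e + \<gamma> *s (x0 *v v))" by simp
    also have "\<dots> = \<alpha> *s e"
      using e sq[OF nz(1)] by (simp add: matrix_vector_right_distrib vector_scalar_commute e_def[symmetric])
    finally show False using no by blast
  qed
  have "y *v e = 0" if y: "y \<in> H" for y
  proof -
    have "(x0 + y) *v ((x0 + y) *v w) = 0"
      using y nz H by (intro sq cmat.subspace_add)
    hence "x0 *v (y *v w) + y *v e = 0"
      using sq[OF nz(1), of w] sq[OF y, of w]
      by (simp add: matrix_vector_mult_add_rdistrib matrix_vector_right_distrib e_def add.commute)
    moreover obtain c where "x0 *v (y *v w) = c *s e" using rk by blast
    ultimately have c: "y *v e = (- c) *s e" by (simp add: add_eq_0_iff vec_eq_iff)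
    hence "- c = 0" using nilpotent_eigenvalue[of y e "- c"] e(1) nil[OF y] by blast
    thus ?thesis using c by simp
  qed
  thus ?thesis using e by blast
qed

section \<open>Invariant lines and planes from a common kernel\<close>

definition has_eigenvector :: "(complex^3^3) set \<Rightarrow> bool" where
  "has_eigenvector M \<longleftrightarrow> (\<exists>u. u \<noteq> 0 \<and> (\<forall>A\<in>M. \<exists>c. A *v u = c *s u))"

text \<open>A common eigenvector of the transposes is a row vector whose kernel is a plane invariant
  under \<open>M\<close>.\<close>

definition has_coeigenvector :: "(complex^3^3) set \<Rightarrow> bool" where
  "has_coeigenvector M \<longleftrightarrow> (\<exists>u. u \<noteq> 0 \<and> (\<forall>A\<in>M. \<exists>c. transpose A *v u = c *s u))"

text \<open>The common kernel of \<open>H\<close> is nonzero, proper because \<open>h\<close> is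
  nonzero, and invariant under \<open>M\<close>. If it is a line, it gives an eigenvector. If it is
  a plane, its annihilator is the line of any nonzero row of \<open>h\<close>, and this line is
  stable under the transposes.\<close>

lemma common_kernel_eigen:
  fixes M H :: "(complex^3^3) set"
  assumes h: "h \<in> H" "h \<noteq> 0" and e: "e \<noteq> 0" "\<And>x. x \<in> H \<Longrightarrow> x *v e = 0"
    and inv: "\<And>A v x. A \<in> M \<Longrightarrow> (\<And>x. x \<in> H \<Longrightarrow> x *v v = 0) \<Longrightarrow> x \<in> H \<Longrightarrow> x *v (A *v v) = 0"
  shows "has_eigenvector M \<or> has_coeigenvector M"
proof (cases "\<forall>v. (\<forall>x\<in>H. x *v v = 0) \<longrightarrow> (\<exists>c. v = c *s e)")
  case True
  hence "\<forall>A\<in>M. \<exists>c. A *v e = c *s e" using inv e by metis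
  thus ?thesis using e by (auto simp: has_eigenvector_def)
next
  case False
  then obtain w where w: "\<And>x. x \<in> H \<Longrightarrow> x *v w = 0" "\<And>c. w \<noteq> c *s e" by blast
  define dot :: "complex^3 \<Rightarrow> complex^3 \<Rightarrow> complex"
    where "dot r v = r$1 * v$1 + r$2 * v$2 + r$3 * v$3" for r v
  have dot_add: "dot r (v + v') = dot r v + dot r v'" "dot r (c *s v) = c * dot r v" for r v v' c
    by (simp_all add: dot_def algebra_simps)
  have dot_axis: "dot r (axis i 1) = r$i" for r i
    using exhaust_3[of i] by (auto simp: dot_def axis_def)
  obtain i where "h $ i \<noteq> 0" using h(2) by (auto simp: vec_eq_iff)
  define \<xi> where "\<xi> = h $ i"
  have ker: "dot \<xi> v = 0" if "\<And>x. x \<in> H \<Longrightarrow> x *v v = 0" for v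
  proof -
    have "(h *v v)$i = 0" using that[OF h(1)] by simp
    thus ?thesis by (simp add: multv3 dot_def \<xi>_def)
  qed
  obtain j where "\<xi> $ j \<noteq> 0" using \<open>h $ i \<noteq> 0\<close> by (auto simp: \<xi>_def vec_eq_iff)
  hence j: "dot \<xi> (axis j 1) \<noteq> 0" by (simp add: dot_axis)
  \<comment> \<open>\<open>e\<close> and \<open>w\<close> span the kernel, and the row
    \<open>\<xi>\<close> vanishes on it but not on the chosen axis vector, so the three vectors form
    a basis.\<close>
  have ind: "\<alpha> = 0 \<and> \<beta> = 0 \<and> \<gamma> = 0"
    if eq: "\<alpha> *s e + \<beta> *s w + \<gamma> *s (axis j 1) = 0" for \<alpha> \<beta> \<gamma>
  proof -
    have "dot \<xi> (\<alpha> *s e + \<beta> *s w + \<gamma> *s (axis j 1)) = \<gamma> * dot \<xi> (axis j 1)"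
      using ker[of e] ker[of w] e w by (simp add: dot_add)
    hence g: "\<gamma> = 0" using eq j by (simp add: dot_def)
    have b: "\<beta> = 0"
    proof (rule ccontr)
      assume "\<beta> \<noteq> 0"
      have "w$i = (- \<alpha> / \<beta>) * e$i" for i
      proof -
        have "\<alpha> * e$i + \<beta> * w$i = 0"
          using arg_cong[OF eq, of "\<lambda>v. v$i"] g by simp
        thus ?thesis using \<open>\<beta> \<noteq> 0\<close> by (simp add: field_simps add_eq_0_iff)
      qed
      hence "w = (- \<alpha> / \<beta>) *s e" by (simp add: vec_eq_iff)
      thus False using w by blast
    qed
    show ?thesis using b g eq e by simp
  qed
  have mult: "\<exists>c. r = c *s \<xi>" if r: "dot r e = 0" "dot r w = 0" for r
  proof -
    define c where "c = dot r (axis j 1) / dot \<xi> (axis j 1)"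
    have "dot r v = c * dot \<xi> v" for v
    proof -
      obtain \<alpha> \<beta> \<gamma> where v: "v = \<alpha> *s e + \<beta> *s w + \<gamma> *s (axis j 1)"
        using ind independent3_span[of e w "axis j 1" v] by blast
      show ?thesis unfolding v dot_add using j ker[of e] ker[of w] e w r
        by (simp add: c_def)
    qed
    hence "r$i = c * \<xi>$i" for i using dot_axis by metis
    hence "r = c *s \<xi>" by (simp add: vec_eq_iff)
    thus ?thesis by blast
  qed
  have tr: "dot (transpose A *v \<xi>) v = dot \<xi> (A *v v)" for A v
    by (simp add: dot_def multv3 transpose_def algebra_simps)
  have "\<exists>c. transpose A *v \<xi> = c *s \<xi>" if "A \<in> M" for A
    using that by (intro mult; unfold tr; intro ker inv) (auto simp: e w)
  thus ?thesis using \<open>h $ i \<noteq> 0\<close> by (auto simp: has_coeigenvector_def \<xi>_def)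
qed

lemma eigenvalue3:
  fixes w :: "complex^3^3"
  shows "\<exists>\<mu> e. e \<noteq> 0 \<and> w *v e = \<mu> *s e"
proof -
  \<comment> \<open>The polynomial \<open>det (w - \<mu>)\<close> in the variable
    \<open>\<mu>\<close>, expanded by principal minors.\<close>
  define p where "p = [:det w, - (w$1$1*w$2$2 - w$1$2*w$2$1 + w$1$1*w$3$3 - w$1$3*w$3$1 + w$2$2*w$3$3 - w$2$3*w$3$2),
     w$1$1+w$2$2+w$3$3, -1:]"
  have "\<not> constant (poly p)"
    by (subst constant_degree) (simp add: p_def)
  then obtain \<mu> where "poly p \<mu> = 0" using fundamental_theorem_of_algebra by blast
  moreover have "poly p \<mu> = det (w - \<mu> *\<^sub>C mat 1)"
    by (simp add: p_def det_3 mat_def algebra_simps)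
  ultimately have "\<not> invertible (w - \<mu> *\<^sub>C mat 1)" by (simp add: invertible_det_nz)
  then obtain e where "(w - \<mu> *\<^sub>C mat 1) *v e = 0" "e \<noteq> 0"
    using matrix_left_invertible_ker[of "w - \<mu> *\<^sub>C mat 1"] invertible_left_inverse by blast
  thus ?thesis by (auto simp: matrix_vector_mult_diff_rdistrib cscale_multv)
qed

section \<open>A Cartan criterion\<close>

lemma linear_vanishes_on_span:
  fixes f :: "complex^'n^'n \<Rightarrow> complex"
  assumes f: "\<And>A B. f (A + B) = f A + f B" "\<And>c A. f (c *\<^sub>C A) = c * f A"
    and "\<And>A. A \<in> B \<Longrightarrow> f A = 0" and "A \<in> cmat.span B"
  shows "f A = 0"
  using assms(4)
proof (induction rule: cmat.span_induct_alt)
  case base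
  then show ?case using f(2)[of 0 0] by simp
next
  case (step c x y)
  then show ?case by (simp add: f assms(3))
qed

text \<open>An alternating 3-form on a 4-dimensional space is the contraction of a volume form with a
  vector, which lies in its kernel.\<close>

lemma trace_form_kernel:
  fixes M :: "(complex^'n^'n) set"
  assumes M: "cmat.subspace M" "cmat.dim M = 4"
  shows "\<exists>w\<in>M. w \<noteq> 0 \<and> (\<forall>y\<in>M. \<forall>z\<in>M. trace (w ** lie_bracket y z) = 0)"
proof -
  define \<omega> :: "complex^'n^'n \<Rightarrow> complex^'n^'n \<Rightarrow> complex^'n^'n \<Rightarrow> complex"
    where "\<omega> x y z = trace (x ** lie_bracket y z)" for x y z
  have lin1: "\<omega> (x + x') y z = \<omega> x y z + \<omega> x' y z" "\<omega> (c *\<^sub>C x) y z = c * \<omega> x y z" for x x' y z c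
    by (simp_all add: \<omega>_def matrix_add_ldistrib trace_add)
       (simp add: matrix_matrix_mult_def trace_def sum.distrib distrib_right)
  have lin1': "\<omega> (x - x') y z = \<omega> x y z - \<omega> x' y z" for x x' y z
    using lin1(1)[of "x - x'" x' y z] by simp
  have anti: "\<omega> x y z = - \<omega> x z y" for x y z
    unfolding \<omega>_def by (subst bracket_anti) (simp add: matrix_matrix_mult_def trace_def sum_negf)
  have cyc: "\<omega> x y z = \<omega> y z x" for x y z
    unfolding \<omega>_def by (metis trace_bracket_cycle trace_mul_sym)
  have alt0: "\<omega> x y y = 0" for x y by (simp add: \<omega>_def lie_bracket_def trace_def)
  have alt: "\<omega> x y y = 0" "\<omega> y x y = 0" "\<omega> y y x = 0" for x y
    using alt0[of x y] cyc[of x y y] cyc[of y y x] by simp_all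
  obtain B where B: "B \<subseteq> M" "\<not> cmat.dependent B" "M \<subseteq> cmat.span B" "card B = cmat.dim M"
    using cmat.basis_exists by blast
  have fin: "finite B" using B(2) cmatfd.finiteI_independent by blast
  have "card B = Suc (Suc (Suc (Suc 0)))" using B M by simp
  then obtain a b c d where Beq: "B = {a, b, c, d}" and dist: "a \<noteq> b" "a \<noteq> c" "a \<noteq> d" "b \<noteq> c" "b \<noteq> d" "c \<noteq> d"
    unfolding card_Suc_eq by auto
  \<comment> \<open>For the volume form taking the value 1 on \<open>(a, b, c, d)\<close>, this is
    the vector whose contraction with it is \<open>\<omega>\<close>.\<close>
  define w where "w = \<omega> b c d *\<^sub>C a + (- \<omega> a c d) *\<^sub>C b + \<omega> a b d *\<^sub>C c + (- \<omega> a b c) *\<^sub>C d"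
  have wM: "w \<in> M" unfolding w_def
    using B Beq M by (intro cmat.subspace_add cmat.subspace_scale) auto
  have ker: "\<omega> w' y z = 0" if w': "\<And>y z. y \<in> B \<Longrightarrow> z \<in> B \<Longrightarrow> \<omega> w' y z = 0" and "y \<in> M" "z \<in> M" for w' y z
  proof -
    have 1: "\<omega> w' y z = 0" if "z \<in> B" for z
    proof -
      have "\<omega> y z w' = 0"
      proof (rule linear_vanishes_on_span[where B = B and f = "\<lambda>y. \<omega> y z w'"])
        show "y \<in> cmat.span B" using \<open>y \<in> M\<close> B(3) by blast
        show "\<omega> A z w' = 0" if "A \<in> B" for A
          using w'[OF that \<open>z \<in> B\<close>] cyc[of w' A z] by simp
      qed (rule lin1)+
      thus ?thesis using cyc[of w' y z] by simp
    qed
    have "\<omega> z w' y = 0"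
    proof (rule linear_vanishes_on_span[where B = B and f = "\<lambda>z. \<omega> z w' y"])
      show "z \<in> cmat.span B" using \<open>z \<in> M\<close> B(3) by blast
      show "\<omega> A w' y = 0" if "A \<in> B" for A
        using 1[OF that] cyc[of A w' y] by simp
    qed (rule lin1)+
    thus ?thesis using cyc[of z w' y] by simp
  qed
  show ?thesis
  proof (cases "w = 0")
    case False
    have "\<omega> w y z = 0" if "y \<in> B" "z \<in> B" for y z
    proof -
      have "\<omega> b a c = - \<omega> a b c" "\<omega> b a d = - \<omega> a b d" "\<omega> c a d = - \<omega> a c d" "\<omega> c b d = - \<omega> b c d"
        by (simp_all only: anti[of b a c] anti[of b a d] anti[of c a d] anti[of c b d] cyc[of a b c]
            cyc[of a b d] cyc[of a c d] cyc[of b c d])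
      note p = this cyc[of c a b] cyc[of d a b] cyc[of d a c] cyc[of d b c]
      show ?thesis using that
        by (auto simp: w_def lin1 lin1' Beq alt p anti[of _ b a] anti[of _ c a] anti[of _ d a] anti[of _ c b]
              anti[of _ d b] anti[of _ d c])
    qed
    thus ?thesis using ker wM False by (auto simp: \<omega>_def)
  next
    \<comment> \<open>By independence of the basis all four values of \<open>\<omega>\<close>
      vanish, so the form is zero and any basis vector serves.\<close>
    case True
    define u where "u v = (if v = a then \<omega> b c d else if v = b then - \<omega> a c d else if v = c then \<omega> a b d
       else - \<omega> a b c)" for v
    have "(\<Sum>v\<in>B. u v *\<^sub>C v) = w"
      using dist by (simp add: Beq u_def w_def)
    hence "u v = 0" if "v \<in> B" for v
      using cmat.independentD[OF B(2) fin subset_refl] True that by auto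
    hence z: "\<omega> b c d = 0" "\<omega> a c d = 0" "\<omega> a b d = 0" "\<omega> a b c = 0"
      using dist unfolding u_def Beq by (metis insertI1 insertI2 neg_equal_0_iff_equal)+
    have "\<omega> a y z = 0" if "y \<in> B" "z \<in> B" for y z
      using that z anti[of a c b] anti[of a d b] anti[of a d c] by (auto simp: Beq alt)
    moreover have "a \<noteq> 0" using B(2) Beq cmat.dependent_zero by blast
    moreover have "a \<in> M" using B Beq by auto
    ultimately show ?thesis using ker by (auto simp: \<omega>_def)
  qed
qed

text \<open>Cayley-Hamilton in dimension three: for trace zero the linear coefficient is a multiple
  of \<open>trace (z ** z)\<close>, so only the determinant remains.\<close>

lemma traceless_cube:
  fixes z :: "complex^3^3"
  assumes "trace z = 0" "trace (z ** z) = 0"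
  shows "z ** z ** z = det z *\<^sub>C mat 1"
proof -
  have a33: "z$3$3 = - z$1$1 - z$2$2"
    using assms(1) by (simp add: trace3 algebra_simps add_eq_0_iff)
  have "z ** z ** z = (trace (z ** z) / 2) *\<^sub>C z + det z *\<^sub>C mat 1"
    unfolding mat3_eq det_3 trace3
    by (simp add: mult3 a33 mat_def) (simp add: field_simps)
  thus ?thesis using assms(2) by simp
qed

text \<open>For a non-nilpotent \<open>z\<close> with eigenvalues \<open>c, c\<omega>, c\<omega>\<^sup>2\<close>, the eigenvalues of \<open>ad z\<^sup>2\<close> are a
  polynomial without constant term in those of \<open>ad z\<close>; this plays the role of the replica in
  Cartan's criterion.\<close>

lemma ad_power5:
  fixes z a :: "complex^3^3"
  assumes z: "z ** z ** z = d *\<^sub>C mat 1"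
  shows "lie_bracket z (lie_bracket z (lie_bracket z (lie_bracket z (lie_bracket z a))))
    = (- 9 * d) *\<^sub>C lie_bracket (z ** z) a"
proof -
  have z': "X ** z ** z ** z = d *\<^sub>C X" for X
  proof -
    have "X ** z ** z ** z = X ** (z ** z ** z)" by (simp only: matrix_mul_assoc)
    thus ?thesis by (simp add: z)
  qed
  show ?thesis
    unfolding lie_bracket_def
    by (simp only: matrix_diff_distrib matrix_mul_assoc z z' cscale_mult_left cscale_mult_right
        matrix_mul_lid matrix_mul_rid) (simp add: vec_eq_iff algebra_simps)
qed

text \<open>Invariance of the trace form turns \<open>trace ([a, w] q)\<close> into
  \<open>trace (w [q, a])\<close>, so \<open>z\<close> is orthogonal to itself. Hence the cube of
  \<open>z\<close> is the scalar \<open>det z\<close>, and pairing \<open>z\<close> with its square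
  shows that this scalar is zero.\<close>

lemma ideal_nilpotent:
  fixes M K :: "(complex^3^3) set"
  assumes M: "M \<subseteq> sl" "cmat.subspace M" and br: "\<And>x y. x \<in> M \<Longrightarrow> y \<in> M \<Longrightarrow> lie_bracket x y \<in> M"
    and K: "K \<subseteq> M" "\<And>w y z. w \<in> K \<Longrightarrow> y \<in> M \<Longrightarrow> z \<in> M \<Longrightarrow> trace (w ** lie_bracket y z) = 0"
    and z: "z \<in> cmat.span {lie_bracket a w |a w. a \<in> M \<and> w \<in> K}"
  shows "z ** z ** z = 0"
proof -
  let ?S = "{lie_bracket a w |a w. a \<in> M \<and> w \<in> K}"
  have tr: "trace (x ** q) = 0"
    if x: "x \<in> cmat.span ?S" and q: "\<And>a w. a \<in> M \<Longrightarrow> w \<in> K \<Longrightarrow> trace (w ** lie_bracket q a) = 0" for x q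
  proof (rule linear_vanishes_on_span[where f = "\<lambda>x. trace (x ** q)", OF _ _ _ x])
    fix A B :: "complex^3^3" and c
    show "trace ((A + B) ** q) = trace (A ** q) + trace (B ** q)"
      by (simp add: matrix_matrix_mult_def trace_def sum.distrib distrib_right)
    show "trace ((c *\<^sub>C A) ** q) = c * trace (A ** q)" by simp
  next
    fix A assume "A \<in> ?S"
    thus "trace (A ** q) = 0" using q by (auto simp: trace_bracket_cycle)
  qed
  have "?S \<subseteq> M" using br K(1) by auto
  hence zM: "z \<in> M" using z cmat.span_minimal[OF _ M(2)] by blast
  have "trace z = 0" using zM M(1) by (auto simp: sl_def)
  moreover have "trace (z ** z) = 0"
  proof (rule tr[OF z])
    fix a w assume "a \<in> M" "w \<in> K"
    thus "trace (w ** lie_bracket z a) = 0" using K(2) zM by blast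
  qed
  ultimately have cube: "z ** z ** z = det z *\<^sub>C mat 1" by (rule traceless_cube)
  have "det z = 0"
  proof (rule ccontr)
    assume d: "det z \<noteq> 0"
    \<comment> \<open>\<open>z ** z\<close> need not lie in \<open>M\<close>, but up to the nonzero
      factor \<open>- 9 * det z\<close> its adjoint action is the fifth power of that of
      \<open>z\<close>, which sends \<open>a\<close> to a bracket of elements of
      \<open>M\<close>.\<close>
    have "trace (z ** (z ** z)) = 0"
    proof (rule tr[OF z])
      fix a w assume a: "a \<in> M" and w: "w \<in> K"
      let ?b = "lie_bracket z (lie_bracket z (lie_bracket z (lie_bracket z a)))"
      have "trace (w ** lie_bracket z ?b) = 0"
        by (intro K(2) br zM a w)
      thus "trace (w ** lie_bracket (z ** z) a) = 0"
        using d unfolding ad_power5[OF cube] cscale_mult_right trace_cscale by simp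
    qed
    thus False using d by (simp add: matrix_mul_assoc cube trace_I)
  qed
  thus ?thesis using cube by simp
qed

section \<open>Reducibility and isomorphisms\<close>

theorem subalgebra_reducible:
  fixes M :: "(complex^3^3) set"
  assumes M: "M \<subseteq> sl" "cmat.subspace M" "cmat.dim M = 4"
    and br: "\<And>x y. x \<in> M \<Longrightarrow> y \<in> M \<Longrightarrow> lie_bracket x y \<in> M"
  shows "has_eigenvector M \<or> has_coeigenvector M"
proof -
  define K where "K = {w\<in>M. \<forall>y\<in>M. \<forall>z\<in>M. trace (w ** lie_bracket y z) = 0}"
  define S where "S = {lie_bracket a w |a w. a \<in> M \<and> w \<in> K}"
  define H where "H = cmat.span S"
  obtain w where w: "w \<in> K" "w \<noteq> 0"
    using trace_form_kernel[OF M(2,3)] by (auto simp: K_def)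
  have KM: "K \<subseteq> M" and trK: "\<And>w y z. w \<in> K \<Longrightarrow> y \<in> M \<Longrightarrow> z \<in> M \<Longrightarrow> trace (w ** lie_bracket y z) = 0"
    by (auto simp: K_def)
  have subK: "cmat.subspace K"
  proof -
    have "trace ((A + B) ** C) = trace (A ** C) + trace (B ** C)" for A B C :: "complex^3^3"
      by (simp add: matrix_matrix_mult_def trace_def sum.distrib distrib_right)
    moreover have "trace (0 ** C) = 0" for C :: "complex^3^3"
      by (simp add: matrix_matrix_mult_def trace_def)
    ultimately show ?thesis
      unfolding cmat.subspace_def K_def using M(2)
      by (simp add: cmat.subspace_0 cmat.subspace_add cmat.subspace_scale)
  qed
  have idK: "lie_bracket a w \<in> K" if "a \<in> M" "w \<in> K" for a w
  proof -
    have "lie_bracket a w \<in> M" using br that KM by blast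
    moreover have "trace (lie_bracket a w ** lie_bracket y z) = 0" if "y \<in> M" "z \<in> M" for y z
      unfolding trace_bracket_cycle using trK br that \<open>a \<in> M\<close> \<open>w \<in> K\<close> by blast
    ultimately show ?thesis by (auto simp: K_def)
  qed
  have HK: "H \<subseteq> K"
    unfolding H_def using idK by (intro cmat.span_minimal subK) (auto simp: S_def)
  \<comment> \<open>Since \<open>H\<close> lies in \<open>K\<close>, a bracket of \<open>M\<close>
    with \<open>H\<close> is itself a generator of \<open>H\<close>.\<close>
  have idH: "lie_bracket a x \<in> H" if "a \<in> M" "x \<in> H" for a x
    unfolding H_def S_def using that HK by (intro cmat.span_base) blast
  show ?thesis
  proof (cases "H = {0}")
    case True
    have comm: "lie_bracket a w = 0" if "a \<in> M" for a
      using that w True unfolding H_def S_def by (metis (mono_tags, lifting) cmat.span_base mem_Collect_eq singletonD)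
    obtain \<mu> e where e: "e \<noteq> 0" "w *v e = \<mu> *s e" using eigenvalue3 by blast
    \<comment> \<open>\<open>w\<close> commutes with \<open>M\<close>, so the eigenspace of
      \<open>w\<close> is invariant; \<open>h\<close> is nonzero because a traceless scalar matrix
      would be zero.\<close>
    define h where "h = w - \<mu> *\<^sub>C mat 1"
    have "h \<noteq> 0"
    proof
      assume "h = 0"
      hence "w = \<mu> *\<^sub>C mat 1" by (simp add: h_def)
      moreover have "trace w = 0" using w KM M(1) by (auto simp: sl_def)
      ultimately show False using w(2) by (simp add: trace_I)
    qed
    show ?thesis
    proof (rule common_kernel_eigen[of h "{h}" e M])
      fix A v x assume A: "A \<in> M" and v: "\<And>x. x \<in> {h} \<Longrightarrow> x *v v = 0" and "x \<in> {h}"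
      have "w ** A = A ** w" using comm[OF A] by (simp add: lie_bracket_def)
      hence "h ** A = A ** h"
        by (simp add: h_def matrix_diff_distrib)
      hence "h *v (A *v v) = A *v (h *v v)" by (simp add: matrix_vector_mul_assoc)
      thus "x *v (A *v v) = 0" using v \<open>x \<in> {h}\<close> by simp
    qed (use \<open>h \<noteq> 0\<close> e in \<open>auto simp: h_def matrix_vector_mult_diff_rdistrib cscale_multv\<close>)
  next
    case False
    have sub: "cmat.subspace H" unfolding H_def by (rule cmat.subspace_span)
    then obtain x0 where x0: "x0 \<in> H" "x0 \<noteq> 0" using False cmat.subspace_0 by blast
    have nil: "x *v (x *v (x *v v)) = 0" if "x \<in> H" for x v
      using ideal_nilpotent[OF M(1,2) br KM trK that[unfolded H_def S_def]]
      by (simp add: matrix_vector_mul_assoc matrix_mul_assoc)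
    obtain e where e: "e \<noteq> 0" "\<forall>y\<in>H. y *v e = 0"
      using engel3[OF sub _ nil x0] idH HK KM by blast
    show ?thesis
    proof (rule common_kernel_eigen[of x0 H e M])
      fix A v x assume A: "A \<in> M" and v: "\<And>x. x \<in> H \<Longrightarrow> x *v v = 0" and x: "x \<in> H"
      have "lie_bracket A x *v v = 0" by (rule v) (rule idH[OF A x])
      hence "A *v (x *v v) - x *v (A *v v) = 0"
        by (simp add: lie_bracket_def matrix_vector_mult_diff_rdistrib flip: matrix_vector_mul_assoc)
      thus "x *v (A *v v) = 0" using v[OF x] by simp
    qed (use x0 e in auto)
  qed
qed

text \<open>Defined on all matrices rather than on \<open>sl\<close>; the trace clause makes it
  restrict to \<open>sl\<close>, and the last clause carries the real form of \<open>s\<close> to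
  that of \<open>s'\<close>.\<close>

definition lie_iso :: "(complex^'n^'n \<Rightarrow> complex^'n^'n) \<Rightarrow> (complex^'n^'n \<Rightarrow> complex^'n^'n) \<Rightarrow>
    (complex^'n^'n \<Rightarrow> complex^'n^'n) \<Rightarrow> bool" where
  "lie_iso s s' f \<longleftrightarrow> bij f \<and> (\<forall>A B. f (A + B) = f A + f B) \<and> (\<forall>c A. f (c *\<^sub>C A) = c *\<^sub>C f A) \<and>
     (\<forall>A B. f (lie_bracket A B) = lie_bracket (f A) (f B)) \<and> (\<forall>A. trace (f A) = 0 \<longleftrightarrow> trace A = 0) \<and>
     (\<forall>A. f (s A) = s' (f A))"

lemma lie_isoD:
  assumes "lie_iso s s' f"
  shows "bij f" "f (A + B) = f A + f B" "f (c *\<^sub>C A) = c *\<^sub>C f A"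
    "f (lie_bracket A B) = lie_bracket (f A) (f B)" "trace (f A) = 0 \<longleftrightarrow> trace A = 0" "f (s A) = s' (f A)"
  using assms by (simp_all add: lie_iso_def)

lemma lie_iso_comp:
  assumes f: "lie_iso s s' f" and g: "lie_iso s' s'' g"
  shows "lie_iso s s'' (\<lambda>A. g (f A))"
  using bij_comp[OF lie_isoD(1)[OF f] lie_isoD(1)[OF g]]
  by (simp add: lie_iso_def o_def lie_isoD[OF f] lie_isoD[OF g])

lemma lie_iso_inv:
  assumes f: "lie_iso s s' f"
  shows "lie_iso s' s (inv f)"
proof -
  note b = lie_isoD(1)[OF f]
  have r: "f (inv f X) = X" for X using b by (simp add: bij_is_surj surj_f_inv_f)
  have eq: "inv f X = Y" if "f Y = X" for X Y
    using b that by (metis bij_inv_eq_iff)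
  show ?thesis
    unfolding lie_iso_def
  proof (intro conjI allI)
    show "bij (inv f)" using b by (rule bij_imp_bij_inv)
    fix A B c
    show "inv f (A + B) = inv f A + inv f B" by (rule eq) (simp add: lie_isoD(2)[OF f] r)
    show "inv f (c *\<^sub>C A) = c *\<^sub>C inv f A" by (rule eq) (simp add: lie_isoD(3)[OF f] r)
    show "inv f (lie_bracket A B) = lie_bracket (inv f A) (inv f B)"
      by (rule eq) (simp add: lie_isoD(4)[OF f] r)
    show "trace (inv f A) = 0 \<longleftrightarrow> trace A = 0"
      using lie_isoD(5)[OF f, of "inv f A"] by (simp add: r)
    show "inv f (s' A) = s (inv f A)" by (rule eq) (simp add: lie_isoD(6)[OF f] r)
  qed
qed

lemma lie_iso_sl:
  assumes f: "lie_iso s s' f"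
  shows "f ` sl = sl"
proof -
  have "A \<in> f ` sl" if "A \<in> sl" for A
  proof
    show "A = f (inv f A)" using lie_isoD(1)[OF f] by (simp add: bij_is_surj surj_f_inv_f)
    show "inv f A \<in> sl" using that lie_isoD(5)[OF lie_iso_inv[OF f]] by (simp add: sl_def)
  qed
  thus ?thesis using lie_isoD(5)[OF f] by (auto simp: sl_def)
qed

lemma inv_subalgebra_image:
  assumes f: "lie_iso s s' f" and M: "inv_subalgebra s M"
  shows "inv_subalgebra s' (f ` M)"
proof -
  note D = lie_isoD[OF f]
  have inj: "inj f" using D(1) by (rule bij_is_inj)
  have f0: "f 0 = 0" using D(3)[of 0 0] by simp
  have s: "s' ` f ` M = f ` s ` M" by (simp add: image_image D(6))
  have sub: "cmat.subspace M" using M by (simp add: inv_subalgebra_def)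
  have "f ` M \<subseteq> sl" using M lie_iso_sl[OF f] unfolding inv_subalgebra_def by blast
  moreover have "cmat.subspace (f ` M)"
    unfolding cmat.subspace_def
  proof (intro conjI ballI allI)
    show "0 \<in> f ` M" using f0 cmat.subspace_0[OF sub] by (metis imageI)
  next
    fix x y assume "x \<in> f ` M" "y \<in> f ` M"
    then obtain a b where "a \<in> M" "b \<in> M" "x = f a" "y = f b" by auto
    hence "x + y = f (a + b)" "a + b \<in> M"
      using cmat.subspace_add[OF sub] by (simp_all add: D)
    thus "x + y \<in> f ` M" by blast
  next
    fix c x assume "x \<in> f ` M"
    then obtain a where "a \<in> M" "x = f a" by auto
    hence "c *\<^sub>C x = f (c *\<^sub>C a)" "c *\<^sub>C a \<in> M"
      using cmat.subspace_scale[OF sub] by (simp_all add: D)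
    thus "c *\<^sub>C x \<in> f ` M" by blast
  qed
  moreover have "\<forall>A\<in>f ` M. \<forall>B\<in>f ` M. lie_bracket A B \<in> f ` M"
  proof clarify
    fix A B assume "A \<in> M" "B \<in> M"
    hence "lie_bracket (f A) (f B) = f (lie_bracket A B)" "lie_bracket A B \<in> M"
      using M by (simp_all add: D inv_subalgebra_def)
    thus "lie_bracket (f A) (f B) \<in> f ` M" by simp
  qed
  moreover have "f ` M \<inter> s' ` f ` M = {0}"
  proof -
    have "f ` M \<inter> f ` s ` M = f ` (M \<inter> s ` M)" using inj by (simp add: image_Int)
    also have "\<dots> = {0}" using M f0 by (simp add: inv_subalgebra_def)
    finally show ?thesis unfolding s .
  qed
  moreover have "{A + B |A B. A \<in> f ` M \<and> B \<in> s' ` f ` M} = sl"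
  proof -
    have "{A + B |A B. A \<in> f ` M \<and> B \<in> f ` s ` M} = f ` {A + B |A B. A \<in> M \<and> B \<in> s ` M}"
    proof (intro equalityI subsetI)
      fix x assume "x \<in> {A + B |A B. A \<in> f ` M \<and> B \<in> f ` s ` M}"
      then obtain A B where "A \<in> M" "B \<in> s ` M" "x = f A + f B" by blast
      hence "x = f (A + B)" by (simp add: D(2))
      with \<open>A \<in> M\<close> \<open>B \<in> s ` M\<close> show "x \<in> f ` {A + B |A B. A \<in> M \<and> B \<in> s ` M}" by blast
    next
      fix x assume "x \<in> f ` {A + B |A B. A \<in> M \<and> B \<in> s ` M}"
      then obtain A B where "A \<in> M" "B \<in> s ` M" "x = f (A + B)" by blast
      hence "x = f A + f B" by (simp add: D(2))
      with \<open>A \<in> M\<close> \<open>B \<in> s ` M\<close> show "x \<in> {A + B |A B. A \<in> f ` M \<and> B \<in> f ` s ` M}" by blast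
    qed
    also have "\<dots> = sl" using M lie_iso_sl[OF f] by (simp add: inv_subalgebra_def)
    finally show ?thesis unfolding s .
  qed
  ultimately show ?thesis by (simp add: inv_subalgebra_def)
qed

lemma bracket_conjugate:
  fixes A B P R :: "complex^'n^'n"
  assumes "P ** R = mat 1"
  shows "lie_bracket (R ** A ** P) (R ** B ** P) = R ** lie_bracket A B ** P"
proof -
  have "R ** A ** P ** (R ** B ** P) = R ** A ** (P ** R) ** B ** P" for A B
    by (simp only: matrix_mul_assoc)
  thus ?thesis using assms by (simp add: lie_bracket_def matrix_diff_distrib matrix_mul_assoc)
qed

lemma lie_iso_conjugate:
  fixes P R :: "complex^'n^'n"
  assumes PR: "P ** R = mat 1" "R ** P = mat 1" and s: "\<And>A. R ** s A ** P = s' (R ** A ** P)"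
  shows "lie_iso s s' (\<lambda>A. R ** A ** P)"
proof -
  have "P ** (R ** A ** P) ** R = A" for A
  proof -
    have "P ** (R ** A ** P) ** R = (P ** R) ** A ** (P ** R)" by (simp only: matrix_mul_assoc)
    thus ?thesis by (simp add: PR)
  qed
  moreover have "R ** (P ** A ** R) ** P = A" for A
  proof -
    have "R ** (P ** A ** R) ** P = (R ** P) ** A ** (R ** P)" by (simp only: matrix_mul_assoc)
    thus ?thesis by (simp add: PR)
  qed
  ultimately have "bij (\<lambda>A. R ** A ** P)" by (intro o_bij[of "\<lambda>A. P ** A ** R"]) auto
  moreover have "trace (R ** A ** P) = trace A" for A
  proof -
    have "trace (R ** A ** P) = trace (P ** (R ** A))" by (rule trace_mul_sym)
    thus ?thesis by (simp add: matrix_mul_assoc PR)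
  qed
  moreover have "R ** (A + B) ** P = R ** A ** P + R ** B ** P" for A B
    by (simp add: vec_eq_iff matrix_matrix_mult_def sum.distrib algebra_simps)
  ultimately show ?thesis
    unfolding lie_iso_def using s bracket_conjugate[OF PR(1)] by simp
qed

section \<open>The twisted real form\<close>

definition smat :: "complex^3^3" where
  "smat = vector [vector [0, 0, 1], vector [0, 1, 0], vector [1, 0, 0]]"

text \<open>Complex conjugation read in a basis whose outer vectors are conjugate and whose middle
  vector is real. It turns the conjugated matrix by 180 degrees, so upper triangular matrices become
  lower triangular.\<close>

definition tconj :: "complex^3^3 \<Rightarrow> complex^3^3" where
  "tconj A = smat ** conj_mat A ** smat"

text \<open>The outer automorphism \<open>- transpose A\<close> followed by conjugation with
  \<open>smat\<close>: minus the reflection in the antidiagonal, which keeps upper triangular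
  matrices upper triangular.\<close>

definition tdual :: "complex^3^3 \<Rightarrow> complex^3^3" where
  "tdual A = - (smat ** transpose A ** smat)"

lemma tconj_nth [simp]:
  "tconj A $ 1 $ 1 = cnj (A$3$3)" "tconj A $ 1 $ 2 = cnj (A$3$2)" "tconj A $ 1 $ 3 = cnj (A$3$1)"
  "tconj A $ 2 $ 1 = cnj (A$2$3)" "tconj A $ 2 $ 2 = cnj (A$2$2)" "tconj A $ 2 $ 3 = cnj (A$2$1)"
  "tconj A $ 3 $ 1 = cnj (A$1$3)" "tconj A $ 3 $ 2 = cnj (A$1$2)" "tconj A $ 3 $ 3 = cnj (A$1$1)"
  by (simp_all add: tconj_def smat_def mult3)

lemma tdual_nth [simp]:
  "tdual A $ 1 $ 1 = - (A$3$3)" "tdual A $ 1 $ 2 = - (A$2$3)" "tdual A $ 1 $ 3 = - (A$1$3)"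
  "tdual A $ 2 $ 1 = - (A$3$2)" "tdual A $ 2 $ 2 = - (A$2$2)" "tdual A $ 2 $ 3 = - (A$1$2)"
  "tdual A $ 3 $ 1 = - (A$3$1)" "tdual A $ 3 $ 2 = - (A$2$1)" "tdual A $ 3 $ 3 = - (A$1$1)"
  by (simp_all add: tdual_def smat_def mult3 transpose_def)

lemma smat_smat [simp]: "smat ** smat = mat 1"
  by (simp add: mat3_eq mult3 smat_def mat_def)

lemma conj_mat_mult: "conj_mat (A ** B) = conj_mat A ** conj_mat B"
  by (simp add: vec_eq_iff matrix_matrix_mult_def)

lemma conj_mat_one: "conj_mat (mat 1) = mat 1"
  by (simp add: vec_eq_iff mat_def)

lemma tconj_mult: "tconj (A ** B) = tconj A ** tconj B"
proof -
  have "tconj A ** tconj B = smat ** conj_mat A ** (smat ** smat) ** conj_mat B ** smat"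
    by (simp only: tconj_def matrix_mul_assoc)
  thus ?thesis by (simp add: tconj_def conj_mat_mult matrix_mul_assoc)
qed

lemma tconj_tconj [simp]: "tconj (tconj A) = A"
  by (simp add: mat3_eq)

lemma conjugation_tconj: "conjugation tconj"
  by (simp add: conjugation_def mat3_eq)

lemma left_inverse_unique:
  fixes P R X :: "complex^3^3"
  assumes "X ** P = mat 1" "P ** R = mat 1"
  shows "X = R"
proof -
  have "X = X ** (P ** R)" by (simp add: assms)
  also have "\<dots> = R" unfolding matrix_mul_assoc assms(1) by simp
  finally show ?thesis .
qed

text \<open>A matrix \<open>P\<close> fixed by \<open>tconj\<close> is a real base change for the
  twisted form; by uniqueness of inverses \<open>R\<close> is fixed too.\<close>

lemma lie_iso_twisted_conjugate:
  assumes PR: "P ** R = mat 1" "R ** P = mat 1" and P: "tconj P = P"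
  shows "lie_iso tconj tconj (\<lambda>A. R ** A ** P)"
proof (rule lie_iso_conjugate[OF PR])
  fix A
  have "tconj R ** P = tconj (R ** P)" by (simp add: tconj_mult P)
  also have "\<dots> = mat 1" by (simp add: PR tconj_def conj_mat_one)
  finally have "tconj R = R" using PR(1) by (rule left_inverse_unique)
  thus "R ** tconj A ** P = tconj (R ** A ** P)" by (simp add: tconj_mult P)
qed

text \<open>The hypothesis on \<open>P\<close> says that its outer columns are conjugate to each
  other and its middle column is real; in such a basis entrywise conjugation becomes
  \<open>tconj\<close>.\<close>

lemma lie_iso_untwist:
  assumes PR: "P ** R = mat 1" "R ** P = mat 1" and P: "conj_mat P = P ** smat"
  shows "lie_iso conj_mat tconj (\<lambda>A. R ** A ** P)"
proof (rule lie_iso_conjugate[OF PR])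
  fix A
  have P': "conj_mat P ** smat = P"
    unfolding P by (simp flip: matrix_mul_assoc)
  have "smat ** conj_mat R ** P = smat ** conj_mat (R ** P) ** smat"
    by (simp add: conj_mat_mult P' flip: matrix_mul_assoc)
  also have "\<dots> = mat 1" by (simp add: PR conj_mat_one)
  finally have R': "smat ** conj_mat R = R" using PR(1) by (rule left_inverse_unique)
  have "tconj (R ** A ** P) = (smat ** conj_mat R) ** conj_mat A ** (conj_mat P ** smat)"
    by (simp only: tconj_def conj_mat_mult matrix_mul_assoc)
  thus "R ** conj_mat A ** P = tconj (R ** A ** P)" by (simp add: P' R')
qed

text \<open>The outer automorphism, used to exchange invariant planes for invariant lines.\<close>

lemma lie_iso_dual: "lie_iso conj_mat conj_mat (\<lambda>A :: complex^'n^'n. - transpose A)"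
proof -
  have "bij (\<lambda>A :: complex^'n^'n. - transpose A)"
    by (rule o_bij[of "\<lambda>A. - transpose A"]) (auto simp: fun_eq_iff transpose_def vec_eq_iff)
  moreover have "- transpose (lie_bracket A B) = lie_bracket (- transpose A) (- transpose B)"
    for A B :: "complex^'n^'n"
    by (simp add: vec_eq_iff transpose_def lie_bracket_def matrix_matrix_mult_def sum_negf mult.commute)
  moreover have "trace (- transpose A) = - trace A" for A :: "complex^'n^'n"
    by (simp add: trace_def transpose_def sum_negf)
  moreover have "- transpose (A + B) = - transpose A + - transpose B"
    "- transpose (c *\<^sub>C A) = c *\<^sub>C - transpose A"
    "- transpose (conj_mat A) = conj_mat (- transpose A)" for A B :: "complex^'n^'n" and c
    by (simp_all add: vec_eq_iff transpose_def)
  ultimately show ?thesis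
    unfolding lie_iso_def by simp
qed

lemma lie_iso_tdual: "lie_iso tconj tconj tdual"
proof -
  have "bij tdual"
    by (rule o_bij[of tdual]) (simp_all add: fun_eq_iff mat3_eq)
  moreover have "tdual (lie_bracket A B) = lie_bracket (tdual A) (tdual B)" for A B
    by (simp add: mat3_eq bracket_nth mult3)
  moreover have "trace (tdual A) = - trace A" for A
    by (simp add: trace3)
  ultimately show ?thesis
    unfolding lie_iso_def by (simp add: mat3_eq)
qed

text \<open>A real \<open>u\<close> would also be an eigenvector of the conjugate of
  \<open>M\<close>, hence of all of \<open>sl\<close>, but a suitable matrix unit moves it out of
  its line.\<close>

lemma no_real_eigenvector:
  fixes M :: "(complex^3^3) set"
  assumes M: "inv_subalgebra conj_mat M" and u: "\<And>A. A \<in> M \<Longrightarrow> \<exists>c. A *v u = c *s u"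
    and real: "\<And>i. cnj (u$i) = u$i" and nz: "u$j \<noteq> 0"
  shows False
proof -
  obtain k where k: "k \<noteq> j" by (metis exhaust_3 zero_neq_one one_neq_zero )
  have "mat_unit k j \<in> (sl :: (complex^3^3) set)"
    using k by (auto simp: sl_def trace_def intro!: sum.neutral)
  then obtain A B where AB: "A \<in> M" "B \<in> M" "mat_unit k j = A + conj_mat B"
    using M unfolding inv_subalgebra_def by blast
  obtain a b where a: "A *v u = a *s u" and b: "B *v u = b *s u" using u AB by blast
  have "conj_mat B *v u = cnj b *s u"
  proof -
    have "(conj_mat B *v u)$i = cnj ((B *v u)$i)" for i
      by (simp add: matrix_vector_mult_def real)
    thus ?thesis by (simp add: b real vec_eq_iff)
  qed
  hence eq: "mat_unit k j *v u = (a + cnj b) *s u"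
    by (simp add: AB(3) matrix_vector_mult_add_rdistrib a vec_eq_iff distrib_right)
  have v: "(mat_unit k j *v u)$i = (if i = k then u$j else 0)" for i
    using exhaust_3[of j] by (auto simp: multv3)
  have "(mat_unit k j *v u)$j = 0" using v[of j] k by auto
  hence "(a + cnj b) * u$j = 0" unfolding eq vector_smult_component .
  hence "a + cnj b = 0" using nz by simp
  thus False using v[of k] nz by (simp add: eq)
qed

text \<open>The eigenvector \<open>u\<close> is not proportional to a real vector, so
  \<open>u\<close>, some standard basis vector and the conjugate of \<open>u\<close> form a basis,
  in which the invariant line is the first axis.\<close>

lemma parabolic_form_aux:
  fixes M :: "(complex^3^3) set"
  assumes M: "inv_subalgebra conj_mat M" and ev: "has_eigenvector M"
  shows "\<exists>f. lie_iso conj_mat tconj f \<and> (\<forall>A\<in>f ` M. A$2$1 = 0 \<and> A$3$1 = 0)"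
proof -
  obtain u where u: "u \<noteq> 0" "\<And>A. A \<in> M \<Longrightarrow> \<exists>c. A *v u = c *s u"
    using ev by (auto simp: has_eigenvector_def)
  have "\<exists>i j. u$i * cnj (u$j) \<noteq> u$j * cnj (u$i)"
  proof (rule ccontr)
    assume no: "\<not> ?thesis"
    obtain i where i: "u$i \<noteq> 0" using u(1) by (auto simp: vec_eq_iff)
    \<comment> \<open>If all 2 by 2 minors of \<open>u\<close> and its conjugate vanish, dividing
      \<open>u\<close> by a nonzero coordinate makes it real.\<close>
    define w where "w = (1 / u$i) *s u"
    show False
    proof (rule no_real_eigenvector[OF M])
      fix A assume "A \<in> M"
      then obtain c where "A *v u = c *s u" using u by blast
      thus "\<exists>c. A *v w = c *s w"
        by (intro exI[of _ c]) (simp add: w_def vector_scalar_commute vec_eq_iff)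
    next
      show "cnj (w$j) = w$j" for j
        using no i by (simp add: w_def field_simps)
      show "w$i \<noteq> 0" using i by (simp add: w_def)
    qed
  qed
  \<comment> \<open>Expanded along the middle column, these determinants are those minors up to
    sign.\<close>
  hence "\<exists>k. det (\<chi> a b. if b = 1 then u$a else if b = 2 then (if a = k then 1 else 0) else cnj (u$a)) \<noteq> 0"
    by (rule contrapos_pp) (simp add: det_3 forall_3 mult.commute)
  then obtain k where "det (\<chi> a b. if b = 1 then u$a else if b = 2 then (if a = k then 1 else 0) else cnj (u$a)) \<noteq> 0"
    by blast
  moreover define P :: "complex^3^3" where
    "P = (\<chi> a b. if b = 1 then u$a else if b = 2 then (if a = k then 1 else 0) else cnj (u$a))"
  ultimately have "invertible P" by (simp add: invertible_det_nz)
  then obtain R where PR: "P ** R = mat 1" "R ** P = mat 1" by (auto simp: invertible_def)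
  have "conj_mat P = P ** smat"
    by (simp add: mat3_eq mult3 smat_def P_def)
  hence iso: "lie_iso conj_mat tconj (\<lambda>A. R ** A ** P)" by (rule lie_iso_untwist[OF PR])
  have Pu: "P *v axis 1 1 = u" by (simp add: vec_eq_iff multv3 axis_def P_def)
  have "(R ** A ** P)$2$1 = 0 \<and> (R ** A ** P)$3$1 = 0" if A: "A \<in> M" for A
  proof -
    obtain c where c: "A *v u = c *s u" using u A by blast
    have "(R ** A ** P) *v axis 1 1 = R *v (A *v (P *v axis 1 1))"
      by (simp only: matrix_vector_mul_assoc matrix_mul_assoc)
    also have "\<dots> = c *s (R *v (P *v axis 1 1))"
      by (simp only: Pu c vector_scalar_commute)
    also have "\<dots> = c *s axis 1 1" by (simp add: matrix_vector_mul_assoc PR)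
    finally have "((R ** A ** P) *v axis 1 1)$i = (c *s axis 1 1)$i" for i by simp
    from this[of 2] this[of 3] show ?thesis by (simp add: multv3 axis_def)
  qed
  thus ?thesis using iso by blast
qed

lemma parabolic_form:
  fixes M :: "(complex^3^3) set"
  assumes M: "inv_subalgebra conj_mat M"
  shows "\<exists>f. lie_iso conj_mat tconj f \<and> (\<forall>A\<in>f ` M. A$2$1 = 0 \<and> A$3$1 = 0)"
proof -
  have "has_eigenvector M \<or> has_coeigenvector M"
  proof (rule subalgebra_reducible)
    show "cmat.dim M = 4" by (rule dim_inv_subalgebra[OF conjugation_conj_mat M])
  qed (use M in \<open>auto simp: inv_subalgebra_def\<close>)
  thus ?thesis
  proof
    assume "has_eigenvector M"
    thus ?thesis by (rule parabolic_form_aux[OF M])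
  next
    assume co: "has_coeigenvector M"
    let ?d = "\<lambda>A :: complex^3^3. - transpose A"
    have "has_eigenvector (?d ` M)"
      unfolding has_eigenvector_def
    proof -
      obtain u where u: "u \<noteq> 0" "\<And>A. A \<in> M \<Longrightarrow> \<exists>c. transpose A *v u = c *s u"
        using co by (auto simp: has_coeigenvector_def)
      have "\<exists>c. - transpose A *v u = c *s u" if A: "A \<in> M" for A
      proof -
        obtain c where "transpose A *v u = c *s u" using u(2)[OF A] by blast
        moreover have "- transpose A *v u = - (transpose A *v u)"
          by (simp add: matrix_vector_mult_def vec_eq_iff sum_negf)
        ultimately have "- transpose A *v u = (- c) *s u" by (simp add: vec_eq_iff)
        thus ?thesis by blast
      qed
      thus "\<exists>u. u \<noteq> 0 \<and> (\<forall>A\<in>?d ` M. \<exists>c. A *v u = c *s u)" using u by auto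
    qed
    then obtain f where f: "lie_iso conj_mat tconj f" "\<forall>A\<in>f ` ?d ` M. A$2$1 = 0 \<and> A$3$1 = 0"
      using parabolic_form_aux[OF inv_subalgebra_image[OF lie_iso_dual M]] by blast
    thus ?thesis
      by (intro exI[of _ "\<lambda>A. f (?d A)"]) (auto intro: lie_iso_comp[OF lie_iso_dual])
  qed
qed

section \<open>Invariant flags\<close>

text \<open>Roots are taken in the projective line: if the coefficient of \<open>y^2\<close>
  vanishes, the point \<open>(0, 1)\<close> is one.\<close>

lemma binary_quadratic_root:
  fixes p q r :: complex
  shows "\<exists>x y. (x \<noteq> 0 \<or> y \<noteq> 0) \<and> p * y^2 + q * x * y + r * x^2 = 0"
proof (cases "p = 0")
  case True
  thus ?thesis by (intro exI[of _ 0] exI[of _ 1]) simp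
next
  case False
  define s where "s = csqrt (q^2 - 4 * p * r)"
  have s: "s^2 = q^2 - 4 * p * r" by (simp add: s_def)
  have "4 * p * (p * ((s - q) / (2 * p))^2 + q * ((s - q) / (2 * p)) + r) = (s - q)^2 + 2 * q * (s - q) + 4 * p * r"
    using False by (simp add: field_simps power2_eq_square)
  also have "\<dots> = s^2 - q^2 + 4 * p * r" by (simp add: power2_eq_square algebra_simps)
  also have "\<dots> = 0" using s by simp
  finally have "p * ((s - q) / (2 * p))^2 + q * ((s - q) / (2 * p)) + r = 0" using False by simp
  thus ?thesis by (intro exI[of _ 1] exI[of _ "(s - q) / (2 * p)"]) simp
qed

text \<open>A traceless 2x2 matrix is identified with the triple \<open>(c, h, b)\<close> of its lower left entry, the
  difference of its diagonal entries and its upper right entry; a row vector \<open>(x, y)\<close> is an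
  eigenvector iff the associated binary quadratic form vanishes at it.\<close>

lemma solvable_gl2_eigenvector:
  fixes c h b c' h' b' \<alpha> \<beta> :: complex
  assumes C: "c * h' - c' * h = \<alpha> * c + \<beta> * c'" "2 * (b * c' - b' * c) = \<alpha> * h + \<beta> * h'"
    "h * b' - h' * b = \<alpha> * b + \<beta> * b'"
  shows "\<exists>x y. (x \<noteq> 0 \<or> y \<noteq> 0) \<and> c * y^2 + h * x * y - b * x^2 = 0 \<and> c' * y^2 + h' * x * y - b' * x^2 = 0"
proof -
  \<comment> \<open>The bracket of the two traceless matrices, in the same coordinates.\<close>
  define u v w where uvw: "u = c * h' - c' * h" "v = 2 * (b * c' - b' * c)" "w = h * b' - h' * b"
  \<comment> \<open>The bracket is orthogonal to both matrices for the trace form; lying in their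
    span, it is orthogonal to itself, that is, nilpotent.\<close>
  have A: "c * w + h * v / 2 + b * u = 0" "c' * w + h' * v / 2 + b' * u = 0"
    unfolding uvw by (simp_all add: field_simps)
  have lin: "u = \<alpha> * c + \<beta> * c'" "v = \<alpha> * h + \<beta> * h'" "w = \<alpha> * b + \<beta> * b'"
    using C uvw by auto
  have "2 * u * w + v^2 / 2 = u * w + v * v / 2 + w * u" by (simp add: power2_eq_square)
  also have "\<dots> = \<alpha> * (c * w + h * v / 2 + b * u) + \<beta> * (c' * w + h' * v / 2 + b' * u)"
    by (subst (1) lin(1), subst (1) lin(2), subst (2) lin(3)) (simp add: field_simps)
  also have "\<dots> = 0" unfolding A by simp
  finally have "2 * (2 * u * w + v^2 / 2) = 0" by simp
  hence disc: "4 * (u * w) + v^2 = 0" by (simp add: algebra_simps)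
  show ?thesis
  proof (cases "u = 0")
    \<comment> \<open>\<open>(2 * u, - v)\<close> spans the eigenline of the nonzero nilpotent
      bracket, and both matrices preserve it.\<close>
    case False
    have "c * v^2 - 2 * h * v * u - 4 * b * u^2 = c * (4 * (u * w) + v^2) - 4 * u * (c * w + h * v / 2 + b * u)"
      by (simp add: power2_eq_square field_simps)
    hence 1: "c * v^2 - 2 * h * v * u - 4 * b * u^2 = 0" by (simp add: disc A)
    have "c' * v^2 - 2 * h' * v * u - 4 * b' * u^2 = c' * (4 * (u * w) + v^2) - 4 * u * (c' * w + h' * v / 2 + b' * u)"
      by (simp add: power2_eq_square field_simps)
    hence 2: "c' * v^2 - 2 * h' * v * u - 4 * b' * u^2 = 0" by (simp add: disc A)
    show ?thesis
      using False 1 2 by (intro exI[of _ "2 * u"] exI[of _ "- v"]) (simp add: power2_eq_square algebra_simps)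
  next
    case u: True
    hence v: "v = 0" using disc by simp
    show ?thesis
    proof (cases "w = 0")
      case False
      hence "c = 0" "c' = 0" using A u v by auto
      thus ?thesis by (intro exI[of _ 0] exI[of _ 1]) simp
    next
      case w: True
      show ?thesis
      proof (cases "c = 0 \<and> h = 0 \<and> b = 0")
        case True
        thus ?thesis using binary_quadratic_root[of c' h' "- b'"] by auto
      next
        case False
        \<comment> \<open>The matrices commute, so their triples are proportional and a root for the
          nonzero one serves both.\<close>
        obtain k where k: "c' = k * c" "h' = k * h" "b' = k * b"
        proof -
          consider "c \<noteq> 0" | "h \<noteq> 0" | "b \<noteq> 0" using False by blast
          thus thesis
          proof cases
            case 1 thus thesis using u v w by (intro that[of "c' / c"]) (auto simp: uvw field_simps)
          next
            case 2 thus thesis using u v w by (intro that[of "h' / h"]) (auto simp: uvw field_simps)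
          next
            case 3 thus thesis using u v w by (intro that[of "b' / b"]) (auto simp: uvw field_simps)
          qed
        qed
        obtain x y where xy: "x \<noteq> 0 \<or> y \<noteq> 0" "c * y^2 + h * x * y - b * x^2 = 0"
          using binary_quadratic_root[of c h "- b"] by auto
        have "c' * y^2 + h' * x * y - b' * x^2 = k * (c * y^2 + h * x * y - b * x^2)"
          by (simp add: k algebra_simps)
        thus ?thesis using xy by auto
      qed
    qed
  qed
qed

section \<open>From an invariant line to an invariant flag\<close>

lemma three_functionals:
  fixes N :: "(complex^'n^'n) set"
  assumes N: "cmat.subspace N" "cmat.dim N \<ge> 4"
    and f: "\<And>A B. f (A + B) = f A + f B" "\<And>c A. f (c *\<^sub>C A) = c * f A"
    and g: "\<And>A B. g (A + B) = g A + g B" "\<And>c A. g (c *\<^sub>C A) = c * g A"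
    and h: "\<And>A B. h (A + B) = h A + h B" "\<And>c A. h (c *\<^sub>C A) = c * h A"
  shows "\<exists>A\<in>N. A \<noteq> 0 \<and> f A = 0 \<and> g A = 0 \<and> h A = 0"
proof -
  have s1: "cmat.subspace {A\<in>N. f A = 0}" by (rule subspace_kernel[OF N(1) f])
  have s2: "cmat.subspace {A\<in>{A\<in>N. f A = 0}. g A = 0}" by (rule subspace_kernel[OF s1 g])
  have s3: "cmat.subspace {A\<in>{A\<in>{A\<in>N. f A = 0}. g A = 0}. h A = 0}" by (rule subspace_kernel[OF s2 h])
  have "cmat.dim {A\<in>{A\<in>{A\<in>N. f A = 0}. g A = 0}. h A = 0} > 0"
    using dim_kernel_le[OF N(1) f] dim_kernel_le[OF s1 g] dim_kernel_le[OF s2 h] N(2) by linarith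
  from subspace_nonzero[OF s3 this] show ?thesis by auto
qed

text \<open>The equation says that \<open>(x, y)\<close> is a left eigenvector of the lower right
  blocks; the kernel of the row \<open>(0, x, y)\<close> is then an invariant plane containing the
  invariant line. The cases are the dimension of the ideal of elements with zero block: one, two or
  zero.\<close>

lemma parabolic_coeigenvector:
  fixes N :: "(complex^3^3) set"
  assumes N: "inv_subalgebra tconj N" and par: "\<And>A. A \<in> N \<Longrightarrow> A$2$1 = 0 \<and> A$3$1 = 0"
  shows "\<exists>x y. (x \<noteq> 0 \<or> y \<noteq> 0) \<and>
    (\<forall>A\<in>N. (x * A$2$2 + y * A$3$2) * y = (x * A$2$3 + y * A$3$3) * x)"
proof -
  have sub: "cmat.subspace N" and sl: "N \<subseteq> sl" and br: "\<And>A B. A \<in> N \<Longrightarrow> B \<in> N \<Longrightarrow> lie_bracket A B \<in> N"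
    and int: "\<And>A. A \<in> N \<Longrightarrow> tconj A \<in> N \<Longrightarrow> A = 0"
  proof -
    fix A assume "A \<in> N" "tconj A \<in> N"
    hence "A \<in> tconj ` N" by (metis tconj_tconj imageI)
    thus "A = 0" using N \<open>A \<in> N\<close> by (auto simp: inv_subalgebra_def)
  qed (use N in \<open>auto simp: inv_subalgebra_def\<close>)
  have dim: "cmat.dim N = 4" by (rule dim_inv_subalgebra[OF conjugation_tconj N])
  have tr: "A$1$1 = - A$2$2 - A$3$3" if "A \<in> N" for A
  proof -
    have "A$1$1 + A$2$2 + A$3$3 = 0" using that sl by (auto simp: sl_def trace3)
    moreover have "A$1$1 = (A$1$1 + A$2$2 + A$3$3) - A$2$2 - A$3$3" by simp
    ultimately show ?thesis by simp
  qed
  \<comment> \<open>In \<open>N\<close> such an element has only the entries 12 and 13, because the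
    trace vanishes.\<close>
  define small where "small A \<longleftrightarrow> A$2$2 = 0 \<and> A$2$3 = 0 \<and> A$3$2 = 0 \<and> A$3$3 = 0" for A :: "complex^3^3"
  show ?thesis
  proof (cases "\<exists>E\<in>N. small E \<and> E \<noteq> 0")
    case True
    then obtain E where E: "E \<in> N" "small E" "E \<noteq> 0" by blast
    define p q where pq: "p = E$1$2" "q = E$1$3"
    have E0: "E$1$1 = 0" "E$2$1 = 0" "E$3$1 = 0" "E$2$2 = 0" "E$2$3 = 0" "E$3$2 = 0" "E$3$3 = 0"
      using E tr par by (auto simp: small_def)
    have pq0: "p \<noteq> 0 \<or> q \<noteq> 0" using E(3) E0 pq by (auto simp: mat3_eq)
    show ?thesis
    proof (cases "\<forall>X\<in>N. small X \<longrightarrow> (\<exists>c. X = c *\<^sub>C E)")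
      \<comment> \<open>\<open>[E, A]\<close> lies again in the ideal spanned by \<open>E\<close>,
        so the first row of \<open>E\<close> provides the left eigenvector.\<close>
      case True
      have "(p * A$2$2 + q * A$3$2) * q = (p * A$2$3 + q * A$3$3) * p" if A: "A \<in> N" for A
      proof -
        have "small (lie_bracket E A)"
          using par[OF A] by (simp add: small_def bracket_nth mult3 E0)
        then obtain c where c: "lie_bracket E A = c *\<^sub>C E" using True br[OF E(1) A] by blast
        have 1: "p * A$2$2 + q * A$3$2 - A$1$1 * p = c * p" "p * A$2$3 + q * A$3$3 - A$1$1 * q = c * q"
          using arg_cong[OF c, of "\<lambda>X. X$1$2"] arg_cong[OF c, of "\<lambda>X. X$1$3"]
          by (simp_all add: bracket_nth mult3 E0 pq)
        hence "p * A$2$2 + q * A$3$2 = (c + A$1$1) * p" "p * A$2$3 + q * A$3$3 = (c + A$1$1) * q"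
          by (simp_all add: algebra_simps)
        thus ?thesis by simp
      qed
      thus ?thesis using pq0 by blast
    next
      \<comment> \<open>The ideal contains the independent pair \<open>E\<close>, \<open>F\<close>,
        so \<open>A\<close> and \<open>A'\<close> represent the quotient and their blocks span a
        subalgebra of gl(2) of dimension at most two.\<close>
      case False
      then obtain F where F: "F \<in> N" "small F" "\<And>c. F \<noteq> c *\<^sub>C E" by blast
      have "\<not> cmat.dependent {E, F}"
        using E(3) F(3) by (simp add: cmat.independent_insert cmat.span_singleton insert_commute[of E F] image_iff)
      then obtain B where B: "{E, F} \<subseteq> B" "B \<subseteq> N" "\<not> cmat.dependent B" "N \<subseteq> cmat.span B"
        using cmat.maximal_independent_subset_extend[of "{E, F}" N] E F by blast
      have cardB: "card B = 4"
        using cmat.dim_unique[OF B(2) B(4) B(3)] dim by simp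
      have fin: "finite B" using cardB card.infinite by fastforce
      have EF: "E \<noteq> F" using F(3)[of 1] by auto
      have "card (B - {E, F}) = Suc (Suc 0)"
        using B(1) cardB EF fin by (simp add: card_Diff_subset)
      then obtain A A' where AA': "B - {E, F} = {A, A'}" unfolding card_Suc_eq by auto
      have AN: "A \<in> N" "A' \<in> N" using AA' B(2) by auto
      have "B \<subseteq> {A, A', E, F}" using AA' by auto
      hence span: "X \<in> cmat.span {A, A', E, F}" if "X \<in> N" for X
        using B(4) that cmat.span_mono by blast
      have ex: "\<exists>\<alpha> \<beta>. small (X - \<alpha> *\<^sub>C A - \<beta> *\<^sub>C A')" if X: "X \<in> N" for X
      proof -
        obtain \<alpha> \<beta> \<gamma> \<delta> where "X - \<alpha> *\<^sub>C A - \<beta> *\<^sub>C A' - \<gamma> *\<^sub>C E - \<delta> *\<^sub>C F = 0"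
          using span[OF X] unfolding cmat.span_insert cmat.span_empty by auto
        hence "X - \<alpha> *\<^sub>C A - \<beta> *\<^sub>C A' = \<gamma> *\<^sub>C E + \<delta> *\<^sub>C F" by (simp add: algebra_simps)
        hence "small (X - \<alpha> *\<^sub>C A - \<beta> *\<^sub>C A')" using E(2) F(2) by (simp add: small_def)
        thus ?thesis by blast
      qed
      obtain \<alpha> \<beta> where ab: "small (lie_bracket A A' - \<alpha> *\<^sub>C A - \<beta> *\<^sub>C A')"
        using ex[OF br[OF AN]] by blast
      have z: "A$2$1 = 0" "A$3$1 = 0" "A'$2$1 = 0" "A'$3$1 = 0" using par AN by auto
      have "\<exists>x y. (x \<noteq> 0 \<or> y \<noteq> 0) \<and> A$3$2 * y^2 + (A$2$2 - A$3$3) * x * y - A$2$3 * x^2 = 0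
          \<and> A'$3$2 * y^2 + (A'$2$2 - A'$3$3) * x * y - A'$2$3 * x^2 = 0"
      proof (rule solvable_gl2_eigenvector)
        have eqs: "lie_bracket A A' $ 2 $ 2 = \<alpha> * A$2$2 + \<beta> * A'$2$2"
          "lie_bracket A A' $ 2 $ 3 = \<alpha> * A$2$3 + \<beta> * A'$2$3"
          "lie_bracket A A' $ 3 $ 2 = \<alpha> * A$3$2 + \<beta> * A'$3$2"
          "lie_bracket A A' $ 3 $ 3 = \<alpha> * A$3$3 + \<beta> * A'$3$3"
          using ab by (simp_all add: small_def diff_eq_eq add.commute)
        have 32: "A$3$2 * A'$2$2 + A$3$3 * A'$3$2 - (A'$3$2 * A$2$2 + A'$3$3 * A$3$2) = \<alpha> * A$3$2 + \<beta> * A'$3$2"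
          unfolding eqs(3)[symmetric] by (simp add: bracket_nth mult3 z)
        have 22: "A$2$3 * A'$3$2 - A'$2$3 * A$3$2 = \<alpha> * A$2$2 + \<beta> * A'$2$2"
          unfolding eqs(1)[symmetric] by (simp add: bracket_nth mult3 z)
        have 33: "A$3$2 * A'$2$3 - A'$3$2 * A$2$3 = \<alpha> * A$3$3 + \<beta> * A'$3$3"
          unfolding eqs(4)[symmetric] by (simp add: bracket_nth mult3 z)
        have 23: "A$2$2 * A'$2$3 + A$2$3 * A'$3$3 - (A'$2$2 * A$2$3 + A'$2$3 * A$3$3) = \<alpha> * A$2$3 + \<beta> * A'$2$3"
          unfolding eqs(2)[symmetric] by (simp add: bracket_nth mult3 z)
        show "A$3$2 * (A'$2$2 - A'$3$3) - A'$3$2 * (A$2$2 - A$3$3) = \<alpha> * A$3$2 + \<beta> * A'$3$2"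
          unfolding 32[symmetric] by (simp add: algebra_simps)
        show "2 * (A$2$3 * A'$3$2 - A'$2$3 * A$3$2) = \<alpha> * (A$2$2 - A$3$3) + \<beta> * (A'$2$2 - A'$3$3)"
        proof -
          have "2 * (A$2$3 * A'$3$2 - A'$2$3 * A$3$2) = (A$2$3 * A'$3$2 - A'$2$3 * A$3$2) - (A$3$2 * A'$2$3 - A'$3$2 * A$2$3)"
            by (simp add: algebra_simps)
          also have "\<dots> = (\<alpha> * A$2$2 + \<beta> * A'$2$2) - (\<alpha> * A$3$3 + \<beta> * A'$3$3)" by (simp only: 22 33)
          finally show ?thesis by (simp add: algebra_simps)
        qed
        show "(A$2$2 - A$3$3) * A'$2$3 - (A'$2$2 - A'$3$3) * A$2$3 = \<alpha> * A$2$3 + \<beta> * A'$2$3"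
          unfolding 23[symmetric] by (simp add: algebra_simps)
      qed
      then obtain x y where xy: "x \<noteq> 0 \<or> y \<noteq> 0"
        "A$3$2 * y^2 + (A$2$2 - A$3$3) * x * y - A$2$3 * x^2 = 0"
        "A'$3$2 * y^2 + (A'$2$2 - A'$3$3) * x * y - A'$2$3 * x^2 = 0" by blast
      have "(x * X$2$2 + y * X$3$2) * y = (x * X$2$3 + y * X$3$3) * x" if X: "X \<in> N" for X
      proof -
        obtain \<gamma> \<delta> where "small (X - \<gamma> *\<^sub>C A - \<delta> *\<^sub>C A')" using ex[OF X] by blast
        hence s: "X$2$2 = \<gamma> * A$2$2 + \<delta> * A'$2$2" "X$2$3 = \<gamma> * A$2$3 + \<delta> * A'$2$3"
          "X$3$2 = \<gamma> * A$3$2 + \<delta> * A'$3$2" "X$3$3 = \<gamma> * A$3$3 + \<delta> * A'$3$3"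
          by (simp_all add: small_def diff_eq_eq add.commute)
        have "(x * X$2$2 + y * X$3$2) * y - (x * X$2$3 + y * X$3$3) * x
          = \<gamma> * (A$3$2 * y^2 + (A$2$2 - A$3$3) * x * y - A$2$3 * x^2)
          + \<delta> * (A'$3$2 * y^2 + (A'$2$2 - A'$3$3) * x * y - A'$2$3 * x^2)"
          unfolding s by (simp add: power2_eq_square algebra_simps)
        thus ?thesis unfolding xy by simp
      qed
      thus ?thesis using xy(1) by blast
    qed
  next
    case False
    \<comment> \<open>Reading off the block is now injective on \<open>N\<close>, and by dimension
      onto; the four elements \<open>D22\<close>, \<open>D23\<close>, \<open>D32\<close>,
      \<open>D33\<close> lift the matrix units.\<close>
    have small0: "A = 0" if "A \<in> N" "small A" for A using False that by blast
    have dim4: "cmat.dim N \<ge> 4" using dim by simp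
    obtain D22 where D22: "D22 \<in> N" "D22$2$2 = 1" "D22$2$3 = 0" "D22$3$2 = 0" "D22$3$3 = 0"
    proof -
      obtain D where D: "D \<in> N" "D \<noteq> 0" "D$2$3 = 0" "D$3$2 = 0" "D$3$3 = 0"
        using three_functionals[OF sub dim4, of "\<lambda>A. A$2$3" "\<lambda>A. A$3$2" "\<lambda>A. A$3$3"] by auto
      hence "D$2$2 \<noteq> 0" using small0 by (auto simp: small_def)
      thus thesis using D cmat.subspace_scale[OF sub D(1)] by (intro that[of "(1 / D$2$2) *\<^sub>C D"]) auto
    qed
    obtain D23 where D23: "D23 \<in> N" "D23$2$2 = 0" "D23$2$3 = 1" "D23$3$2 = 0" "D23$3$3 = 0"
    proof -
      obtain D where D: "D \<in> N" "D \<noteq> 0" "D$2$2 = 0" "D$3$2 = 0" "D$3$3 = 0"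
        using three_functionals[OF sub dim4, of "\<lambda>A. A$2$2" "\<lambda>A. A$3$2" "\<lambda>A. A$3$3"] by auto
      hence "D$2$3 \<noteq> 0" using small0 by (auto simp: small_def)
      thus thesis using D cmat.subspace_scale[OF sub D(1)] by (intro that[of "(1 / D$2$3) *\<^sub>C D"]) auto
    qed
    obtain D32 where D32: "D32 \<in> N" "D32$2$2 = 0" "D32$2$3 = 0" "D32$3$2 = 1" "D32$3$3 = 0"
    proof -
      obtain D where D: "D \<in> N" "D \<noteq> 0" "D$2$2 = 0" "D$2$3 = 0" "D$3$3 = 0"
        using three_functionals[OF sub dim4, of "\<lambda>A. A$2$2" "\<lambda>A. A$2$3" "\<lambda>A. A$3$3"] by auto
      hence "D$3$2 \<noteq> 0" using small0 by (auto simp: small_def)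
      thus thesis using D cmat.subspace_scale[OF sub D(1)] by (intro that[of "(1 / D$3$2) *\<^sub>C D"]) auto
    qed
    obtain D33 where D33: "D33 \<in> N" "D33$2$2 = 0" "D33$2$3 = 0" "D33$3$2 = 0" "D33$3$3 = 1"
    proof -
      obtain D where D: "D \<in> N" "D \<noteq> 0" "D$2$2 = 0" "D$2$3 = 0" "D$3$2 = 0"
        using three_functionals[OF sub dim4, of "\<lambda>A. A$2$2" "\<lambda>A. A$2$3" "\<lambda>A. A$3$2"] by auto
      hence "D$3$3 \<noteq> 0" using small0 by (auto simp: small_def)
      thus thesis using D cmat.subspace_scale[OF sub D(1)] by (intro that[of "(1 / D$3$3) *\<^sub>C D"]) auto
    qed
    \<comment> \<open>\<open>E\<close> lifts the identity, so \<open>[E, X]\<close> has zero block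
      and vanishes: \<open>N\<close> is cut out by commuting with \<open>E\<close>, as
      \<open>rel\<close> and \<open>mem\<close> spell out.\<close>
    define E where "E = D22 + D33"
    have E: "E \<in> N" "E$2$2 = 1" "E$2$3 = 0" "E$3$2 = 0" "E$3$3 = 1" "E$2$1 = 0" "E$3$1 = 0" "E$1$1 = - 2"
      using D22 D33 par tr cmat.subspace_add[OF sub D22(1) D33(1)] by (auto simp: E_def)
    define e f where ef: "e = E$1$2" "f = E$1$3"
    have rel: "3 * X$1$2 = e * (X$2$2 - X$1$1) + f * X$3$2" "3 * X$1$3 = e * X$2$3 + f * (X$3$3 - X$1$1)"
      if X: "X \<in> N" for X
    proof -
      have "small (lie_bracket E X)" using par[OF X] E by (simp add: small_def bracket_nth mult3)
      hence 0: "lie_bracket E X = 0" using small0 br[OF E(1) X] by blast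
      show "3 * X$1$2 = e * (X$2$2 - X$1$1) + f * X$3$2"
        using arg_cong[OF 0, of "\<lambda>X. X$1$2"] par[OF X] E by (simp add: bracket_nth mult3 ef algebra_simps)
      show "3 * X$1$3 = e * X$2$3 + f * (X$3$3 - X$1$1)"
        using arg_cong[OF 0, of "\<lambda>X. X$1$3"] par[OF X] E by (simp add: bracket_nth mult3 ef algebra_simps)
    qed
    have mem: "Z \<in> N" if Z: "Z$2$1 = 0" "Z$3$1 = 0" "Z$1$1 = - Z$2$2 - Z$3$3"
      "3 * Z$1$2 = e * (Z$2$2 - Z$1$1) + f * Z$3$2" "3 * Z$1$3 = e * Z$2$3 + f * (Z$3$3 - Z$1$1)" for Z
    proof -
      define M where "M = Z$2$2 *\<^sub>C D22 + Z$2$3 *\<^sub>C D23 + Z$3$2 *\<^sub>C D32 + Z$3$3 *\<^sub>C D33"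
      have MN: "M \<in> N" unfolding M_def
        by (intro cmat.subspace_add[OF sub] cmat.subspace_scale[OF sub] D22 D23 D32 D33)
      have low: "M$2$2 = Z$2$2" "M$2$3 = Z$2$3" "M$3$2 = Z$3$2" "M$3$3 = Z$3$3"
        using D22 D23 D32 D33 by (simp_all add: M_def)
      have c1: "M$2$1 = 0" "M$3$1 = 0" "M$1$1 = Z$1$1" using par[OF MN] tr[OF MN] Z low by auto
      have "3 * M$1$2 = 3 * Z$1$2" "3 * M$1$3 = 3 * Z$1$3"
        unfolding rel[OF MN] Z low c1 by simp_all
      hence "M$1$2 = Z$1$2" "M$1$3 = Z$1$3" by simp_all
      hence "M = Z" using low c1 Z by (simp add: mat3_eq)
      thus ?thesis using MN by simp
    qed
    \<comment> \<open>The conditions for the matrix \<open>Z\<close> below and for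
      \<open>tconj Z\<close> to satisfy \<open>mem\<close>. With \<open>a = 1\<close> they form a
      linear system for \<open>p\<close> and \<open>q\<close> of determinant
      \<open>9 - f * cnj f\<close>; where that vanishes, \<open>a = 0\<close> has a nonzero
      solution.\<close>
    have "\<exists>a p q :: complex. (a \<noteq> 0 \<or> q \<noteq> 0) \<and> cnj a = a \<and> 3 * p = e * (- 3 * a) + f * q
        \<and> 3 * cnj q = e * (- 3 * a) + f * cnj p"
    proof (cases "f * cnj f = 9")
      case True
      thus ?thesis by (intro exI[of _ 0] exI[of _ "f / 3"] exI[of _ 1]) simp
    next
      case False
      define d where "d = 3 - f * cnj f / 3"
      have d: "d \<noteq> 0" "cnj d = d" using False by (auto simp: d_def field_simps)
      define p q where pq: "p = (- 3 * e - f * cnj e) / d" "q = - cnj e + cnj f * p / 3"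
      have "3 * p - f * cnj f * p / 3 = d * p" by (simp add: d_def algebra_simps)
      also have "\<dots> = - 3 * e - f * cnj e" using d by (simp add: pq(1))
      finally have "3 * p = e * (- 3 * 1) + f * q" by (simp add: pq(2) algebra_simps)
      moreover have "3 * cnj q = e * (- 3 * 1) + f * cnj p" by (simp add: pq(2) algebra_simps)
      ultimately show ?thesis by (intro exI[of _ 1] exI[of _ p] exI[of _ q]) simp
    qed
    then obtain a p q where apq: "a \<noteq> 0 \<or> q \<noteq> 0" "cnj a = a" "3 * p = e * (- 3 * a) + f * q"
      "3 * cnj q = e * (- 3 * a) + f * cnj p" by blast
    define Z :: "complex^3^3" where "Z = vector [vector [a, p, 0], vector [0, - 2 * a, 0], vector [0, q, a]]"
    have "Z \<in> N" using apq by (intro mem) (simp_all add: Z_def)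
    moreover have "tconj Z \<in> N" using apq by (intro mem) (simp_all add: Z_def)
    ultimately have "Z = 0" by (rule int)
    hence "Z$1$1 = 0" "Z$3$2 = 0" by simp_all
    hence False using apq(1) by (simp add: Z_def)
    thus ?thesis ..
  qed
qed

text \<open>A unipotent base change, real for \<open>tconj\<close>, turns the left eigenvector
  \<open>(x, y)\<close> into \<open>(0, y)\<close> and so clears the entry 32.\<close>

lemma triangular_form:
  fixes N :: "(complex^3^3) set"
  assumes N: "inv_subalgebra tconj N" and par: "\<And>A. A \<in> N \<Longrightarrow> A$2$1 = 0 \<and> A$3$1 = 0"
  shows "\<exists>f. lie_iso tconj tconj f \<and> (\<forall>A\<in>f ` N. A$2$1 = 0 \<and> A$3$1 = 0 \<and> A$3$2 = 0)"
proof -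
  obtain x y where xy: "x \<noteq> 0 \<or> y \<noteq> 0"
    "\<And>A. A \<in> N \<Longrightarrow> (x * A$2$2 + y * A$3$2) * y = (x * A$2$3 + y * A$3$3) * x"
    using parabolic_coeigenvector[OF assms] by blast
  \<comment> \<open>For \<open>y = 0\<close> the entry 23 would vanish on \<open>N\<close>, and also
    on the conjugate of \<open>N\<close>, where it is the conjugate of the entry 21; the two could
    not fill \<open>sl\<close>.\<close>
  have "y \<noteq> 0"
  proof
    assume "y = 0"
    hence z: "A$2$3 = 0" if "A \<in> N" for A using xy that by auto
    have "mat_unit 2 3 \<in> (sl :: (complex^3^3) set)" by (simp add: sl_def trace3)
    then obtain A B where "A \<in> N" "B \<in> N" "mat_unit 2 3 = A + tconj B"
      using N unfolding inv_subalgebra_def by blast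
    hence "(mat_unit 2 3 :: complex^3^3) $ 2 $ 3 = (A + tconj B) $ 2 $ 3" by (simp only:)
    thus False using z par \<open>A \<in> N\<close> \<open>B \<in> N\<close> by simp
  qed
  define s where "s = - x / y"
  have s: "A$3$2 + s * A$3$3 = s * (A$2$2 + s * A$2$3)" if "A \<in> N" for A
  proof -
    have "y * y * (A$3$2 + s * A$3$3 - s * (A$2$2 + s * A$2$3))
      = (x * A$2$2 + y * A$3$2) * y - (x * A$2$3 + y * A$3$3) * x"
      using \<open>y \<noteq> 0\<close> by (simp add: s_def field_simps)
    thus ?thesis using xy(2)[OF that] \<open>y \<noteq> 0\<close> by simp
  qed
  \<comment> \<open>The entry \<open>s\<close> clears 32, and \<open>cnj s\<close> makes
    \<open>P\<close> fixed by \<open>tconj\<close>.\<close>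
  define P R :: "complex^3^3" where
    "P = vector [vector [1, cnj s, 0], vector [0, 1, 0], vector [0, s, 1]]"
    and "R = vector [vector [1, - cnj s, 0], vector [0, 1, 0], vector [0, - s, 1]]"
  have "P ** R = mat 1" "R ** P = mat 1" "tconj P = P"
    by (simp_all add: mat3_eq mult3 P_def R_def mat_def)
  hence "lie_iso tconj tconj (\<lambda>A. R ** A ** P)" by (rule lie_iso_twisted_conjugate)
  moreover have "(R ** A ** P)$2$1 = 0 \<and> (R ** A ** P)$3$1 = 0 \<and> (R ** A ** P)$3$2 = 0" if "A \<in> N" for A
    using par[OF that] s[OF that] by (simp add: mult3 P_def R_def algebra_simps)
  ultimately show ?thesis by blast
qed

section \<open>Triangular subalgebras\<close>

text \<open>\<open>algebra_I l\<close> in the basis given by the columns of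
  \<open>qmat\<close>.\<close>

definition tI :: "complex \<Rightarrow> (complex^3^3) set" where
  "tI l = {A. A$2$1 = 0 \<and> A$3$1 = 0 \<and> A$3$2 = 0 \<and> A$2$2 = (l - 1) * A$1$1 \<and> A$3$3 = - l * A$1$1}"

text \<open>\<open>algebra_II\<close> in the same basis. It is only block triangular, but its upper
  left blocks share the eigenvectors \<open>(1, 1)\<close> and \<open>(1, -1)\<close>, so it is
  conjugate to a hyperplane in the Borel subalgebra.\<close>

definition tII :: "(complex^3^3) set" where
  "tII = {A. A$3$1 = 0 \<and> A$3$2 = 0 \<and> A$2$1 = A$1$2 \<and> A$2$2 = A$1$1 \<and> A$3$3 = - 2 * A$1$1}"

primrec tlabel :: "label \<Rightarrow> (complex^3^3) set" where
  "tlabel (Label_I l) = tI l"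
| "tlabel Label_II = tII"

section \<open>Coordinates on the Borel subalgebra\<close>

definition triangular :: "(complex^3^3) set" where
  "triangular = {A. A$2$1 = 0 \<and> A$3$1 = 0 \<and> A$3$2 = 0 \<and> A$3$3 = - A$1$1 - A$2$2}"

lemma triangular_iff: "A \<in> triangular \<longleftrightarrow> A \<in> sl \<and> A$2$1 = 0 \<and> A$3$1 = 0 \<and> A$3$2 = 0"
proof -
  have "A$3$3 = - A$1$1 - A$2$2 \<longleftrightarrow> A$1$1 + A$2$2 + A$3$3 = 0" by algebra
  thus ?thesis by (auto simp: triangular_def sl_def trace3)
qed

lemma tdual_image:
  assumes "\<And>A. A \<in> N \<longleftrightarrow> tdual A \<in> N'"
  shows "tdual ` N = N'"
proof -
  have inv: "tdual (tdual A) = A" for A by (simp add: mat3_eq)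
  show ?thesis
  proof (intro equalityI subsetI)
    fix A assume "A \<in> N'"
    hence "tdual A \<in> N" using assms[of "tdual A"] by (simp add: inv)
    thus "A \<in> tdual ` N" using inv[of A] by (metis imageI)
  qed (use assms in auto)
qed

lemma dim_triangular: "cmat.dim triangular = 5"
proof -
  let ?s1 = "{A \<in> sl :: (complex^3^3) set. A$2$1 = 0}"
  let ?s2 = "{A \<in> ?s1. A$3$1 = 0}"
  let ?s3 = "{A \<in> ?s2. A$3$2 = 0}"
  have s1: "cmat.subspace ?s1" by (rule subspace_kernel[OF subspace_sl]) auto
  have s2: "cmat.subspace ?s2" by (rule subspace_kernel[OF s1]) auto
  have "cmat.dim (sl :: (complex^3^3) set) = Suc (cmat.dim ?s1)"
    by (rule dim_kernel[OF subspace_sl, where x = "mat_unit 2 1"]) (auto simp: sl_def trace3)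
  moreover have "cmat.dim ?s1 = Suc (cmat.dim ?s2)"
    by (rule dim_kernel[OF s1, where x = "mat_unit 3 1"]) (auto simp: sl_def trace3)
  moreover have "cmat.dim ?s2 = Suc (cmat.dim ?s3)"
    by (rule dim_kernel[OF s2, where x = "mat_unit 3 2"]) (auto simp: sl_def trace3)
  moreover have "?s3 = triangular" by (auto simp: triangular_iff)
  ultimately show ?thesis by (simp add: dim_sl3)
qed

lemma subspace_triangular: "cmat.subspace triangular"
  by (auto simp: cmat.subspace_def triangular_def right_diff_distrib)

definition tri :: "complex \<Rightarrow> complex \<Rightarrow> complex \<Rightarrow> complex \<Rightarrow> complex \<Rightarrow> complex^3^3" where
  "tri a b x y z = vector [vector [a, x, z], vector [0, b, y], vector [0, 0, - a - b]]"

lemma tri_nth [simp]: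
  "tri a b x y z $ 1 $ 1 = a" "tri a b x y z $ 1 $ 2 = x" "tri a b x y z $ 1 $ 3 = z"
  "tri a b x y z $ 2 $ 1 = 0" "tri a b x y z $ 2 $ 2 = b" "tri a b x y z $ 2 $ 3 = y"
  "tri a b x y z $ 3 $ 1 = 0" "tri a b x y z $ 3 $ 2 = 0" "tri a b x y z $ 3 $ 3 = - a - b"
  by (simp_all add: tri_def)

lemma tri_triangular [simp]: "tri a b x y z \<in> triangular"
  by (simp add: triangular_def)

lemma triangular_eq_tri: "A \<in> triangular \<Longrightarrow> A = tri (A$1$1) (A$2$2) (A$1$2) (A$2$3) (A$1$3)"
  by (simp add: triangular_def mat3_eq)

text \<open>\<open>f\<close> is the coefficient of a fixed vector \<open>b\<close> outside
  \<open>N\<close>, determined modulo \<open>N\<close>; being defined by a choice, it is controlled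
  only on \<open>V\<close>.\<close>

lemma hyperplane_functional:
  fixes N V :: "(complex^'n^'n) set"
  assumes N: "cmat.subspace N" "N \<subseteq> V" and V: "cmat.subspace V" "cmat.dim V = Suc (cmat.dim N)"
  shows "\<exists>f. (\<forall>A\<in>V. \<forall>B\<in>V. f (A + B) = f A + f B) \<and> (\<forall>c. \<forall>A\<in>V. f (c *\<^sub>C A) = c * f A)
    \<and> (\<forall>A\<in>V. A \<in> N \<longleftrightarrow> f A = 0) \<and> (\<exists>A\<in>V. f A \<noteq> 0)"
proof -
  have "\<not> V \<subseteq> N"
  proof
    assume "V \<subseteq> N"
    hence "V = N" using N by auto
    thus False using V by simp
  qed
  then obtain b where b: "b \<in> V" "b \<notin> N" by blast
  have spanN: "cmat.span N = N" using N(1) by (rule cmat.span_eq_iff[THEN iffD2])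
  have "cmat.span (insert b N) = V"
  proof (rule cmatfd.subspace_dim_equal)
    show "cmat.span (insert b N) \<subseteq> V" using b N by (intro cmat.span_minimal V) auto
    have "cmat.dim (insert b N) = Suc (cmat.dim N)" using b by (simp add: cmatfd.dim_insert spanN)
    thus "cmat.dim (cmat.span (insert b N)) \<ge> cmat.dim V" using V by simp
  qed (use V in auto)
  hence ex: "\<exists>k. A - k *\<^sub>C b \<in> N" if "A \<in> V" for A
    using that unfolding cmat.span_insert spanN by auto
  have uniq: "k = k'" if "A - k *\<^sub>C b \<in> N" "A - k' *\<^sub>C b \<in> N" for A k k'
  proof (rule ccontr)
    assume ne: "k \<noteq> k'"
    have "(A - k *\<^sub>C b) - (A - k' *\<^sub>C b) \<in> N" using that by (rule cmat.subspace_diff[OF N(1)])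
    moreover have "(A - k *\<^sub>C b) - (A - k' *\<^sub>C b) = (k' - k) *\<^sub>C b"
      by (simp add: vec_eq_iff algebra_simps)
    ultimately have "(1 / (k' - k)) *\<^sub>C (k' - k) *\<^sub>C b \<in> N"
      using cmat.subspace_scale[OF N(1)] by metis
    thus False using b ne by simp
  qed
  define f where "f A = (SOME k. A - k *\<^sub>C b \<in> N)" for A
  have f: "A - f A *\<^sub>C b \<in> N" if "A \<in> V" for A
    unfolding f_def using ex[OF that] by (rule someI_ex)
  have feq: "f A = k" if "A \<in> V" "A - k *\<^sub>C b \<in> N" for A k
    using uniq f that by blast
  have "f (A + B) = f A + f B" if "A \<in> V" "B \<in> V" for A B
  proof (rule feq)
    have "(A - f A *\<^sub>C b) + (B - f B *\<^sub>C b) \<in> N" using f that by (intro cmat.subspace_add[OF N(1)])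
    moreover have "(A - f A *\<^sub>C b) + (B - f B *\<^sub>C b) = A + B - (f A + f B) *\<^sub>C b"
      by (simp add: vec_eq_iff algebra_simps)
    ultimately show "A + B - (f A + f B) *\<^sub>C b \<in> N" by simp
    show "A + B \<in> V" using that by (intro cmat.subspace_add[OF V(1)])
  qed
  moreover have "f (c *\<^sub>C A) = c * f A" if "A \<in> V" for A c
  proof (rule feq)
    have "c *\<^sub>C (A - f A *\<^sub>C b) \<in> N" using f that by (intro cmat.subspace_scale[OF N(1)])
    moreover have "c *\<^sub>C (A - f A *\<^sub>C b) = c *\<^sub>C A - (c * f A) *\<^sub>C b"
      by (simp add: vec_eq_iff algebra_simps)
    ultimately show "c *\<^sub>C A - (c * f A) *\<^sub>C b \<in> N" by simp
    show "c *\<^sub>C A \<in> V" using that by (intro cmat.subspace_scale[OF V(1)])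
  qed
  moreover have "A \<in> N \<longleftrightarrow> f A = 0" if "A \<in> V" for A
    using f[OF that] feq[OF that, of 0] by auto
  ultimately show ?thesis using b by (intro exI[of _ f]) blast
qed

lemma triangular_functional:
  assumes N: "cmat.subspace N" "N \<subseteq> triangular" "cmat.dim N = 4"
  shows "\<exists>\<alpha> \<beta> \<xi> \<eta> \<zeta>. (\<alpha> \<noteq> 0 \<or> \<beta> \<noteq> 0 \<or> \<xi> \<noteq> 0 \<or> \<eta> \<noteq> 0 \<or> \<zeta> \<noteq> 0) \<and>
    (\<forall>a b x y z. tri a b x y z \<in> N \<longleftrightarrow> \<alpha> * a + \<beta> * b + \<xi> * x + \<eta> * y + \<zeta> * z = 0)"
proof -
  obtain f where f: "\<And>A B. A \<in> triangular \<Longrightarrow> B \<in> triangular \<Longrightarrow> f (A + B) = f A + f B"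
    "\<And>c A. A \<in> triangular \<Longrightarrow> f (c *\<^sub>C A) = c * f A" "\<And>A. A \<in> triangular \<Longrightarrow> A \<in> N \<longleftrightarrow> f A = 0"
    "\<exists>A\<in>triangular. f A \<noteq> 0"
  proof -
    have "cmat.dim triangular = Suc (cmat.dim N)" using N(3) dim_triangular by simp
    from hyperplane_functional[OF N(1,2) subspace_triangular this] show thesis using that by blast
  qed
  define \<alpha> \<beta> \<xi> \<eta> \<zeta> where d: "\<alpha> = f (tri 1 0 0 0 0)" "\<beta> = f (tri 0 1 0 0 0)" "\<xi> = f (tri 0 0 1 0 0)"
    "\<eta> = f (tri 0 0 0 1 0)" "\<zeta> = f (tri 0 0 0 0 1)"
  have eq: "f (tri a b x y z) = \<alpha> * a + \<beta> * b + \<xi> * x + \<eta> * y + \<zeta> * z" for a b x y z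
  proof -
    have "tri a b x y z = a *\<^sub>C tri 1 0 0 0 0 + (b *\<^sub>C tri 0 1 0 0 0 + (x *\<^sub>C tri 0 0 1 0 0
        + (y *\<^sub>C tri 0 0 0 1 0 + z *\<^sub>C tri 0 0 0 0 1)))"
      by (simp add: mat3_eq)
    thus ?thesis
      by (simp add: f(1,2) d cmat.subspace_add[OF subspace_triangular] cmat.subspace_scale[OF subspace_triangular] mult.commute)
  qed
  obtain A where "A \<in> triangular" "f A \<noteq> 0" using f(4) by blast
  hence "f (tri (A$1$1) (A$2$2) (A$1$2) (A$2$3) (A$1$3)) \<noteq> 0" using triangular_eq_tri by metis
  hence "\<alpha> \<noteq> 0 \<or> \<beta> \<noteq> 0 \<or> \<xi> \<noteq> 0 \<or> \<eta> \<noteq> 0 \<or> \<zeta> \<noteq> 0" unfolding eq by auto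
  moreover have "tri a b x y z \<in> N \<longleftrightarrow> \<alpha> * a + \<beta> * b + \<xi> * x + \<eta> * y + \<zeta> * z = 0" for a b x y z
    unfolding f(3)[OF tri_triangular] eq ..
  ultimately show ?thesis by blast
qed

section \<open>Subalgebras that are hyperplanes in the Borel subalgebra\<close>

lemma bracket_tri:
  "lie_bracket (tri a b x y z) (tri a' b' x' y' z') =
    tri 0 0 ((a - b) * x' - (a' - b') * x) ((a + 2 * b) * y' - (a' + 2 * b') * y)
      ((2 * a + b) * z' - (2 * a' + b') * z + x * y' - x' * y)"
  by (simp add: mat3_eq bracket_nth mult3) (simp add: algebra_simps)

text \<open>Closure under brackets restricts the functional that cuts out \<open>N\<close>: it can
  involve neither the highest root coordinate nor both simple root coordinates, and if it involves
  one of the latter, its diagonal part is a multiple of that simple root.\<close>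

lemma triangular_subalgebra_cases:
  assumes N: "cmat.subspace N" "N \<subseteq> triangular" "cmat.dim N = 4"
    and br: "\<And>A B. A \<in> N \<Longrightarrow> B \<in> N \<Longrightarrow> lie_bracket A B \<in> N"
  obtains (I) \<alpha> \<beta> where "\<alpha> \<noteq> 0 \<or> \<beta> \<noteq> 0" "\<And>a b x y z. tri a b x y z \<in> N \<longleftrightarrow> \<alpha> * a + \<beta> * b = 0"
  | (II) k where "\<And>a b x y z. tri a b x y z \<in> N \<longleftrightarrow> x = k * (a - b)"
  | (II') k where "\<And>a b x y z. tri a b x y z \<in> N \<longleftrightarrow> y = k * (a + 2 * b)"
proof -
  obtain \<alpha> \<beta> \<xi> \<eta> \<zeta> where nz: "\<alpha> \<noteq> 0 \<or> \<beta> \<noteq> 0 \<or> \<xi> \<noteq> 0 \<or> \<eta> \<noteq> 0 \<or> \<zeta> \<noteq> 0"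
    and mem: "\<And>a b x y z. tri a b x y z \<in> N \<longleftrightarrow> \<alpha> * a + \<beta> * b + \<xi> * x + \<eta> * y + \<zeta> * z = 0"
    using triangular_functional[OF N] by metis
  have closed: "\<xi> * ((a - b) * x' - (a' - b') * x) + \<eta> * ((a + 2 * b) * y' - (a' + 2 * b') * y)
      + \<zeta> * ((2 * a + b) * z' - (2 * a' + b') * z + x * y' - x' * y) = 0"
    if "\<alpha> * a + \<beta> * b + \<xi> * x + \<eta> * y + \<zeta> * z = 0" "\<alpha> * a' + \<beta> * b' + \<xi> * x' + \<eta> * y' + \<zeta> * z' = 0"
    for a b x y z a' b' x' y' z'
    using br[OF mem[THEN iffD2, OF that(1)] mem[THEN iffD2, OF that(2)]] unfolding bracket_tri mem by simp
  \<comment> \<open>Pairs in \<open>N\<close> with zero diagonal have their bracket in the highest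
    root space; closure then makes \<open>\<zeta>\<close> vanish, or its square times
    \<open>\<xi>\<close> or \<open>\<eta>\<close>.\<close>
  have \<zeta>: "\<zeta> = 0"
  proof -
    consider "\<xi> = 0" "\<eta> = 0" | "\<xi> \<noteq> 0" | "\<eta> \<noteq> 0" by blast
    thus ?thesis
    proof cases
      case 1 thus ?thesis using closed[of 0 0 1 0 0 0 0 0 1 0] by simp
    next
      case 2 thus ?thesis using closed[of 0 0 "- \<zeta>" 0 \<xi> 0 0 "- \<eta>" \<xi> 0] by simp
    next
      case 3 thus ?thesis using closed[of 0 0 0 "- \<zeta>" \<eta> 0 0 \<eta> "- \<xi>" 0] by simp
    qed
  qed
  consider "\<xi> = 0" "\<eta> = 0" | "\<xi> \<noteq> 0" "\<eta> = 0" | "\<xi> = 0" "\<eta> \<noteq> 0" | "\<xi> \<noteq> 0" "\<eta> \<noteq> 0" by blast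
  thus thesis
  proof cases
    case 1
    show thesis by (rule I[of \<alpha> \<beta>]) (use nz mem 1 \<zeta> in auto)
  next
    case 2
    have "\<alpha> + \<beta> = 0"
    proof -
      have "\<alpha> * \<xi> + \<beta> * 0 + \<xi> * (- \<alpha>) + \<eta> * 0 + \<zeta> * 0 = 0"
        "\<alpha> * 0 + \<beta> * \<xi> + \<xi> * (- \<beta>) + \<eta> * 0 + \<zeta> * 0 = 0" by simp_all
      from closed[OF this] have "\<xi> * \<xi> * (\<alpha> + \<beta>) = 0" using 2 \<zeta> by algebra
      thus ?thesis using 2 by simp
    qed
    hence "\<beta> = - \<alpha>" by (simp add: eq_neg_iff_add_eq_0 add.commute)
    have "tri a b x y z \<in> N \<longleftrightarrow> x = (- \<alpha> / \<xi>) * (a - b)" for a b x y z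
    proof -
      have "x = (- \<alpha> / \<xi>) * (a - b) \<longleftrightarrow> \<xi> * x = - \<alpha> * (a - b)" using 2 by (auto simp: field_simps)
      also have "\<dots> \<longleftrightarrow> \<alpha> * a - \<alpha> * b + \<xi> * x = 0" by algebra
      finally show ?thesis unfolding mem using 2 \<zeta> \<open>\<beta> = - \<alpha>\<close> by simp
    qed
    thus thesis by (rule II)
  next
    case 3
    have "\<beta> = 2 * \<alpha>"
    proof -
      have "\<alpha> * \<eta> + \<beta> * 0 + \<xi> * 0 + \<eta> * (- \<alpha>) + \<zeta> * 0 = 0"
        "\<alpha> * 0 + \<beta> * \<eta> + \<xi> * 0 + \<eta> * (- \<beta>) + \<zeta> * 0 = 0" by simp_all
      from closed[OF this] have "\<eta> * \<eta> * (2 * \<alpha> - \<beta>) = 0" using 3 \<zeta> by algebra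
      thus ?thesis using 3 by simp
    qed
    have "tri a b x y z \<in> N \<longleftrightarrow> y = (- \<alpha> / \<eta>) * (a + 2 * b)" for a b x y z
    proof -
      have "y = (- \<alpha> / \<eta>) * (a + 2 * b) \<longleftrightarrow> \<eta> * y = - \<alpha> * (a + 2 * b)" using 3 by (auto simp: field_simps)
      also have "\<dots> \<longleftrightarrow> \<alpha> * a + 2 * \<alpha> * b + \<eta> * y = 0" by algebra
      finally show ?thesis unfolding mem using 3 \<zeta> \<open>\<beta> = 2 * \<alpha>\<close> by simp
    qed
    thus thesis by (rule II')
  next
    case 4
    \<comment> \<open>The simple roots take different values on the diagonal
      \<open>(\<xi>, - \<xi>, 0)\<close>, so bracketing with a combination of the two simple root
      vectors leaves \<open>N\<close>.\<close>
    have "\<alpha> * \<xi> + \<beta> * (- \<xi>) + \<xi> * (\<beta> - \<alpha>) + \<eta> * 0 + \<zeta> * 0 = 0"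
      "\<alpha> * 0 + \<beta> * 0 + \<xi> * \<eta> + \<eta> * (- \<xi>) + \<zeta> * 0 = 0" by (simp_all add: algebra_simps)
    from closed[OF this] have "3 * \<xi> * \<xi> * \<eta> = 0" using \<zeta> by algebra
    hence False using 4 by simp
    thus thesis ..
  qed
qed

lemma lie_iso_id: "lie_iso s s (\<lambda>A. A)"
  unfolding lie_iso_def by (simp add: bij_id[unfolded id_def])

text \<open>The parameter is \<open>(\<beta> - \<alpha>) / \<beta>\<close> or its inverse,
  \<open>tdual\<close> exchanging the two. Modulus one is impossible: a diagonal element of
  \<open>N\<close> would be proportional to its own conjugate.\<close>

lemma type_I_form:
  assumes N: "inv_subalgebra tconj N" "N \<subseteq> triangular" and nz: "\<alpha> \<noteq> 0 \<or> \<beta> \<noteq> 0"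
    and mem: "\<And>a b x y z. tri a b x y z \<in> N \<longleftrightarrow> \<alpha> * a + \<beta> * b = 0"
  shows "\<exists>l f. cmod l < 1 \<and> lie_iso tconj tconj f \<and> f ` N = tI l"
proof -
  have memA: "A \<in> N \<longleftrightarrow> A \<in> triangular \<and> \<alpha> * A$1$1 + \<beta> * A$2$2 = 0" for A
    using N(2) mem[of "A$1$1" "A$2$2" "A$1$2" "A$2$3" "A$1$3"] triangular_eq_tri[of A, symmetric] by auto
  consider "cmod (\<beta> - \<alpha>) < cmod \<beta>" | "cmod \<beta> < cmod (\<beta> - \<alpha>)" | "cmod \<beta> = cmod (\<beta> - \<alpha>)" by linarith
  thus ?thesis
  proof cases
    case 1
    hence b: "\<beta> \<noteq> 0" by auto
    define l where "l = (\<beta> - \<alpha>) / \<beta>"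
    have a: "\<alpha> = \<beta> * (1 - l)" using b by (simp add: l_def field_simps)
    have "A \<in> N \<longleftrightarrow> A \<in> tI l" for A
    proof -
      have "\<alpha> * A$1$1 + \<beta> * A$2$2 = \<beta> * (A$2$2 - (l - 1) * A$1$1)" by (simp add: a algebra_simps)
      hence "\<alpha> * A$1$1 + \<beta> * A$2$2 = 0 \<longleftrightarrow> A$2$2 = (l - 1) * A$1$1" using b by simp
      thus ?thesis by (auto simp: memA tI_def triangular_def left_diff_distrib)
    qed
    hence "N = tI l" by blast
    moreover have "cmod l < 1" using 1 b by (simp add: l_def norm_divide)
    ultimately show ?thesis using lie_iso_id[of tconj] by (metis image_ident)
  next
    case 2
    hence b: "\<beta> - \<alpha> \<noteq> 0" by auto
    define g l where gl: "g = \<beta> - \<alpha>" "l = \<beta> / (\<beta> - \<alpha>)"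
    have ab: "\<alpha> = g * (l - 1)" "\<beta> = g * l" "g \<noteq> 0" using b by (auto simp: gl field_simps)
    have "A \<in> N \<longleftrightarrow> tdual A \<in> tI l" for A
    proof -
      have "\<alpha> * A$1$1 + \<beta> * A$2$2 = g * ((l - 1) * A$1$1 + l * A$2$2)" by (simp add: ab algebra_simps)
      hence 1: "\<alpha> * A$1$1 + \<beta> * A$2$2 = 0 \<longleftrightarrow> (l - 1) * A$1$1 + l * A$2$2 = 0" using ab by simp
      have 2: "tdual A \<in> tI l \<longleftrightarrow> A$2$1 = 0 \<and> A$3$1 = 0 \<and> A$3$2 = 0 \<and> A$2$2 = (l - 1) * A$3$3 \<and> - A$1$1 = l * A$3$3"
        by (auto simp: tI_def)
      have "A$2$2 = (l - 1) * A$3$3 \<and> - A$1$1 = l * A$3$3 \<longleftrightarrow>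
          A$3$3 = - A$1$1 - A$2$2 \<and> (l - 1) * A$1$1 + l * A$2$2 = 0"
        by (intro iffI conjI; elim conjE) algebra+
      thus ?thesis unfolding memA 1 2 triangular_def by blast
    qed
    hence "tdual ` N = tI l" by (rule tdual_image)
    moreover have "cmod l < 1" using 2 b by (simp add: gl norm_divide)
    ultimately show ?thesis using lie_iso_tdual by blast
  next
    case 3
    hence b: "\<beta> \<noteq> 0" using nz by auto
    define l where "l = (\<beta> - \<alpha>) / \<beta>"
    have l1: "cmod l = 1" using b by (simp add: l_def norm_divide flip: 3)
    hence l: "l * cnj l = 1" by (simp add: complex_norm_square[symmetric])
    have a: "\<alpha> = \<beta> * (1 - l)" using b by (simp add: l_def field_simps)
    let ?U = "tri 1 (l - 1) 0 0 0"
    have "?U \<in> N" unfolding mem a by (simp add: algebra_simps)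
    moreover have "tconj ?U = tri (- cnj l) (cnj l - 1) 0 0 0"
      by (simp add: mat3_eq)
    \<comment> \<open>As \<open>l * cnj l = 1\<close>, this is \<open>- cnj l\<close> times
      \<open>?U\<close>.\<close>
    moreover have "tri (- cnj l) (cnj l - 1) 0 0 0 \<in> N"
      unfolding mem a using l by (simp add: algebra_simps)
    ultimately have "?U \<in> N \<inter> tconj ` N" by (metis IntI imageI tconj_tconj)
    hence "?U = 0" using N(1) by (auto simp: inv_subalgebra_def)
    hence "?U $ 1 $ 1 = 0" by simp
    thus ?thesis by simp
  qed
qed

text \<open>For \<open>k = 0\<close> the diagonal matrix with entries 1, -2, 1 would lie in
  \<open>N\<close> and be fixed by \<open>tconj\<close>; every other \<open>k\<close> is absorbed by
  a real base change.\<close>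

lemma type_II_form:
  assumes N: "inv_subalgebra tconj N" "N \<subseteq> triangular"
    and mem: "\<And>a b x y z. tri a b x y z \<in> N \<longleftrightarrow> x = k * (a - b)"
  shows "\<exists>f. lie_iso tconj tconj f \<and> f ` N = tII"
proof -
  have memA: "A \<in> N \<longleftrightarrow> A \<in> triangular \<and> A$1$2 = k * (A$1$1 - A$2$2)" for A
    using N(2) mem[of "A$1$1" "A$2$2" "A$1$2" "A$2$3" "A$1$3"] triangular_eq_tri[of A, symmetric] by auto
  have k: "k \<noteq> 0"
  proof
    assume "k = 0"
    hence "tri 1 (- 2) 0 0 0 \<in> N" by (simp add: mem)
    moreover have "tconj (tri 1 (- 2) 0 0 0) = tri 1 (- 2) 0 0 0" by (simp add: mat3_eq)
    ultimately have "tri 1 (- 2) 0 0 0 \<in> N \<inter> tconj ` N" by (metis IntI imageI)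
    hence "tri 1 (- 2) 0 0 0 = 0" using N(1) by (auto simp: inv_subalgebra_def)
    hence "tri 1 (- 2) 0 0 0 $ 1 $ 1 = 0" by simp
    thus False by simp
  qed
  \<comment> \<open>\<open>P\<close> sends \<open>(1, 1, 0)\<close> and \<open>(1, -1, 0)\<close> to
    multiples of \<open>(1, 0, 0)\<close> and \<open>(- k, 1, 0)\<close>, the common eigenvectors of
    \<open>N\<close>; the last column is forced by \<open>tconj P = P\<close>.\<close>
  define P R :: "complex^3^3" where
    "P = vector [vector [2 * k, 0, 0], vector [- 1, 1, - 1], vector [0, 0, 2 * cnj k]]"
    and "R = vector [vector [1 / (2 * k), 0, 0], vector [1 / (2 * k), 1, 1 / (2 * cnj k)], vector [0, 0, 1 / (2 * cnj k)]]"
  have PR: "P ** R = mat 1" "R ** P = mat 1" "tconj P = P"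
    using k by (simp_all add: mat3_eq mult3 P_def R_def mat_def)
  hence "lie_iso tconj tconj (\<lambda>A. R ** A ** P)" by (rule lie_iso_twisted_conjugate)
  moreover have "(\<lambda>A. R ** A ** P) ` N = tII"
  proof (intro equalityI subsetI)
    fix B assume "B \<in> (\<lambda>A. R ** A ** P) ` N"
    then obtain A where A: "A \<in> N" "B = R ** A ** P" by blast
    have "A$3$3 = - A$1$1 - A$2$2" "A$2$1 = 0" "A$3$1 = 0" "A$3$2 = 0" "A$1$2 = k * (A$1$1 - A$2$2)"
      using A(1) unfolding memA triangular_def by auto
    thus "B \<in> tII"
      using k unfolding A(2) tII_def by (simp add: mult3 P_def R_def) (simp add: field_simps)
  next
    fix B assume B: "B \<in> tII"
    have "P ** B ** R \<in> N"
      using B k unfolding memA triangular_def tII_def by (simp add: mult3 P_def R_def) (simp add: field_simps)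
    moreover have "B = R ** (P ** B ** R) ** P"
    proof -
      have "R ** (P ** B ** R) ** P = (R ** P) ** B ** (R ** P)" by (simp only: matrix_mul_assoc)
      thus ?thesis by (simp add: PR)
    qed
    ultimately show "B \<in> (\<lambda>A. R ** A ** P) ` N" by blast
  qed
  ultimately show ?thesis by blast
qed

lemma triangular_classification:
  assumes N: "inv_subalgebra tconj N" "\<And>A. A \<in> N \<Longrightarrow> A$2$1 = 0 \<and> A$3$1 = 0 \<and> A$3$2 = 0"
  shows "\<exists>t\<in>labels. \<exists>f. lie_iso tconj tconj f \<and> f ` N = tlabel t"
proof -
  have tri: "N \<subseteq> triangular"
    using N by (auto simp: triangular_iff inv_subalgebra_def)
  have sub: "cmat.subspace N" "cmat.dim N = 4" "\<And>A B. A \<in> N \<Longrightarrow> B \<in> N \<Longrightarrow> lie_bracket A B \<in> N"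
    using N dim_inv_subalgebra[OF conjugation_tconj N(1)] by (auto simp: inv_subalgebra_def)
  show ?thesis
  proof (rule triangular_subalgebra_cases[OF sub(1) tri sub(2)])
    show "lie_bracket A B \<in> N" if "A \<in> N" "B \<in> N" for A B using that by (rule sub(3))
  next
    fix \<alpha> \<beta> assume I: "\<alpha> \<noteq> 0 \<or> \<beta> \<noteq> 0" "\<And>a b x y z. tri a b x y z \<in> N \<longleftrightarrow> \<alpha> * a + \<beta> * b = 0"
    obtain l f where "cmod l < 1" "lie_iso tconj tconj f" "f ` N = tI l"
      using type_I_form[OF N(1) tri I] by blast
    thus ?thesis by (intro bexI[of _ "Label_I l"]) (auto simp: labels_def)
  next
    fix k assume II: "\<And>a b x y z. tri a b x y z \<in> N \<longleftrightarrow> x = k * (a - b)"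
    show ?thesis using type_II_form[OF N(1) tri II] by (intro bexI[of _ "Label_II"]) (auto simp: labels_def)
  next
    fix k assume II': "\<And>a b x y z. tri a b x y z \<in> N \<longleftrightarrow> y = k * (a + 2 * b)"
    \<comment> \<open>\<open>tdual\<close> exchanges the two simple root coordinates, which reduces
      this case to the previous one.\<close>
    have tri': "tdual ` N \<subseteq> triangular" using tri by (auto simp: triangular_def algebra_simps)
    have mem': "tri a b x y z \<in> tdual ` N \<longleftrightarrow> x = - k * (a - b)" for a b x y z
    proof -
      have "tri a b x y z = tdual (tri (a + b) (- b) (- y) (- x) (- z))" by (simp add: mat3_eq)
      moreover have "inj tdual" using lie_isoD(1)[OF lie_iso_tdual] by (rule bij_is_inj)
      ultimately have "tri a b x y z \<in> tdual ` N \<longleftrightarrow> tri (a + b) (- b) (- y) (- x) (- z) \<in> N"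
        by (simp add: inj_image_mem_iff)
      thus ?thesis unfolding II' by (auto simp: algebra_simps)
    qed
    obtain f where f: "lie_iso tconj tconj f" "f ` tdual ` N = tII"
      using type_II_form[OF inv_subalgebra_image[OF lie_iso_tdual N(1)] tri' mem'] by blast
    thus ?thesis
      by (intro bexI[of _ "Label_II"] exI[of _ "\<lambda>A. f (tdual A)"])
         (auto simp: labels_def image_image intro: lie_iso_comp[OF lie_iso_tdual])
  qed
qed

section \<open>The list of subalgebras and its rigidity\<close>

text \<open>The columns are an isotropic vector, a real vector and the conjugate of the first; the
  factor \<open>sqrt 2\<close> turns the generators \<open>X\<close>, \<open>Y\<close>,
  \<open>Z\<close> of \<open>algebra_I\<close> into matrix units.\<close>

definition qmat :: "complex^3^3" where
  "qmat = vector [vector [1, 0, 1], vector [\<i>, 0, - \<i>], vector [0, complex_of_real (sqrt 2), 0]]"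

definition qinv :: "complex^3^3" where
  "qinv = vector [vector [1 / 2, - \<i> / 2, 0], vector [0, 0, complex_of_real (1 / sqrt 2)],
    vector [1 / 2, \<i> / 2, 0]]"

definition twist :: "complex^3^3 \<Rightarrow> complex^3^3" where
  "twist A = qinv ** A ** qmat"

lemma lie_iso_twist: "lie_iso conj_mat tconj twist"
proof -
  have "complex_of_real (sqrt 2) * complex_of_real (1 / sqrt 2) = 1"
    by (simp flip: of_real_mult)
  hence "qmat ** qinv = mat 1" "qinv ** qmat = mat 1"
    by (simp_all add: mat3_eq mult3 qmat_def qinv_def mat_def mult.commute)
  moreover have "conj_mat qmat = qmat ** smat"
    by (simp add: mat3_eq mult3 qmat_def smat_def)
  ultimately have "lie_iso conj_mat tconj (\<lambda>A. qinv ** A ** qmat)" by (rule lie_iso_untwist)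
  thus ?thesis unfolding twist_def[abs_def] .
qed

lemma image_span4:
  fixes f :: "complex^'n^'n \<Rightarrow> complex^'n^'n"
  assumes f: "\<And>A B. f (A + B) = f A + f B" "\<And>c A. f (c *\<^sub>C A) = c *\<^sub>C f A"
    and S: "cmat.subspace S" and gen: "f U \<in> S" "f X \<in> S" "f Y \<in> S" "f Z \<in> S"
    and span: "\<And>T. T \<in> S \<Longrightarrow> \<exists>a b c d. T = a *\<^sub>C f U + b *\<^sub>C f X + c *\<^sub>C f Y + d *\<^sub>C f Z"
  shows "f ` cmat.span {U, X, Y, Z} = S"
proof (intro equalityI subsetI)
  have f0: "f 0 = 0" using f(2)[of 0 0] by simp
  have "cmat.subspace {A. f A \<in> S}"
    by (simp add: cmat.subspace_def f f0 cmat.subspace_0[OF S] cmat.subspace_add[OF S] cmat.subspace_scale[OF S])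
  hence "cmat.span {U, X, Y, Z} \<subseteq> {A. f A \<in> S}" using gen by (intro cmat.span_minimal) auto
  thus "T \<in> S" if "T \<in> f ` cmat.span {U, X, Y, Z}" for T using that by auto
next
  fix T assume "T \<in> S"
  then obtain a b c d where "T = a *\<^sub>C f U + b *\<^sub>C f X + c *\<^sub>C f Y + d *\<^sub>C f Z" using span by blast
  hence "T = f (a *\<^sub>C U + b *\<^sub>C X + c *\<^sub>C Y + d *\<^sub>C Z)" by (simp add: f)
  moreover have "a *\<^sub>C U + b *\<^sub>C X + c *\<^sub>C Y + d *\<^sub>C Z \<in> cmat.span {U, X, Y, Z}"
    by (intro cmat.span_add cmat.span_scale) (auto intro: cmat.span_base)
  ultimately show "T \<in> f ` cmat.span {U, X, Y, Z}" by blast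
qed

lemma subspace_tI: "cmat.subspace (tI l)"
  by (auto simp: cmat.subspace_def tI_def distrib_left mult.left_commute)

lemma subspace_tII: "cmat.subspace tII"
  by (auto simp: cmat.subspace_def tII_def algebra_simps)

lemma sqrt2_mult: "complex_of_real (sqrt 2) * complex_of_real (sqrt 2) = 2"
  by (simp flip: of_real_mult)

lemma twist_algebra_I: "twist ` algebra_I l = tI l"
proof -
  let ?U = "(1/2) *\<^sub>C vector [vector [1 - l, - \<i> * (l + 1), 0], vector [\<i> * (l + 1), 1 - l, 0],
    vector [0, 0, - 2 * (1 - l)]] :: complex^3^3"
  let ?X = "complex_of_real (1 / sqrt 2) *\<^sub>C vector [vector [0, 0, 1], vector [0, 0, \<i>], vector [0, 0, 0]] :: complex^3^3"
  let ?Y = "complex_of_real (1 / sqrt 2) *\<^sub>C vector [vector [0, 0, 0], vector [0, 0, 0], vector [1, \<i>, 0]] :: complex^3^3"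
  let ?Z = "(1/2) *\<^sub>C vector [vector [1, \<i>, 0], vector [\<i>, - 1, 0], vector [0, 0, 0]] :: complex^3^3"
  have gen: "twist ?U = tri 1 (l - 1) 0 0 0" "twist ?X = tri 0 0 1 0 0" "twist ?Y = tri 0 0 0 1 0"
    "twist ?Z = tri 0 0 0 0 1"
    using sqrt2_mult by (simp_all add: mat3_eq mult3 twist_def qmat_def qinv_def field_simps)
  show ?thesis
    unfolding algebra_I_def
  proof (rule image_span4)
    fix T assume "T \<in> tI l"
    hence "T = T$1$1 *\<^sub>C twist ?U + T$1$2 *\<^sub>C twist ?X + T$2$3 *\<^sub>C twist ?Y + T$1$3 *\<^sub>C twist ?Z"
      unfolding gen by (simp add: mat3_eq tI_def algebra_simps)
    thus "\<exists>a b c d. T = a *\<^sub>C twist ?U + b *\<^sub>C twist ?X + c *\<^sub>C twist ?Y + d *\<^sub>C twist ?Z" by blast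
  qed (unfold gen, auto simp: lie_isoD[OF lie_iso_twist] subspace_tI, auto simp: tI_def)
qed

lemma twist_algebra_II: "twist ` algebra_II = tII"
proof -
  let ?U = "(1/2) *\<^sub>C vector [vector [- 1, - 3 * \<i>, 0], vector [3 * \<i>, - 1, 0], vector [0, 0, 2]] :: complex^3^3"
  let ?X = "complex_of_real (1 / sqrt 2) *\<^sub>C vector [vector [0, 0, 1], vector [0, 0, \<i>], vector [1, - \<i>, 0]] :: complex^3^3"
  let ?Y = "complex_of_real (1 / sqrt 2) *\<^sub>C vector [vector [0, 0, 0], vector [0, 0, 0], vector [1, \<i>, 0]] :: complex^3^3"
  let ?Z = "(1/2) *\<^sub>C vector [vector [1, \<i>, 0], vector [\<i>, - 1, 0], vector [0, 0, 0]] :: complex^3^3"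
  have gen: "twist ?U = tri 1 1 0 0 0" "twist ?X = mat_unit 1 2 + mat_unit 2 1" "twist ?Y = tri 0 0 0 1 0"
    "twist ?Z = tri 0 0 0 0 1"
    using sqrt2_mult by (simp_all add: mat3_eq mult3 twist_def qmat_def qinv_def field_simps)
  show ?thesis
    unfolding algebra_II_def
  proof (rule image_span4)
    fix T assume "T \<in> tII"
    hence "T = T$1$1 *\<^sub>C twist ?U + T$1$2 *\<^sub>C twist ?X + T$2$3 *\<^sub>C twist ?Y + T$1$3 *\<^sub>C twist ?Z"
      unfolding gen by (simp add: mat3_eq tII_def algebra_simps)
    thus "\<exists>a b c d. T = a *\<^sub>C twist ?U + b *\<^sub>C twist ?X + c *\<^sub>C twist ?Y + d *\<^sub>C twist ?Z" by blast
  qed (unfold gen, auto simp: lie_isoD[OF lie_iso_twist] subspace_tII, auto simp: tII_def)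
qed

lemma twist_label: "twist ` label_algebra t = tlabel t"
  by (cases t) (simp_all add: twist_algebra_I twist_algebra_II)

section \<open>Invariance of the listed subalgebras\<close>

lemma inv_subalgebra_tconjI:
  assumes S: "cmat.subspace S" "S \<subseteq> sl" "\<And>A B. A \<in> S \<Longrightarrow> B \<in> S \<Longrightarrow> lie_bracket A B \<in> S"
    and int: "\<And>A. A \<in> S \<Longrightarrow> tconj A \<in> S \<Longrightarrow> A = 0"
    and sum: "\<And>C. C \<in> sl \<Longrightarrow> \<exists>A\<in>S. \<exists>B\<in>S. C = A + tconj B"
  shows "inv_subalgebra tconj S"
proof -
  have "0 \<in> S" using S(1) by (rule cmat.subspace_0)
  moreover have t0: "tconj 0 = 0" by (simp add: mat3_eq)
  ultimately have "S \<inter> tconj ` S = {0}"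
    using int by (auto simp: image_iff)
  moreover have "tconj B \<in> sl" if "B \<in> sl" for B
  proof -
    have "cnj (B$1$1 + B$2$2 + B$3$3) = 0" using that by (simp add: sl_def trace3)
    thus ?thesis by (simp add: sl_def trace3 add_ac)
  qed
  hence "A + tconj B \<in> sl" if "A \<in> S" "B \<in> S" for A B
    using S(2) that by (intro cmat.subspace_add[OF subspace_sl]) auto
  hence "{A + B |A B. A \<in> S \<and> B \<in> tconj ` S} \<subseteq> sl" by auto
  hence "{A + B |A B. A \<in> S \<and> B \<in> tconj ` S} = sl"
    using sum by (auto intro!: equalityI) (metis imageI)
  ultimately show ?thesis using S by (simp add: inv_subalgebra_def)
qed

lemma inv_subalgebra_tI:
  assumes l: "cmod l < 1"
  shows "inv_subalgebra tconj (tI l)"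
proof (rule inv_subalgebra_tconjI[OF subspace_tI])
  \<comment> \<open>The determinant \<open>1 - l * cnj l\<close> decides whether the diagonal part
    of \<open>tI l\<close> and its conjugate span the traceless diagonal matrices.\<close>
  have "cmod l * cmod l < 1 * 1" using l by (intro mult_strict_mono') auto
  hence "cmod (l * cnj l) < 1" by (simp add: norm_mult)
  hence ll: "1 - l * cnj l \<noteq> 0" by auto
  show "tI l \<subseteq> sl" by (auto simp: tI_def sl_def trace3 algebra_simps)
  show "lie_bracket A B \<in> tI l" if "A \<in> tI l" "B \<in> tI l" for A B
    using that by (simp add: tI_def bracket_nth mult3)
  show "A = 0" if "A \<in> tI l" "tconj A \<in> tI l" for A
  proof -
    have "A$1$2 = 0" "A$1$3 = 0" "A$2$3 = 0" "A$2$1 = 0" "A$3$1 = 0" "A$3$2 = 0" "A$3$3 = - l * A$1$1"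
      "A$2$2 = (l - 1) * A$1$1" "cnj (A$1$1) = - l * cnj (A$3$3)"
      using that by (simp_all add: tI_def)
    moreover from this have "(1 - l * cnj l) * cnj (A$1$1) = 0" by (simp add: algebra_simps)
    ultimately show ?thesis using ll by (simp add: mat3_eq)
  qed
  show "\<exists>A\<in>tI l. \<exists>B\<in>tI l. C = A + tconj B" if C: "C \<in> sl" for C
  proof -
    define d where "d = 1 - l * cnj l"
    have d: "d \<noteq> 0" "cnj d = d" using ll by (simp_all add: d_def mult.commute)
    \<comment> \<open>The solution of \<open>a - cnj l * b = C$1$1\<close> and
      \<open>b - l * a = C$3$3\<close>, the diagonal part of the decomposition of
      \<open>C\<close>.\<close>
    define a b where ab: "a = (C$1$1 + cnj l * C$3$3) / d" "b = (C$3$3 + l * C$1$1) / d"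
    have "d * (a - cnj l * b) = d * C$1$1"
      using d by (simp add: ab field_simps) (simp add: d_def algebra_simps)
    hence 1: "a - cnj l * b = C$1$1" using d by simp
    have "d * (b - l * a) = d * C$3$3"
      using d by (simp add: ab field_simps) (simp add: d_def algebra_simps)
    hence 3: "b - l * a = C$3$3" using d by simp
    have "C$2$2 = - C$1$1 - C$3$3" using C by (simp add: sl_def trace3) algebra
    hence 2: "C$2$2 = (l - 1) * a + (cnj l - 1) * b" unfolding 1[symmetric] 3[symmetric] by (simp add: algebra_simps)
    let ?A = "tri a ((l - 1) * a) (C$1$2) (C$2$3 ) (C$1$3)"
    let ?B = "tri (cnj b) ((l - 1) * cnj b) (cnj (C$3$2)) (cnj (C$2$1)) (cnj (C$3$1))"
    have "?A \<in> tI l" "?B \<in> tI l" by (simp_all add: tI_def algebra_simps)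
    moreover have "C = ?A + tconj ?B"
      using 1 2 3 by (simp add: mat3_eq) (simp add: algebra_simps)
    ultimately show ?thesis by blast
  qed
qed

lemma inv_subalgebra_tII: "inv_subalgebra tconj tII"
proof (rule inv_subalgebra_tconjI[OF subspace_tII])
  show "tII \<subseteq> sl" by (simp add: subset_iff tII_def sl_def trace3)
  show "lie_bracket A B \<in> tII" if "A \<in> tII" "B \<in> tII" for A B
    using that by (simp add: tII_def bracket_nth mult3)
  show "A = 0" if "A \<in> tII" "tconj A \<in> tII" for A
  proof -
    have A: "A$1$2 = 0" "A$1$3 = 0" "A$2$3 = A$1$2" "A$2$1 = A$1$2" "A$3$1 = 0" "A$3$2 = 0" "A$3$3 = - 2 * A$1$1"
      "A$2$2 = A$1$1" "A$2$2 = A$3$3"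
      using that by (simp_all add: tII_def)
    hence "3 * A$1$1 = 0" by algebra
    with A show ?thesis by (simp add: mat3_eq)
  qed
  show "\<exists>A\<in>tII. \<exists>B\<in>tII. C = A + tconj B" if C: "C \<in> sl" for C
  proof -
    have tr: "C$3$3 = - C$1$1 - C$2$2" using C by (simp add: sl_def trace3) algebra
    \<comment> \<open>The solution of \<open>a - 2 * b = C$1$1\<close> and
      \<open>a + b = C$2$2\<close>.\<close>
    define a b where ab: "a = (C$1$1 + 2 * C$2$2) / 3" "b = (C$2$2 - C$1$1) / 3"
    let ?A = "vector [vector [a, C$1$2, C$1$3], vector [C$1$2, a, C$2$3 - C$3$2], vector [0, 0, - 2 * a]] :: complex^3^3"
    let ?B = "vector [vector [cnj b, cnj (C$3$2), cnj (C$3$1)], vector [cnj (C$3$2), cnj b, cnj (C$2$1 - C$1$2)],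
      vector [0, 0, - 2 * cnj b]] :: complex^3^3"
    have "?A \<in> tII" "?B \<in> tII" by (simp_all add: tII_def)
    moreover have "C = ?A + tconj ?B"
      by (simp add: mat3_eq ab tr) (simp add: field_simps)
    ultimately show ?thesis by blast
  qed
qed

lemma inv_subalgebra_label:
  assumes "t \<in> labels"
  shows "inv_subalgebra conj_mat (label_algebra t)"
proof -
  have "inv_subalgebra tconj (tlabel t)"
    using assms inv_subalgebra_tI inv_subalgebra_tII by (auto simp: labels_def)
  hence "inv_subalgebra conj_mat (inv twist ` tlabel t)"
    by (rule inv_subalgebra_image[OF lie_iso_inv[OF lie_iso_twist]])
  moreover have "inv twist ` twist ` label_algebra t = label_algebra t"
    using lie_isoD(1)[OF lie_iso_twist] by (simp add: bij_is_inj image_inv_f_f)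
  ultimately show ?thesis by (simp add: twist_label)
qed

text \<open>The normalizations are chained: an invariant line becomes the first axis, then a flag is
  made standard, then the list is reached, and \<open>twist\<close> leads back to
  \<open>conj_mat\<close>.\<close>

theorem inv_subalgebra_classification:
  assumes M: "inv_subalgebra conj_mat M"
  shows "\<exists>t\<in>labels. \<exists>f. lie_iso conj_mat conj_mat f \<and> f ` M = label_algebra t"
proof -
  obtain f where f: "lie_iso conj_mat tconj f" "\<forall>A\<in>f ` M. A$2$1 = 0 \<and> A$3$1 = 0"
    using parabolic_form[OF M] by blast
  note N = inv_subalgebra_image[OF f(1) M]
  obtain g where g: "lie_iso tconj tconj g" "\<forall>A\<in>g ` f ` M. A$2$1 = 0 \<and> A$3$1 = 0 \<and> A$3$2 = 0"
    using triangular_form[OF N] f(2) by blast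
  note N' = inv_subalgebra_image[OF g(1) N]
  obtain t h where h: "t \<in> labels" "lie_iso tconj tconj h" "h ` g ` f ` M = tlabel t"
    using triangular_classification[OF N'] g(2) by blast
  have "lie_iso conj_mat conj_mat (\<lambda>A. inv twist (h (g (f A))))"
    by (rule lie_iso_comp[OF _ lie_iso_inv[OF lie_iso_twist]], rule lie_iso_comp[OF _ h(2)], rule lie_iso_comp[OF f(1) g(1)])
  moreover have "(\<lambda>A. inv twist (h (g (f A)))) ` M = label_algebra t"
  proof -
    have "(\<lambda>A. inv twist (h (g (f A)))) ` M = inv twist ` h ` g ` f ` M" by (simp add: image_image)
    also have "\<dots> = inv twist ` twist ` label_algebra t" by (simp only: h(3) twist_label)
    also have "\<dots> = label_algebra t"
      using lie_isoD(1)[OF lie_iso_twist] by (simp add: bij_is_inj image_inv_f_f)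
    finally show ?thesis .
  qed
  ultimately show ?thesis using h(1) by blast
qed

section \<open>Rigidity of the list under injective Lie maps\<close>

definition lie_embedding :: "(complex^'n^'n \<Rightarrow> complex^'n^'n) \<Rightarrow> (complex^'n^'n) set \<Rightarrow> (complex^'n^'n) set \<Rightarrow> bool" where
  "lie_embedding F M M' \<longleftrightarrow> (\<forall>A\<in>M. F A \<in> M') \<and> (\<forall>c. \<forall>A\<in>M. F (c *\<^sub>C A) = c *\<^sub>C F A) \<and>
    (\<forall>A\<in>M. \<forall>B\<in>M. F (lie_bracket A B) = lie_bracket (F A) (F B)) \<and> (\<forall>A\<in>M. F A = 0 \<longrightarrow> A = 0)"

lemma bracket_tI:
  assumes "A \<in> tI l" "B \<in> tI l"
  shows "lie_bracket A B $ 1 $ 1 = 0"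
    "lie_bracket A B $ 1 $ 2 = (2 - l) * (A$1$1 * B$1$2 - B$1$1 * A$1$2)"
    "lie_bracket A B $ 2 $ 3 = (2 * l - 1) * (A$1$1 * B$2$3 - B$1$1 * A$2$3)"
    "lie_bracket A B $ 1 $ 3 = (1 + l) * (A$1$1 * B$1$3 - B$1$1 * A$1$3) + A$1$2 * B$2$3 - B$1$2 * A$2$3"
proof -
  have e: "A$2$1 = 0" "A$3$1 = 0" "A$3$2 = 0" "A$2$2 = (l - 1) * A$1$1" "A$3$3 = - l * A$1$1"
    "B$2$1 = 0" "B$3$1 = 0" "B$3$2 = 0" "B$2$2 = (l - 1) * B$1$1" "B$3$3 = - l * B$1$1"
    using assms by (simp_all add: tI_def)
  show "lie_bracket A B $ 1 $ 1 = 0"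
    "lie_bracket A B $ 1 $ 2 = (2 - l) * (A$1$1 * B$1$2 - B$1$1 * A$1$2)"
    "lie_bracket A B $ 2 $ 3 = (2 * l - 1) * (A$1$1 * B$2$3 - B$1$1 * A$2$3)"
    "lie_bracket A B $ 1 $ 3 = (1 + l) * (A$1$1 * B$1$3 - B$1$1 * A$1$3) + A$1$2 * B$2$3 - B$1$2 * A$2$3"
    by (simp_all add: bracket_nth mult3 e, simp_all add: algebra_simps)
qed

lemma tI_0: "A \<in> tI l \<Longrightarrow> A$1$1 = 0 \<Longrightarrow> A$1$2 = 0 \<Longrightarrow> A$2$3 = 0 \<Longrightarrow> A$1$3 = 0 \<Longrightarrow> A = 0"
  by (simp add: tI_def mat3_eq)

text \<open>\<open>U\<close> acts on \<open>X\<close>, \<open>Y\<close>, \<open>Z\<close> with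
  weights \<open>2 - l\<close>, \<open>2 * l - 1\<close>, \<open>1 + l\<close>, and
  \<open>[X, Y] = Z\<close>. The image of \<open>U\<close> acts with \<open>t\<close> times the
  weights of \<open>m\<close>, so matching weights gives \<open>l = m\<close>, or
  \<open>l * m = 1\<close> if the two simple root spaces are interchanged; the moduli exclude the
  latter.\<close>

lemma tI_rigid:
  assumes F: "lie_embedding F (tI l) (tI m)" and lm: "cmod l < 1" "cmod m < 1"
  shows "l = m"
proof -
  let ?U = "tri 1 (l - 1) 0 0 0" and ?X = "tri 0 0 1 0 0" and ?Y = "tri 0 0 0 1 0" and ?Z = "tri 0 0 0 0 1"
  have mem: "?U \<in> tI l" "?X \<in> tI l" "?Y \<in> tI l" "?Z \<in> tI l" by (simp_all add: tI_def)
  have br: "lie_bracket ?U ?X = (2 - l) *\<^sub>C ?X" "lie_bracket ?U ?Y = (2 * l - 1) *\<^sub>C ?Y"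
    "lie_bracket ?U ?Z = (1 + l) *\<^sub>C ?Z" "lie_bracket ?X ?Y = ?Z" "lie_bracket ?Y ?Z = 0"
    by (simp_all add: bracket_tri mat3_eq)
  define u x y z where uxyz: "u = F ?U" "x = F ?X" "y = F ?Y" "z = F ?Z"
  have M: "u \<in> tI m" "x \<in> tI m" "y \<in> tI m" "z \<in> tI m" using F mem by (auto simp: lie_embedding_def uxyz)
  have Fb: "F (lie_bracket A B) = lie_bracket (F A) (F B)" if "A \<in> tI l" "B \<in> tI l" for A B
    using F that by (auto simp: lie_embedding_def)
  have Fs: "F (c *\<^sub>C A) = c *\<^sub>C F A" if "A \<in> tI l" for A c
    using F that by (auto simp: lie_embedding_def)
  have F0: "F 0 = 0" using Fs[OF mem(1), of 0] by simp
  have b: "lie_bracket u x = (2 - l) *\<^sub>C x" "lie_bracket u y = (2 * l - 1) *\<^sub>C y"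
    "lie_bracket u z = (1 + l) *\<^sub>C z" "lie_bracket x y = z" "lie_bracket y z = 0"
    unfolding uxyz by (simp_all only: Fb[symmetric] mem br Fs F0)
  have "?Z \<noteq> 0" using tri_nth(3)[of 0 0 0 0 1] by force
  hence z0: "z \<noteq> 0" using F mem(4) by (auto simp: lie_embedding_def uxyz)
  have nz: "2 - l \<noteq> 0" "1 + l \<noteq> 0"
    using lm(1) by (auto simp: add_eq_0_iff)
  define t where "t = u$1$1"
  have x11: "x$1$1 = 0" using bracket_tI(1)[OF M(1,2)] nz unfolding b by simp
  have z11: "z$1$1 = 0" using bracket_tI(1)[OF M(1,4)] nz unfolding b by simp
  note uz = bracket_tI(2-4)[OF M(1,4), unfolded b, simplified, unfolded z11, simplified, folded t_def]
  note yz = bracket_tI(2-4)[OF M(3,4), unfolded b, simplified, unfolded z11, simplified]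
  \<comment> \<open>The weight \<open>2 * l - 1\<close> of \<open>y\<close> vanishes for
    \<open>l = 1/2\<close>, so this is drawn from \<open>[y, z] = 0\<close> instead.\<close>
  have y11: "y$1$1 = 0"
  proof (cases "z$1$2 = 0 \<and> z$2$3 = 0")
    case True
    hence z13: "z$1$3 \<noteq> 0" using z0 z11 tI_0[OF M(4)] by blast
    have "(1 + l) * z$1$3 = (1 + m) * (t * z$1$3)" using uz True by simp
    hence "1 + m \<noteq> 0" using z13 nz by auto
    thus ?thesis using yz(3) True z13 by simp
  next
    case False
    thus ?thesis
    proof (cases "z$1$2 = 0")
      case True
      hence z23: "z$2$3 \<noteq> 0" using False by simp
      hence "2 * m - 1 \<noteq> 0" using uz(2) nz by auto
      thus ?thesis using yz(2) z23 by simp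
    next
      case False
      hence "2 - m \<noteq> 0" using uz(1) nz by auto
      thus ?thesis using yz(1) False by simp
    qed
  qed
  note xy = bracket_tI(2-4)[OF M(2,3), unfolded b, unfolded x11 y11, simplified]
  have z13: "z$1$3 \<noteq> 0" using z0 z11 xy tI_0[OF M(4)] by blast
  have "(1 + l) * z$1$3 = (1 + m) * (t * z$1$3)" using uz xy by simp
  hence t1: "t * (1 + m) = 1 + l" using z13 by simp
  hence t0: "t \<noteq> 0" using nz by auto
  \<comment> \<open>The entry 13 of \<open>z = [x, y]\<close> is the difference of these two
    products.\<close>
  have "x$1$2 * y$2$3 \<noteq> 0 \<or> y$1$2 * x$2$3 \<noteq> 0" using z13 xy(3) by auto
  thus ?thesis
  proof
    assume "x$1$2 * y$2$3 \<noteq> 0"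
    hence "(2 - l) = (2 - m) * t"
      using bracket_tI(2)[OF M(1,2), unfolded b, unfolded x11, folded t_def] by simp
    with t1 have "t * (3 * (l - m)) = 0" by algebra
    thus ?thesis using t0 by simp
  next
    assume "y$1$2 * x$2$3 \<noteq> 0"
    hence "(2 - l) = (2 * m - 1) * t"
      using bracket_tI(3)[OF M(1,2), unfolded b, unfolded x11, folded t_def] by simp
    with t1 have "t * (3 * (l * m - 1)) = 0" by algebra
    hence "l * m = 1" using t0 by simp
    hence "cmod l * cmod m = 1" by (metis norm_mult norm_one)
    moreover have "cmod l * cmod m < 1 * 1"
      using lm by (intro mult_strict_mono') auto
    ultimately show ?thesis by simp
  qed
qed

text \<open>\<open>?P\<close> and \<open>?Q\<close> are joint eigenvectors of \<open>?U\<close> and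
  \<open>?X\<close> with weights \<open>(3, 1)\<close> and \<open>(3, -1)\<close>. In
  \<open>tI m\<close> the weights on such a joint eigenvector are one factor times the 11 entries of
  the two acting elements, so both ratios would have to agree.\<close>

lemma tII_not_tI: "\<not> lie_embedding F tII (tI m)"
proof
  assume F: "lie_embedding F tII (tI m)"
  let ?U = "tri 1 1 0 0 0" and ?X = "mat_unit 1 2 + mat_unit 2 1 :: complex^3^3"
  let ?P = "tri 0 0 0 1 1" and ?Q = "tri 0 0 0 (- 1) 1"
  have mem: "?U \<in> tII" "?X \<in> tII" "?P \<in> tII" "?Q \<in> tII" by (simp_all add: tII_def)
  have br: "lie_bracket ?U ?P = 3 *\<^sub>C ?P" "lie_bracket ?X ?P = 1 *\<^sub>C ?P"
    "lie_bracket ?U ?Q = 3 *\<^sub>C ?Q" "lie_bracket ?X ?Q = (- 1) *\<^sub>C ?Q"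
    by (simp_all add: bracket_nth mult3 mat3_eq)
  define u x where ux: "u = F ?U" "x = F ?X"
  have M: "u \<in> tI m" "x \<in> tI m" using F mem by (auto simp: lie_embedding_def ux)
  have Fb: "F (lie_bracket A B) = lie_bracket (F A) (F B)" if "A \<in> tII" "B \<in> tII" for A B
    using F that by (auto simp: lie_embedding_def)
  have Fs: "F (c *\<^sub>C A) = c *\<^sub>C F A" if "A \<in> tII" for A c
    using F that by (auto simp: lie_embedding_def)
  have weight: "3 * x$1$1 = \<epsilon> * u$1$1 \<and> u$1$1 \<noteq> 0"
    if p: "p \<in> tI m" "p \<noteq> 0" "lie_bracket u p = 3 *\<^sub>C p" "lie_bracket x p = \<epsilon> *\<^sub>C p" for p \<epsilon>
  proof -
    have p11: "p$1$1 = 0" using bracket_tI(1)[OF M(1) p(1)] unfolding p(3) by simp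
    have key: ?thesis if "3 * w = k * u$1$1 * w" "\<epsilon> * w = k * x$1$1 * w" "w \<noteq> 0" for k w :: complex
    proof -
      have "3 = k * u$1$1" "\<epsilon> = k * x$1$1" using that by simp_all
      moreover from this have "3 * x$1$1 = \<epsilon> * u$1$1" by simp
      ultimately show ?thesis by auto
    qed
    consider "p$1$2 \<noteq> 0" | "p$2$3 \<noteq> 0" | "p$1$2 = 0" "p$2$3 = 0" "p$1$3 \<noteq> 0"
      using tI_0[OF p(1) p11] p(2) by blast
    thus ?thesis
    proof cases
      case 1
      show ?thesis
        using bracket_tI(2)[OF M(1) p(1)] bracket_tI(2)[OF M(2) p(1)] unfolding p(3,4) p11
        by (intro key[of "p$1$2" "2 - m"] 1) simp_all
    next
      case 2
      show ?thesis
        using bracket_tI(3)[OF M(1) p(1)] bracket_tI(3)[OF M(2) p(1)] unfolding p(3,4) p11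
        by (intro key[of "p$2$3" "2 * m - 1"] 2) simp_all
    next
      case 3
      show ?thesis
        using bracket_tI(4)[OF M(1) p(1)] bracket_tI(4)[OF M(2) p(1)] 3(1,2) unfolding p(3,4) p11
        by (intro key[of "p$1$3" "1 + m"] 3(3)) simp_all
    qed
  qed
  have "?P \<noteq> 0" using tri_nth(3)[of 0 0 0 1 1] by force
  hence "F ?P \<noteq> 0" using F mem(3) by (auto simp: lie_embedding_def)
  moreover have "F ?P \<in> tI m" using F mem by (auto simp: lie_embedding_def)
  moreover have "lie_bracket u (F ?P) = 3 *\<^sub>C F ?P" "lie_bracket x (F ?P) = 1 *\<^sub>C F ?P"
    unfolding ux by (simp_all only: Fb[symmetric] mem br Fs)
  ultimately have 1: "3 * x$1$1 = 1 * u$1$1" "u$1$1 \<noteq> 0" using weight by blast+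
  have "?Q \<noteq> 0" using tri_nth(3)[of 0 0 0 "- 1" 1] by force
  hence "F ?Q \<noteq> 0" using F mem(4) by (auto simp: lie_embedding_def)
  moreover have "F ?Q \<in> tI m" using F mem by (auto simp: lie_embedding_def)
  moreover have "lie_bracket u (F ?Q) = 3 *\<^sub>C F ?Q" "lie_bracket x (F ?Q) = (- 1) *\<^sub>C F ?Q"
    unfolding ux by (simp_all only: Fb[symmetric] mem br Fs)
  ultimately have 2: "3 * x$1$1 = - 1 * u$1$1" using weight by blast
  have "2 * u$1$1 = 0" using 1(1) 2 by algebra
  thus False using 1(2) by simp
qed

section \<open>Complex structures and their eigenspaces\<close>

definition cmat_of :: "real^'n^'n \<Rightarrow> complex^'n^'n" where
  "cmat_of = map_matrix complex_of_real"

definition re_mat :: "complex^'n^'n \<Rightarrow> real^'n^'n" where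
  "re_mat = map_matrix Re"

definition im_mat :: "complex^'n^'n \<Rightarrow> real^'n^'n" where
  "im_mat = map_matrix Im"

lemma cmat_nth [simp]:
  "cmat_of A $ i $ j = complex_of_real (A$i$j)" "re_mat B $ i $ j = Re (B$i$j)" "im_mat B $ i $ j = Im (B$i$j)"
  by (simp_all add: cmat_of_def re_mat_def im_mat_def)

definition cplx :: "real^'n^'n \<Rightarrow> real^'n^'n \<Rightarrow> complex^'n^'n" where
  "cplx A B = cmat_of A + \<i> *\<^sub>C cmat_of B"

lemma re_im_cplx [simp]: "re_mat (cplx A B) = A" "im_mat (cplx A B) = B"
  by (simp_all add: cplx_def vec_eq_iff)

lemma cplx_re_im [simp]: "cplx (re_mat A) (im_mat A) = A"
  by (simp add: cplx_def vec_eq_iff complex_eq_iff)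

lemma cplx_eqI: "re_mat A = re_mat B \<Longrightarrow> im_mat A = im_mat B \<Longrightarrow> A = B"
  by (metis cplx_re_im)

lemma re_im_add [simp]: "re_mat (A + B) = re_mat A + re_mat B" "im_mat (A + B) = im_mat A + im_mat B"
  and re_im_cscale: "re_mat (c *\<^sub>C A) = Re c *\<^sub>R re_mat A - Im c *\<^sub>R im_mat A"
    "im_mat (c *\<^sub>C A) = Re c *\<^sub>R im_mat A + Im c *\<^sub>R re_mat A"
  and re_im_conj [simp]: "re_mat (conj_mat A) = re_mat A" "im_mat (conj_mat A) = - im_mat A"
  and re_im_0 [simp]: "re_mat 0 = 0" "im_mat 0 = 0"
  by (simp_all add: vec_eq_iff)

lemma re_im_bracket:
  "re_mat (lie_bracket A B) = lie_bracket (re_mat A) (re_mat B) - lie_bracket (im_mat A) (im_mat B)"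
  "im_mat (lie_bracket A B) = lie_bracket (re_mat A) (im_mat B) + lie_bracket (im_mat A) (re_mat B)"
  by (simp_all add: vec_eq_iff lie_bracket_def matrix_matrix_mult_def sum_subtractf sum.distrib algebra_simps)

lemma sl_re_im: "A \<in> sl \<longleftrightarrow> re_mat A \<in> sl \<and> im_mat A \<in> sl"
  by (simp add: sl_def trace_def complex_eq_iff)

lemma extension_cplx: "complex_linear_extension J A = cplx (J (re_mat A)) (J (im_mat A))"
  by (simp add: complex_linear_extension_def cplx_def cmat_of_def re_mat_def im_mat_def)

lemma sl_closed:
  fixes A B :: "real^'n^'n"
  shows "0 \<in> (sl :: (real^'n^'n) set)" "A \<in> sl \<Longrightarrow> B \<in> sl \<Longrightarrow> A + B \<in> sl"
    "A \<in> sl \<Longrightarrow> B \<in> sl \<Longrightarrow> A - B \<in> sl" "A \<in> sl \<Longrightarrow> c *\<^sub>R A \<in> sl" "A \<in> sl \<Longrightarrow> - A \<in> sl"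
    "lie_bracket A B \<in> sl"
proof -
  show "lie_bracket A B \<in> sl"
    by (simp add: sl_def lie_bracket_def trace_sub) (rule trace_mul_sym)
qed (simp_all add: sl_def trace_add trace_sub trace_uminus, simp_all add: trace_def flip: sum_distrib_left)

lemma linear_on_slD:
  assumes "linear_on_sl f"
  shows "A \<in> sl \<Longrightarrow> f A \<in> sl" "A \<in> sl \<Longrightarrow> B \<in> sl \<Longrightarrow> f (A + B) = f A + f B"
    "A \<in> sl \<Longrightarrow> f (c *\<^sub>R A) = c *\<^sub>R f A" "A \<in> sl \<Longrightarrow> f (- A) = - f A"
    "A \<in> sl \<Longrightarrow> B \<in> sl \<Longrightarrow> f (A - B) = f A - f B" "f 0 = 0"
proof -
  show 1: "A \<in> sl \<Longrightarrow> f A \<in> sl" and 2: "A \<in> sl \<Longrightarrow> B \<in> sl \<Longrightarrow> f (A + B) = f A + f B"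
    and 3: "A \<in> sl \<Longrightarrow> f (c *\<^sub>R A) = c *\<^sub>R f A" for A B c
    using assms by (auto simp: linear_on_sl_def)
  show 4: "A \<in> sl \<Longrightarrow> f (- A) = - f A" for A using 3[of A "- 1"] by simp
  show "A \<in> sl \<Longrightarrow> B \<in> sl \<Longrightarrow> f (A - B) = f A - f B"
    using 2[of A "- B"] 4[of B] sl_closed(5)[of B] by simp
  show "f 0 = 0" using 3[OF sl_closed(1), of 0] by simp
qed

lemma complex_structureD:
  assumes "complex_structure J"
  shows "linear_on_sl J" "A \<in> sl \<Longrightarrow> J (J A) = - A"
    "A \<in> sl \<Longrightarrow> B \<in> sl \<Longrightarrow>
      J (lie_bracket A B - lie_bracket (J A) (J B)) = lie_bracket A (J B) + lie_bracket (J A) B"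
proof -
  show lin: "linear_on_sl J" and sq: "A \<in> sl \<Longrightarrow> J (J A) = - A" for A
    using assms by (auto simp: complex_structure_def)
  assume A: "A \<in> sl" and B: "B \<in> sl"
  let ?S = "lie_bracket (J A) B + lie_bracket A (J B)"
  have S: "?S \<in> sl" by (intro sl_closed)
  have "lie_bracket A B + J ?S - lie_bracket (J A) (J B) = 0"
    using assms A B by (auto simp: complex_structure_def)
  hence "lie_bracket A B - lie_bracket (J A) (J B) = - J ?S" by (simp add: algebra_simps eq_neg_iff_add_eq_0)
  hence "J (lie_bracket A B - lie_bracket (J A) (J B)) = - J (J ?S)"
    using linear_on_slD(4)[OF lin linear_on_slD(1)[OF lin S]] by simp
  thus "J (lie_bracket A B - lie_bracket (J A) (J B)) = lie_bracket A (J B) + lie_bracket (J A) B"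
    using sq[OF S] by (simp add: add.commute)
qed

text \<open>For \<open>A = X + \<i> Y\<close> the equation \<open>J A = - \<i> A\<close> reads
  \<open>J X = Y\<close> and \<open>J Y = - X\<close>; the second follows from the first since
  \<open>J (J X) = - X\<close>.\<close>

definition eigenspace :: "(real^'n^'n \<Rightarrow> real^'n^'n) \<Rightarrow> (complex^'n^'n) set" where
  "eigenspace J = {A \<in> sl. im_mat A = J (re_mat A)}"

text \<open>Integrability of \<open>J\<close> is what closes the eigenspace under brackets; the
  direct sum is the splitting of \<open>sl\<close> into the eigenspaces for \<open>- \<i>\<close>
  and \<open>\<i>\<close>.\<close>

lemma inv_subalgebra_eigenspace:
  fixes J :: "real^'n^'n \<Rightarrow> real^'n^'n"
  assumes J: "complex_structure J"
  shows "inv_subalgebra conj_mat (eigenspace J)"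
proof -
  note lin = linear_on_slD[OF complex_structureD(1)[OF J]]
  note sq = complex_structureD(2)[OF J]
  have sl: "re_mat A \<in> sl" if "A \<in> eigenspace J" for A using that by (simp add: eigenspace_def sl_re_im)
  have E: "A \<in> eigenspace J \<longleftrightarrow> re_mat A \<in> sl \<and> im_mat A = J (re_mat A)" for A
    by (auto simp: eigenspace_def sl_re_im lin(1))
  have "cmat.subspace (eigenspace J)"
    unfolding cmat.subspace_def
  proof (intro conjI ballI allI)
    show "0 \<in> eigenspace J" by (simp add: E lin sl_closed)
    fix A assume A: "A \<in> eigenspace J"
    show "A + B \<in> eigenspace J" if "B \<in> eigenspace J" for B
      using A that by (simp add: E lin sl_closed)
    show "c *\<^sub>C A \<in> eigenspace J" for c
      using A by (simp add: E re_im_cscale lin sl_closed sq)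
  qed
  moreover have "lie_bracket A B \<in> eigenspace J" if "A \<in> eigenspace J" "B \<in> eigenspace J" for A B
    using that by (simp add: E re_im_bracket sl_closed complex_structureD(3)[OF J])
  moreover have "eigenspace J \<inter> conj_mat ` eigenspace J = {0}"
  proof -
    have "A = 0" if A: "A \<in> eigenspace J" "A = conj_mat B" "B \<in> eigenspace J" for A B
    proof -
      have "J (re_mat B) = - J (re_mat B)" using A unfolding E by simp
      hence 0: "J (re_mat B) = 0" by (simp add: vec_eq_iff)
      hence "re_mat B = 0" using sq[OF sl[OF A(3)]] lin(6) by simp
      thus ?thesis using A 0 unfolding E by (intro cplx_eqI) simp_all
    qed
    moreover have 0: "0 \<in> eigenspace J" by (simp add: E lin sl_closed)
    moreover have "0 \<in> conj_mat ` eigenspace J"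
      by (rule image_eqI[OF _ 0]) (simp add: vec_eq_iff)
    ultimately show ?thesis by blast
  qed
  moreover have "{A + B |A B. A \<in> eigenspace J \<and> B \<in> conj_mat ` eigenspace J} = sl"
  proof (intro equalityI subsetI)
    fix C assume "C \<in> {A + B |A B. A \<in> eigenspace J \<and> B \<in> conj_mat ` eigenspace J}"
    then obtain A B where "A \<in> eigenspace J" "B \<in> eigenspace J" "C = A + conj_mat B" by blast
    thus "C \<in> sl" unfolding E by (simp add: sl_re_im lin sl_closed)
  next
    fix C :: "complex^'n^'n" assume "C \<in> sl"
    hence C: "re_mat C \<in> sl" "im_mat C \<in> sl" by (simp_all add: sl_re_im)
    \<comment> \<open>The real parts of the components of \<open>C\<close> under the projections
      \<open>(1 + \<i> J) / 2\<close> and \<open>(1 - \<i> J) / 2\<close>.\<close>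
    define A B where AB: "A = (1/2) *\<^sub>R (re_mat C - J (im_mat C))" "B = (1/2) *\<^sub>R (re_mat C + J (im_mat C))"
    have sl: "A \<in> sl" "B \<in> sl" unfolding AB by (intro sl_closed C lin(1))+
    have JA: "J A = (1/2) *\<^sub>R (J (re_mat C) + im_mat C)" "J B = (1/2) *\<^sub>R (J (re_mat C) - im_mat C)"
      unfolding AB using C by (simp_all add: lin sl_closed sq)
    have "C = cplx A (J A) + conj_mat (cplx B (J B))"
    proof (rule cplx_eqI)
      show "re_mat C = re_mat (cplx A (J A) + conj_mat (cplx B (J B)))"
        by (simp add: AB vec_eq_iff field_simps)
      show "im_mat C = im_mat (cplx A (J A) + conj_mat (cplx B (J B)))"
        by (simp add: JA vec_eq_iff field_simps)
    qed
    moreover have "cplx A (J A) \<in> eigenspace J" "cplx B (J B) \<in> eigenspace J"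
      by (simp_all add: E sl)
    ultimately show "C \<in> {A + B |A B. A \<in> eigenspace J \<and> B \<in> conj_mat ` eigenspace J}" by blast
  qed
  ultimately show ?thesis unfolding inv_subalgebra_def by (auto simp: eigenspace_def)
qed

text \<open>The eigenvalue equation puts \<open>M\<close> inside the eigenspace; as both are
  complementary to their conjugates, the inclusion is an equality.\<close>

lemma corresponds_iff:
  assumes M: "inv_subalgebra conj_mat M" and K: "complex_structure K"
  shows "corresponds M K \<longleftrightarrow> M = eigenspace K"
proof
  assume c: "corresponds M K"
  have sub: "M \<subseteq> eigenspace K"
  proof
    fix A assume A: "A \<in> M"
    have "complex_linear_extension K A = (- \<i>) *\<^sub>C A" using c A by (simp add: corresponds_def)
    hence "re_mat (cplx (K (re_mat A)) (K (im_mat A))) = re_mat ((- \<i>) *\<^sub>C A)" by (simp only: extension_cplx)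
    hence "K (re_mat A) = im_mat A" by (simp only: re_im_cplx re_im_cscale) simp
    thus "A \<in> eigenspace K" using A M by (auto simp: eigenspace_def inv_subalgebra_def)
  qed
  have E: "inv_subalgebra conj_mat (eigenspace K)" by (rule inv_subalgebra_eigenspace[OF K])
  have "eigenspace K \<subseteq> M"
  proof
    fix A assume A: "A \<in> eigenspace K"
    hence "A \<in> sl" by (simp add: eigenspace_def)
    then obtain X Y where XY: "X \<in> M" "Y \<in> M" "A = X + conj_mat Y"
      using M unfolding inv_subalgebra_def by blast
    have "conj_mat Y = A - X" using XY by simp
    also have "\<dots> \<in> eigenspace K"
      using E A XY sub by (intro cmat.subspace_diff) (auto simp: inv_subalgebra_def)
    finally have "conj_mat Y \<in> eigenspace K \<inter> conj_mat ` eigenspace K" using XY sub by blast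
    hence "conj_mat Y = 0" using E by (auto simp: inv_subalgebra_def)
    thus "A \<in> M" using XY by simp
  qed
  thus "M = eigenspace K" using sub by blast
next
  note lin = linear_on_slD[OF complex_structureD(1)[OF K]]
  note sq = complex_structureD(2)[OF K]
  assume M_eq: "M = eigenspace K"
  have "complex_linear_extension K A = (- \<i>) *\<^sub>C A" if "A \<in> M" for A
  proof (rule cplx_eqI)
    have A: "re_mat A \<in> sl" "im_mat A = K (re_mat A)" using that by (auto simp: M_eq eigenspace_def sl_re_im)
    show "re_mat (complex_linear_extension K A) = re_mat ((- \<i>) *\<^sub>C A)"
      "im_mat (complex_linear_extension K A) = im_mat ((- \<i>) *\<^sub>C A)"
      using A sq by (simp_all add: extension_cplx re_im_cscale del: cmat.scale_minus_left)
  qed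
  moreover have "complex_linear_extension K (conj_mat A) = \<i> *\<^sub>C conj_mat A" if "A \<in> M" for A
  proof (rule cplx_eqI)
    have A: "re_mat A \<in> sl" "im_mat A = K (re_mat A)" using that by (auto simp: M_eq eigenspace_def sl_re_im)
    show "re_mat (complex_linear_extension K (conj_mat A)) = re_mat (\<i> *\<^sub>C conj_mat A)"
      "im_mat (complex_linear_extension K (conj_mat A)) = im_mat (\<i> *\<^sub>C conj_mat A)"
      using A sq lin(1,4) by (simp_all add: extension_cplx re_im_cscale)
  qed
  ultimately show "corresponds M K" using K by (auto simp: corresponds_def)
qed

text \<open>The restriction of \<open>f\<close> to real matrices; if \<open>f\<close> commutes with
  \<open>conj_mat\<close>, then \<open>f (cmat_of A)\<close> is already real.\<close>

definition real_part :: "(complex^'n^'n \<Rightarrow> complex^'n^'n) \<Rightarrow> real^'n^'n \<Rightarrow> real^'n^'n" where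
  "real_part f A = re_mat (f (cmat_of A))"

lemma cmat_of_real_part:
  assumes "lie_iso conj_mat conj_mat f"
  shows "cmat_of (real_part f A) = f (cmat_of A)"
proof -
  have "conj_mat (cmat_of A) = cmat_of A" by (simp add: vec_eq_iff)
  hence "conj_mat (f (cmat_of A)) = f (cmat_of A)"
    unfolding lie_isoD(6)[OF assms, symmetric] by simp
  hence "im_mat (f (cmat_of A)) = - im_mat (f (cmat_of A))" using re_im_conj(2) by metis
  hence "im_mat (f (cmat_of A)) = 0" by (simp add: vec_eq_iff)
  thus ?thesis by (simp add: real_part_def vec_eq_iff complex_eq_iff)
qed

lemma lie_iso_cplx:
  assumes "lie_iso conj_mat conj_mat f"
  shows "f (cplx A B) = cplx (real_part f A) (real_part f B)"
  by (simp add: cplx_def lie_isoD(2,3)[OF assms] cmat_of_real_part[OF assms])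

lemma cmat_of_inj: "cmat_of A = cmat_of B \<Longrightarrow> A = B"
  by (simp add: vec_eq_iff)

lemma cmat_of_bracket: "cmat_of (lie_bracket A B) = lie_bracket (cmat_of A) (cmat_of B)"
  by (simp add: vec_eq_iff lie_bracket_def matrix_matrix_mult_def)

lemma sl_cmat_of: "cmat_of A \<in> sl \<longleftrightarrow> A \<in> sl"
proof -
  have "trace (cmat_of A) = complex_of_real (trace A)" by (simp add: trace_def)
  thus ?thesis by (simp add: sl_def)
qed

lemma real_part_inv:
  assumes f: "lie_iso conj_mat conj_mat f"
  shows "real_part (inv f) (real_part f A) = A" "real_part f (real_part (inv f) A) = A"
proof -
  have b: "bij f" using f by (rule lie_isoD)
  show "real_part (inv f) (real_part f A) = A" "real_part f (real_part (inv f) A) = A"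
    by (rule cmat_of_inj, simp add: cmat_of_real_part f lie_iso_inv bij_is_inj bij_is_surj b surj_f_inv_f)+
qed

lemma lie_automorphism_real_part:
  fixes f :: "complex^'n^'n \<Rightarrow> complex^'n^'n"
  assumes f: "lie_iso conj_mat conj_mat f"
  shows "lie_automorphism (real_part f)"
proof -
  have sl: "real_part f A \<in> sl" if "A \<in> sl" "lie_iso conj_mat conj_mat f" for A and f :: "complex^'n^'n \<Rightarrow> complex^'n^'n"
    using that lie_isoD(5)[OF that(2), of "cmat_of A"] cmat_of_real_part[OF that(2), of A]
      sl_cmat_of[of A] sl_cmat_of[of "real_part f A"] by (simp add: sl_def)
  have add: "real_part f (A + B) = real_part f A + real_part f B" for A B
  proof -
    have "cmat_of (A + B) = cmat_of A + cmat_of B" by (simp add: vec_eq_iff)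
    thus ?thesis by (simp add: real_part_def lie_isoD(2)[OF f])
  qed
  have scale: "real_part f (c *\<^sub>R A) = c *\<^sub>R real_part f A" for A c
  proof -
    have "cmat_of (c *\<^sub>R A) = complex_of_real c *\<^sub>C cmat_of A" by (simp add: vec_eq_iff)
    thus ?thesis by (simp add: real_part_def lie_isoD(3)[OF f] re_im_cscale)
  qed
  have "real_part f (lie_bracket A B) = lie_bracket (real_part f A) (real_part f B)" for A B
    by (rule cmat_of_inj) (simp add: cmat_of_real_part[OF f] cmat_of_bracket lie_isoD(4)[OF f])
  moreover have "bij_betw (real_part f) sl sl"
    by (rule bij_betw_byWitness[of _ "real_part (inv f)"])
      (use sl f lie_iso_inv[OF f] in \<open>auto simp: real_part_inv\<close>)
  ultimately show ?thesis using sl f by (simp add: lie_automorphism_def linear_on_sl_def add scale)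
qed

text \<open>\<open>K\<close> is \<open>J\<close> conjugated by \<open>f\<close>, so moving the
  eigenspace by \<open>f\<close> amounts to passing to an equivalent structure.\<close>

lemma transported_structure:
  fixes J :: "real^'n^'n \<Rightarrow> real^'n^'n"
  assumes J: "complex_structure J" and f: "lie_iso conj_mat conj_mat f"
  defines "K \<equiv> \<lambda>A. real_part f (J (real_part (inv f) A))"
  shows "complex_structure K" "equivalent_structures J K" "eigenspace K = f ` eigenspace J"
proof -
  let ?p = "real_part f" and ?q = "real_part (inv f)"
  note linJ = linear_on_slD[OF complex_structureD(1)[OF J]]
  have p: "lie_automorphism ?p" and q: "lie_automorphism ?q"
    using f lie_iso_inv[OF f] by (auto intro: lie_automorphism_real_part)
  have lp: "linear_on_sl ?p" "linear_on_sl ?q" using p q by (simp_all add: lie_automorphism_def)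
  note linp = linear_on_slD[OF lp(1)] and linq = linear_on_slD[OF lp(2)]
  have br: "?p (lie_bracket A B) = lie_bracket (?p A) (?p B)" "?q (lie_bracket A B) = lie_bracket (?q A) (?q B)"
    if "A \<in> sl" "B \<in> sl" for A B using p q that by (simp_all add: lie_automorphism_def)
  note pq = real_part_inv[OF f]
  show "complex_structure K"
    unfolding complex_structure_def
  proof (intro conjI ballI)
    show "linear_on_sl K"
      by (simp add: linear_on_sl_def K_def linJ linp linq)
    fix A :: "real^'n^'n" assume A: "A \<in> sl"
    show "K (K A) = - A"
      using A by (simp add: K_def pq complex_structureD(2)[OF J] linq linp)
    fix B :: "real^'n^'n" assume B: "B \<in> sl"
    have "lie_bracket A B + K (lie_bracket (K A) B + lie_bracket A (K B)) - lie_bracket (K A) (K B)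
      = ?p (lie_bracket (?q A) (?q B) + J (lie_bracket (J (?q A)) (?q B) + lie_bracket (?q A) (J (?q B)))
          - lie_bracket (J (?q A)) (J (?q B)))"
      using A B by (simp add: K_def linp linq linJ sl_closed br pq)
    also have "\<dots> = 0"
      using J A B linq(1) linp(6) by (simp add: complex_structure_def)
    finally show "lie_bracket A B + K (lie_bracket (K A) B + lie_bracket A (K B)) - lie_bracket (K A) (K B) = 0" .
  qed
  show "equivalent_structures J K"
    unfolding equivalent_structures_def using q by (intro exI[of _ ?q]) (simp add: K_def pq)
  show "eigenspace K = f ` eigenspace J"
  proof (intro equalityI subsetI)
    fix A assume "A \<in> eigenspace K"
    hence A: "re_mat A \<in> sl" "im_mat A = ?p (J (?q (re_mat A)))" by (auto simp: eigenspace_def K_def sl_re_im)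
    have "A = f (cplx (?q (re_mat A)) (J (?q (re_mat A))))"
      unfolding lie_iso_cplx[OF f] pq using A by (metis cplx_re_im)
    moreover have "cplx (?q (re_mat A)) (J (?q (re_mat A))) \<in> eigenspace J"
      using A by (simp add: eigenspace_def sl_re_im linJ linq)
    ultimately show "A \<in> f ` eigenspace J" by blast
  next
    fix A assume "A \<in> f ` eigenspace J"
    then obtain B where B: "B \<in> eigenspace J" "A = f B" by blast
    have "A = cplx (?p (re_mat B)) (?p (im_mat B))"
      using lie_iso_cplx[OF f, of "re_mat B" "im_mat B"] B by simp
    thus "A \<in> eigenspace K"
      using B(1) by (simp add: eigenspace_def sl_re_im K_def pq linp linJ)
  qed
qed

section \<open>Equivalence of complex structures\<close>

lemma lie_automorphism_inv:
  fixes f :: "real^'n^'n \<Rightarrow> real^'n^'n"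
  assumes "lie_automorphism f"
  shows "lie_automorphism (inv_into sl f)"
proof -
  let ?g = "inv_into sl f"
  have b: "bij_betw f sl sl" and lin: "linear_on_sl f"
    and br: "\<And>A B. A \<in> sl \<Longrightarrow> B \<in> sl \<Longrightarrow> f (lie_bracket A B) = lie_bracket (f A) (f B)"
    using assms by (simp_all add: lie_automorphism_def)
  note L = linear_on_slD[OF lin]
  have g: "?g A \<in> sl" "f (?g A) = A" if "A \<in> sl" for A
    using that b by (simp_all add: bij_betw_def inv_into_into f_inv_into_f)
  have eq: "?g A = B" if "B \<in> sl" "f B = A" for A B
    using that b by (auto simp: bij_betw_def)
  have "linear_on_sl ?g"
    unfolding linear_on_sl_def
  proof (intro conjI ballI allI)
    fix A B :: "real^'n^'n" and c assume A: "A \<in> sl"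
    show "?g A \<in> sl" using g A by blast
    show "?g (c *\<^sub>R A) = c *\<^sub>R ?g A" using A by (intro eq) (simp_all add: g L sl_closed)
    assume B: "B \<in> sl"
    show "?g (A + B) = ?g A + ?g B" using A B by (intro eq) (simp_all add: g L sl_closed)
  qed
  moreover have "?g (lie_bracket A B) = lie_bracket (?g A) (?g B)" if "A \<in> sl" "B \<in> sl" for A B
    using that by (intro eq) (simp_all add: g br sl_closed)
  moreover have "bij_betw ?g sl sl" using b by (rule bij_betw_inv_into)
  ultimately show ?thesis by (simp add: lie_automorphism_def)
qed

text \<open>\<open>K\<close> preserves \<open>sl\<close> by linearity on \<open>sl\<close>, so
  \<open>inv_into sl f\<close> cancels \<open>f\<close> on the values of \<open>K\<close>.\<close>

lemma equivalent_structures_sym: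
  assumes "equivalent_structures J K" and K: "linear_on_sl K"
  shows "equivalent_structures K J"
proof -
  obtain f where f: "lie_automorphism f" "\<And>A. A \<in> sl \<Longrightarrow> J (f A) = f (K A)"
    using assms(1) by (auto simp: equivalent_structures_def)
  have b: "bij_betw f sl sl" using f by (simp add: lie_automorphism_def)
  have "K (inv_into sl f A) = inv_into sl f (J A)" if "A \<in> sl" for A
  proof -
    have g: "inv_into sl f A \<in> sl" "f (inv_into sl f A) = A"
      using that b by (simp_all add: bij_betw_def inv_into_into f_inv_into_f)
    have "f (K (inv_into sl f A)) = J A" using f(2)[OF g(1)] g(2) by simp
    moreover have "K (inv_into sl f A) \<in> sl" using linear_on_slD(1)[OF K g(1)] .
    ultimately show ?thesis using b by (metis bij_betw_def inv_into_f_f)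
  qed
  thus ?thesis using lie_automorphism_inv[OF f(1)] by (auto simp: equivalent_structures_def)
qed

lemma equivalent_structures_trans:
  assumes "equivalent_structures J K" "equivalent_structures K L"
  shows "equivalent_structures J L"
proof -
  obtain f where f: "lie_automorphism f" "\<And>A. A \<in> sl \<Longrightarrow> J (f A) = f (K A)"
    using assms(1) by (auto simp: equivalent_structures_def)
  obtain g where g: "lie_automorphism g" "\<And>A. A \<in> sl \<Longrightarrow> K (g A) = g (L A)"
    using assms(2) by (auto simp: equivalent_structures_def)
  have "lie_automorphism (\<lambda>A. f (g A))"
    using f(1) g(1) bij_betw_trans[of g sl sl f sl]
    by (simp add: lie_automorphism_def linear_on_sl_def o_def)
  moreover have "J (f (g A)) = f (g (L A))" if "A \<in> sl" for A
    using f(2)[of "g A"] g that by (simp add: lie_automorphism_def linear_on_sl_def)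
  ultimately show ?thesis unfolding equivalent_structures_def by (intro exI[of _ "\<lambda>A. f (g A)"]) simp
qed

text \<open>The witness is the complex linear extension of the real automorphism that intertwines
  \<open>J\<close> and \<open>K\<close>.\<close>

lemma equivalent_structures_embedding:
  fixes J K :: "real^'n^'n \<Rightarrow> real^'n^'n"
  assumes e: "equivalent_structures J K" and K: "linear_on_sl K"
  shows "\<exists>F. lie_embedding F (eigenspace K) (eigenspace J)"
proof -
  obtain f where f: "lie_automorphism f" "\<And>A. A \<in> sl \<Longrightarrow> J (f A) = f (K A)"
    using e by (auto simp: equivalent_structures_def)
  have lin: "linear_on_sl f" and br: "\<And>A B. A \<in> sl \<Longrightarrow> B \<in> sl \<Longrightarrow> f (lie_bracket A B) = lie_bracket (f A) (f B)"
    and inj: "inj_on f sl"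
    using f by (simp_all add: lie_automorphism_def bij_betw_def)
  note L = linear_on_slD[OF lin]
  have "lie_embedding (\<lambda>A. cplx (f (re_mat A)) (f (im_mat A))) (eigenspace K) (eigenspace J)"
    unfolding lie_embedding_def
  proof (intro conjI ballI allI impI)
    fix A :: "complex^'n^'n" and c assume "A \<in> eigenspace K"
    hence A: "re_mat A \<in> sl" "im_mat A \<in> sl" "im_mat A = K (re_mat A)" by (auto simp: eigenspace_def sl_re_im)
    show "cplx (f (re_mat A)) (f (im_mat A)) \<in> eigenspace J"
      using A f(2) by (simp add: eigenspace_def sl_re_im L)
    show "cplx (f (re_mat (c *\<^sub>C A))) (f (im_mat (c *\<^sub>C A))) = c *\<^sub>C cplx (f (re_mat A)) (f (im_mat A))"
      using A(1,2) by (intro cplx_eqI) (simp_all add: re_im_cscale L sl_closed)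
    show "A = 0" if "cplx (f (re_mat A)) (f (im_mat A)) = 0"
    proof (rule cplx_eqI)
      have "f (re_mat A) = f 0" "f (im_mat A) = f 0"
        using arg_cong[OF that, of re_mat] arg_cong[OF that, of im_mat] by (simp_all add: L)
      thus "re_mat A = re_mat 0" "im_mat A = im_mat 0"
        using inj A(1,2) sl_closed(1) by (auto dest: inj_onD)
    qed
    fix B :: "complex^'n^'n" assume "B \<in> eigenspace K"
    hence B: "re_mat B \<in> sl" "im_mat B \<in> sl" by (auto simp: eigenspace_def sl_re_im)
    show "cplx (f (re_mat (lie_bracket A B))) (f (im_mat (lie_bracket A B)))
      = lie_bracket (cplx (f (re_mat A)) (f (im_mat A))) (cplx (f (re_mat B)) (f (im_mat B)))"
      using A(1,2) B by (intro cplx_eqI) (simp_all add: re_im_bracket L sl_closed br)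
  qed
  thus ?thesis by blast
qed

text \<open>After passing to \<open>tlabel\<close> by \<open>twist\<close>, two labels of type I are
  compared by their weights; maps in both directions are assumed because types I and II are told
  apart by a map from \<open>tII\<close> to \<open>tI\<close>.\<close>

lemma label_rigid:
  assumes t: "t \<in> labels" "t' \<in> labels"
    and F: "lie_embedding F (label_algebra t) (label_algebra t')"
    and G: "lie_embedding G (label_algebra t') (label_algebra t)"
  shows "t = t'"
proof -
  have twisted: "\<exists>F. lie_embedding F (tlabel t) (tlabel t')"
    if F: "lie_embedding F (label_algebra t) (label_algebra t')" for F t t'
  proof -
    note D = lie_isoD[OF lie_iso_twist]
    have inj: "inv twist (twist A) = A" for A using D(1) by (simp add: bij_is_inj)
    have t0: "twist 0 = 0" using D(3)[of 0 0] by simp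
    have "twist A = 0 \<longleftrightarrow> A = 0" for A using inj[of A] inj[of 0] t0 by metis
    moreover have "twist X \<in> tlabel t'" if "X \<in> label_algebra t'" for X
      using that twist_label[of t'] by blast
    ultimately have "lie_embedding (\<lambda>A. twist (F (inv twist A))) (twist ` label_algebra t) (tlabel t')"
      using F unfolding lie_embedding_def
      by (simp add: ball_simps inj D(3,4)[symmetric] flip: D(4))
    thus ?thesis unfolding twist_label by blast
  qed
  obtain F' G' where FG: "lie_embedding F' (tlabel t) (tlabel t')" "lie_embedding G' (tlabel t') (tlabel t)"
    using twisted[OF F] twisted[OF G] by blast
  show ?thesis
    using t FG tI_rigid tII_not_tI by (cases t; cases t') (auto simp: labels_def)
qed

theorem theorem3p3:
  shows "(\<forall>t\<in>labels. invariant_complex_subalgebra (label_algebra t)) \<and>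
    (\<forall>J :: real^3^3 \<Rightarrow> real^3^3. complex_structure J \<longrightarrow>
       (\<exists>!t. t \<in> labels \<and>
          (\<exists>K. corresponds (label_algebra t) K \<and> equivalent_structures J K)))"
proof (intro conjI ballI allI impI)
  show "invariant_complex_subalgebra (label_algebra t)" if "t \<in> labels" for t
    using that by (simp add: invariant_complex_subalgebra_iff inv_subalgebra_label)
next
  fix J :: "real^3^3 \<Rightarrow> real^3^3" assume J: "complex_structure J"
  obtain t f where t: "t \<in> labels" "lie_iso conj_mat conj_mat f" "f ` eigenspace J = label_algebra t"
    using inv_subalgebra_classification[OF inv_subalgebra_eigenspace[OF J]] by blast
  \<comment> \<open>Moving \<open>J\<close> along \<open>f\<close> gives the structure whose
    eigenspace is the listed subalgebra.\<close>
  note T = transported_structure[OF J t(2)]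
  show "\<exists>!t. t \<in> labels \<and> (\<exists>K. corresponds (label_algebra t) K \<and> equivalent_structures J K)"
  proof (rule ex_ex1I)
    show "\<exists>t. t \<in> labels \<and> (\<exists>K. corresponds (label_algebra t) K \<and> equivalent_structures J K)"
      using t(1) T(2) T(3)[unfolded t(3)] corresponds_iff[OF inv_subalgebra_label[OF t(1)] T(1)] by metis
  next
    fix t t'
    assume t: "t \<in> labels \<and> (\<exists>K. corresponds (label_algebra t) K \<and> equivalent_structures J K)"
      and t': "t' \<in> labels \<and> (\<exists>K. corresponds (label_algebra t') K \<and> equivalent_structures J K)"
    obtain K where K: "corresponds (label_algebra t) K" "equivalent_structures J K" using t by blast
    obtain K' where K': "corresponds (label_algebra t') K'" "equivalent_structures J K'" using t' by blast
    have cs: "complex_structure K" "complex_structure K'" using K K' by (auto simp: corresponds_def)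
    note lin = complex_structureD(1)[OF cs(1)] complex_structureD(1)[OF cs(2)]
    have E: "label_algebra t = eigenspace K" "label_algebra t' = eigenspace K'"
      using corresponds_iff inv_subalgebra_label cs K K' t t' by metis+
    \<comment> \<open>Both structures are equivalent to \<open>J\<close>, hence to each other, so
      their eigenspaces embed in each other.\<close>
    have "equivalent_structures K' K" "equivalent_structures K K'"
      using equivalent_structures_trans equivalent_structures_sym K(2) K'(2) lin by metis+
    then obtain F G where "lie_embedding F (label_algebra t) (label_algebra t')"
        "lie_embedding G (label_algebra t') (label_algebra t)"
      unfolding E using equivalent_structures_embedding lin by blast
    thus "t = t'" using t t' label_rigid by blast
  qed
qed

end
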